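(* Let $n\ge4$ be an integer, $1<p<\frac n2$ and $\gamma\in(0,n)$. Then the embedding $E\hookrightarrow L^\varrho(\mathbb{R}^n,|x|^{-\gamma}dx)$ is compact for all (finite) $\varrho\ge p^\ast$, where $p^\ast:=\frac{np}{n-2p}$.
   Context: Here $\|\cdot\|_s$ is the $L^s(\mathbb{R}^n)$ norm. The space $E$ is the completion of $C_0^\infty(\mathbb{R}^n)$ (real-valued) with respect to the norm $\|u\|:=\left(\|\Delta u\|_{n/2}^{n/2}+\|\Delta u\|_p^{n/2}\right)^{2/n}$; by the Sobolev embedding $\|u\|_{p^\ast}\le C\|\Delta u\|_p$ its elements are regarded as functions in $L^{p^\ast}(\mathbb{R}^n)$ with distributional Laplacian in $L^p(\mathbb{R}^n)\cap L^{n/2}(\mathbb{R}^n)$. The space $L^\varrho(\mathbb{R}^n,|x|^{-\gamma}dx)$ consists of real-valued measurable $u$ with $|u|^\varrho|x|^{-\gamma}\in L^1(\mathbb{R}^n)$, with norm $\|u\|_{\varrho,\gamma}:=\left(\int_{\mathbb{R}^n}|u|^\varrho|x|^{-\gamma}dx\right)^{1/\varrho}$. *)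

theory Defs
  imports "HOL-Analysis.Analysis"
begin

text \<open>
  Elements of \<open>L\<^sup>s\<close> are represented by measurable functions; they are not identified when they agree
  almost everywhere, so all norms below are seminorms on functions.
\<close>

definition Lp_space :: "real \<Rightarrow> 'a measure \<Rightarrow> ('a \<Rightarrow> real) set" where
  "Lp_space s M = {u \<in> borel_measurable M. integrable M (\<lambda>x. \<bar>u x\<bar> powr s)}"

definition Lp_norm :: "real \<Rightarrow> 'a measure \<Rightarrow> ('a \<Rightarrow> real) \<Rightarrow> real" where
  "Lp_norm s M u = (\<integral>x. \<bar>u x\<bar> powr s \<partial>M) powr (1 / s)"

text \<open>The measure \<open>|x|\<close> to the power \<open>-\<gamma>\<close> times Lebesgue measure.\<close>

definition power_weight :: "real \<Rightarrow> ('a::euclidean_space) measure" where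
  "power_weight \<gamma> = density lebesgue (\<lambda>x. ennreal (norm x powr (- \<gamma>)))"

definition partial_deriv ::
    "'a::euclidean_space \<Rightarrow> ('a \<Rightarrow> real) \<Rightarrow> 'a \<Rightarrow> real" where
  "partial_deriv b f x = frechet_derivative f (at x) b"

fun C_k :: "nat \<Rightarrow> ('a::euclidean_space \<Rightarrow> real) \<Rightarrow> bool" where
  "C_k 0 f \<longleftrightarrow> continuous_on UNIV f"
| "C_k (Suc k) f \<longleftrightarrow>
     (\<forall>x. f differentiable (at x)) \<and> (\<forall>b\<in>Basis. C_k k (partial_deriv b f))"

definition test_functions :: "('a::euclidean_space \<Rightarrow> real) set" where
  "test_functions = {f. (\<forall>k. C_k k f) \<and> compact (closure {x. f x \<noteq> 0})}"

definition laplacian :: "('a::euclidean_space \<Rightarrow> real) \<Rightarrow> 'a \<Rightarrow> real" where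
  "laplacian f x = (\<Sum>b\<in>Basis. partial_deriv b (partial_deriv b f) x)"

definition locally_integrable :: "('a::euclidean_space \<Rightarrow> real) \<Rightarrow> bool" where
  "locally_integrable u \<longleftrightarrow> (\<forall>K. compact K \<longrightarrow> set_integrable lebesgue K u)"

definition has_distr_laplacian ::
    "('a::euclidean_space \<Rightarrow> real) \<Rightarrow> ('a \<Rightarrow> real) \<Rightarrow> bool" where
  "has_distr_laplacian u w \<longleftrightarrow>
     locally_integrable u \<and> locally_integrable w \<and>
     (\<forall>\<phi>\<in>test_functions.
        (\<integral>x. u x * laplacian \<phi> x \<partial>lebesgue) = (\<integral>x. w x * \<phi> x \<partial>lebesgue))"

text \<open>
  The distributional Laplacian is unique up to null sets, so the choice below is immaterial for
  norms.  It is meaningful only if some \<open>w\<close> satisfies \<open>has_distr_laplacian u w\<close>.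
\<close>

definition distr_laplacian :: "('a::euclidean_space \<Rightarrow> real) \<Rightarrow> 'a \<Rightarrow> real" where
  "distr_laplacian u = (SOME w. has_distr_laplacian u w)"

definition p_star :: "nat \<Rightarrow> real \<Rightarrow> real" where
  "p_star n p = real n * p / (real n - 2 * p)"

text \<open>The norm of \<open>E\<close> as a function of \<open>w = \<Delta>u\<close>.\<close>

definition laplacian_norm :: "real \<Rightarrow> ('a::euclidean_space \<Rightarrow> real) \<Rightarrow> real" where
  "laplacian_norm p w =
     (let n = real DIM('a)
      in (Lp_norm (n / 2) lebesgue w powr (n / 2) + Lp_norm p lebesgue w powr (n / 2)) powr (2 / n))"

definition E_norm :: "real \<Rightarrow> ('a::euclidean_space \<Rightarrow> real) \<Rightarrow> real" where
  "E_norm p u = laplacian_norm p (distr_laplacian u)"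

text \<open>
  The completion of the test functions for \<open>E_norm\<close>, realised inside \<open>L\<^sup>s\<close> with \<open>s = p_star n p\<close>.
  By the Sobolev inequality every Cauchy sequence \<open>\<phi>\<close> of test functions converges in \<open>L\<^sup>s\<close>, and its
  \<open>L\<^sup>s\<close>-limit \<open>u\<close> is the function representing its class in the completion; by completeness of the
  Lebesgue spaces the Laplacians of \<open>\<phi> k\<close> then converge to the distributional Laplacian of \<open>u\<close>.
  The last conjunct says that \<open>\<phi> k\<close> tends to \<open>u\<close> in the norm of \<open>E\<close>: the argument of
  \<open>laplacian_norm\<close> is the distributional Laplacian of \<open>\<phi> k - u\<close>.
\<close>

definition E_space :: "real \<Rightarrow> ('a::euclidean_space \<Rightarrow> real) set" where
  "E_space p = {u \<in> Lp_space (p_star DIM('a) p) lebesgue.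
     (\<exists>w. has_distr_laplacian u w) \<and>
     distr_laplacian u \<in> Lp_space p lebesgue \<inter> Lp_space (real DIM('a) / 2) lebesgue \<and>
     (\<exists>\<phi>. (\<forall>k::nat. \<phi> k \<in> test_functions) \<and>
        (\<lambda>k. Lp_norm (p_star DIM('a) p) lebesgue (\<lambda>x. \<phi> k x - u x)) \<longlonglongrightarrow> 0 \<and>
        (\<lambda>k. laplacian_norm p (\<lambda>x. laplacian (\<phi> k) x - distr_laplacian u x)) \<longlonglongrightarrow> 0)}"

text \<open>
  \<open>X\<close> with norm \<open>NX\<close> is continuously contained in \<open>Y\<close> with norm \<open>NY\<close>, and the inclusion map is a
  compact operator.
\<close>

definition compact_embedding ::
    "('a \<Rightarrow> real) set \<Rightarrow> (('a \<Rightarrow> real) \<Rightarrow> real) \<Rightarrow>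
     ('a \<Rightarrow> real) set \<Rightarrow> (('a \<Rightarrow> real) \<Rightarrow> real) \<Rightarrow> bool" where
  "compact_embedding X NX Y NY \<longleftrightarrow>
     X \<subseteq> Y \<and>
     (\<exists>C. \<forall>u\<in>X. NY u \<le> C * NX u) \<and>
     (\<forall>u. (\<forall>k::nat. u k \<in> X) \<and> (\<exists>B. \<forall>k. NX (u k) \<le> B) \<longrightarrow>
        (\<exists>r v. strict_mono (r :: nat \<Rightarrow> nat) \<and> v \<in> Y \<and>
           (\<lambda>k. NY (\<lambda>x. u (r k) x - v x)) \<longlonglongrightarrow> 0))"

end

theory Submission
  imports Defs "HOL-Complex_Analysis.Great_Picard"
begin

text \<open>
  A test function is recovered from its Laplacian \<open>w\<close> by convolution with the Newton kernel, a multiple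
  of \<open>|z|\<close> to the power \<open>2 - n\<close>. Splitting the kernel at \<open>|z| = 1\<close>, Young's inequality bounds the
  potential in \<open>L\<^sup>s\<close> for every \<open>s > p*\<close>, and Hoelder's inequality against the weight turns this into
  a bound in the weighted space for every \<open>\<rho> \<ge> p*\<close>. For compactness the kernel is replaced by the
  regularised kernel with \<open>|z|\<^sup>2 + \<epsilon>\<^sup>2\<close> in place of \<open>|z|\<^sup>2\<close>: the error is small in the weighted norm
  uniformly in \<open>w\<close>, the regularised potentials are bounded and equicontinuous, so a diagonal
  subsequence converges pointwise for all \<open>\<epsilon> = 1/m\<close>, and the mass outside a large ball is uniformly
  small since the weight \<open>\<gamma>\<close> may be relaxed to \<open>\<gamma>/2\<close>.
\<close>

section \<open>Hoelder and Young inequalities\<close>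

text \<open>At the critical exponent itself Young's inequality fails: it would need |z|^(2-n) to the
  power n/(n-2), which is integrable neither at 0 nor at infinity. Every convolution estimate
  therefore works strictly above it. The regularised kernel has two further merits. It is smooth
  with derivatives in closed form, so Green's identity holds on the whole space without spheres cut
  out around the singularity. And a small translation changes it by a small multiple of itself, so
  equicontinuity is uniform over the whole space and over all sources at once. Estimates are made
  for Laplacians of test functions, which are bounded with bounded support, so that every potential
  is an absolutely convergent integral; Fatou's lemma carries the bounds to the completion. Triangle
  inequalities are used only up to constant factors, whence the many 2, 4 and 8.\<close>

lemma distr_lborel_reflect:
  fixes x :: "'a::euclidean_space"
  shows "distr lborel borel (\<lambda>y. x - y) = lborel"
  by (subst (2) lborel_affine[of "-1" x]) (auto simp: density_1)

lemma nn_integral_translate: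
  fixes x :: "'a::euclidean_space"
  assumes [measurable]: "f \<in> borel_measurable borel"
  shows "(\<integral>\<^sup>+y. f (y - x) \<partial>lborel) = (\<integral>\<^sup>+y. f y \<partial>lborel)"
  using assms by (subst (2) lborel_distr_plus[of "-x", symmetric], subst nn_integral_distr) auto

lemma integral_translate:
  fixes f :: "'a::euclidean_space \<Rightarrow> real"
  assumes [measurable]: "f \<in> borel_measurable borel"
  shows "(\<integral>y. f (y + x) \<partial>lborel) = (\<integral>y. f y \<partial>lborel)"
  using assms by (subst (2) lborel_distr_plus[of "x", symmetric], subst integral_distr) (auto simp: add.commute)

lemma integrable_reflect:
  fixes f :: "'a::euclidean_space \<Rightarrow> real"
  assumes "integrable lborel f"
  shows "integrable lborel (\<lambda>y. f (x - y))"
    and "(\<integral>y. f (x - y) \<partial>lborel) = (\<integral>y. f y \<partial>lborel)"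
proof -
  have [measurable]: "f \<in> borel_measurable borel" using assms by auto
  have "integrable (distr lborel borel (\<lambda>y. x - y)) f"
    using assms by (simp add: distr_lborel_reflect)
  then show "integrable lborel (\<lambda>y. f (x - y))"
    by (subst (asm) integrable_distr_eq) auto
  show "(\<integral>y. f (x - y) \<partial>lborel) = (\<integral>y. f y \<partial>lborel)"
    by (subst (2) distr_lborel_reflect[of x, symmetric], subst integral_distr) auto
qed

text \<open>The exponents sit on integrable functions and add up to 1, so conjugate exponents never
  appear and the version for three factors follows by iteration. After division by the two integrals
  the claim is the pointwise weighted inequality of arithmetic and geometric means.\<close>

lemma Holder_inequality:
  fixes f g :: "'a \<Rightarrow> real"
  assumes "0 < \<alpha>" "0 < \<beta>" "\<alpha> + \<beta> = 1"
    and f: "integrable M f" "\<And>x. 0 \<le> f x" and g: "integrable M g" "\<And>x. 0 \<le> g x"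
  shows "integrable M (\<lambda>x. f x powr \<alpha> * g x powr \<beta>)"
    and "(\<integral>x. f x powr \<alpha> * g x powr \<beta> \<partial>M) \<le> (\<integral>x. f x \<partial>M) powr \<alpha> * (\<integral>x. g x \<partial>M) powr \<beta>"
proof -
  have [measurable]: "f \<in> borel_measurable M" "g \<in> borel_measurable M" using f g by auto
  have Y: "a powr \<alpha> * b powr \<beta> \<le> \<alpha> * a + \<beta> * b" if "0 \<le> a" "0 \<le> b" for a b :: real
    using Youngs_inequality_0[of \<alpha> \<beta> a b] that assms(1-3)
    by (cases "a = 0 \<or> b = 0") auto
  show int: "integrable M (\<lambda>x. f x powr \<alpha> * g x powr \<beta>)"
    by (rule Bochner_Integration.integrable_bound[of M "\<lambda>x. \<alpha> * f x + \<beta> * g x"])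
       (use f g Y assms(1,2) in \<open>auto intro!: AE_I2 simp: abs_mult\<close>)
  let ?F = "\<integral>x. f x \<partial>M" and ?G = "\<integral>x. g x \<partial>M"
  have nn: "0 \<le> ?F" "0 \<le> ?G" using f g by auto
  show "(\<integral>x. f x powr \<alpha> * g x powr \<beta> \<partial>M) \<le> ?F powr \<alpha> * ?G powr \<beta>"
  \<comment> \<open>Normalisation divides by both integrals; if one of them vanishes, its function
    and hence the product is zero almost everywhere.\<close>
  proof (cases "?F = 0 \<or> ?G = 0")
    case True
    then have "AE x in M. f x = 0 \<or> g x = 0"
      using integral_nonneg_eq_0_iff_AE[OF f(1)] integral_nonneg_eq_0_iff_AE[OF g(1)] f g by auto
    then have "(\<integral>x. f x powr \<alpha> * g x powr \<beta> \<partial>M) = 0"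
      by (intro integral_eq_zero_AE) auto
    then show ?thesis by simp
  next
    case False
    then have pos: "?F > 0" "?G > 0" using nn by auto
    let ?c = "?F powr \<alpha> * ?G powr \<beta>"
    have "(\<integral>x. f x powr \<alpha> * g x powr \<beta> \<partial>M)
        \<le> (\<integral>x. ?c * (\<alpha> * (f x / ?F) + \<beta> * (g x / ?G)) \<partial>M)"
    proof (rule integral_mono[OF int])
      show "integrable M (\<lambda>x. ?c * (\<alpha> * (f x / ?F) + \<beta> * (g x / ?G)))" using f g by auto
      fix x
      have "f x powr \<alpha> * g x powr \<beta> = ?c * ((f x / ?F) powr \<alpha> * (g x / ?G) powr \<beta>)"
        using pos f g by (simp add: powr_divide)
      also have "\<dots> \<le> ?c * (\<alpha> * (f x / ?F) + \<beta> * (g x / ?G))"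
        using pos f g by (intro mult_left_mono Y) auto
      finally show "f x powr \<alpha> * g x powr \<beta> \<le> \<dots>" .
    qed
    also have "\<dots> = ?c * (\<alpha> * (?F / ?F) + \<beta> * (?G / ?G))"
      using f g by simp
    also have "\<dots> = ?c" using pos assms(3) by simp
    finally show ?thesis .
  qed
qed

text \<open>Two applications of the inequality for two factors: g and h are merged with their
  exponents rescaled to sum 1, and the merged function receives the exponent \<beta> +
  \<delta>.\<close>

lemma Holder_inequality3:
  fixes f g h :: "'a \<Rightarrow> real"
  assumes "0 < \<alpha>" "0 < \<beta>" "0 < \<delta>" "\<alpha> + \<beta> + \<delta> = 1"
    and f: "integrable M f" "\<And>x. 0 \<le> f x" and g: "integrable M g" "\<And>x. 0 \<le> g x"
    and h: "integrable M h" "\<And>x. 0 \<le> h x"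
  shows "integrable M (\<lambda>x. f x powr \<alpha> * g x powr \<beta> * h x powr \<delta>)"
    and "(\<integral>x. f x powr \<alpha> * g x powr \<beta> * h x powr \<delta> \<partial>M)
      \<le> (\<integral>x. f x \<partial>M) powr \<alpha> * (\<integral>x. g x \<partial>M) powr \<beta> * (\<integral>x. h x \<partial>M) powr \<delta>"
proof -
  define b d where "b = \<beta> / (\<beta> + \<delta>)" and "d = \<delta> / (\<beta> + \<delta>)"
  have bd: "0 < b" "0 < d" "b + d = 1" "b * (\<beta> + \<delta>) = \<beta>" "d * (\<beta> + \<delta>) = \<delta>"
    using assms(1-4) by (auto simp: b_def d_def add_divide_distrib[symmetric])
  define k where "k x = g x powr b * h x powr d" for x
  note K = Holder_inequality[OF bd(1-3) g h, folded k_def]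
  have k0: "0 \<le> k x" for x by (simp add: k_def)
  have eq: "k x powr (\<beta> + \<delta>) = g x powr \<beta> * h x powr \<delta>" for x
    using g h bd by (simp add: k_def powr_mult powr_powr)
  note H = Holder_inequality[OF assms(1) _ _ f K(1) k0, of "\<beta> + \<delta>"]
  show "integrable M (\<lambda>x. f x powr \<alpha> * g x powr \<beta> * h x powr \<delta>)"
    using H(1) assms(2-4) by (simp add: eq mult.assoc)
  have "(\<integral>x. f x powr \<alpha> * g x powr \<beta> * h x powr \<delta> \<partial>M)
      \<le> (\<integral>x. f x \<partial>M) powr \<alpha> * (\<integral>x. k x \<partial>M) powr (\<beta> + \<delta>)"
    using H(2) assms(2-4) by (simp add: eq mult.assoc)
  also have "\<dots> \<le> (\<integral>x. f x \<partial>M) powr \<alpha> * ((\<integral>x. g x \<partial>M) powr b * (\<integral>x. h x \<partial>M) powr d) powr (\<beta> + \<delta>)"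
    using K(2) assms(2-4) by (intro mult_left_mono powr_mono2) (auto simp: k_def)
  also have "\<dots> = (\<integral>x. f x \<partial>M) powr \<alpha> * (\<integral>x. g x \<partial>M) powr \<beta> * (\<integral>x. h x \<partial>M) powr \<delta>"
    using bd by (simp add: powr_mult powr_powr)
  finally show "(\<integral>x. f x powr \<alpha> * g x powr \<beta> * h x powr \<delta> \<partial>M) \<le> \<dots>" .
qed

section \<open>Bounded functions of bounded support and Young's inequality\<close>

text \<open>The class of sources whose potentials are studied. It contains the Laplacians of test
  functions, is closed under absolute values and differences, and can be integrated against every
  locally integrable kernel. Borel measurability permits work in \<open>lborel\<close>, with
  \<open>lebesgue\<close> entering only in the final transfer.\<close>

definition bounded_supp :: "('a::euclidean_space \<Rightarrow> real) \<Rightarrow> bool" where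
  "bounded_supp w \<longleftrightarrow>
     w \<in> borel_measurable borel \<and> (\<exists>M R. \<forall>x. \<bar>w x\<bar> \<le> M * indicator (cball 0 R) x)"

lemma bounded_suppE:
  assumes "bounded_supp w"
  obtains M R where "0 \<le> M" "0 \<le> R" "\<And>x. \<bar>w x\<bar> \<le> M * indicator (cball 0 R) x"
proof -
  obtain M R where *: "\<And>x. \<bar>w x\<bar> \<le> M * indicator (cball 0 R) x"
    using assms by (auto simp: bounded_supp_def)
  have "\<bar>w x\<bar> \<le> \<bar>M\<bar> * indicator (cball 0 \<bar>R\<bar>) x" for x
    using *[of x] by (auto simp: indicator_def of_bool_def split: if_splits)
  then show thesis using that[of "\<bar>M\<bar>" "\<bar>R\<bar>"] by auto
qed

lemma bounded_suppD: "bounded_supp w \<Longrightarrow> w \<in> borel_measurable borel"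
  by (auto simp: bounded_supp_def)

lemma bounded_supp_abs: "bounded_supp w \<Longrightarrow> bounded_supp (\<lambda>x. \<bar>w x\<bar>)"
  unfolding bounded_supp_def by auto

lemma bounded_supp_cmult:
  assumes "bounded_supp w" shows "bounded_supp (\<lambda>x. c * w x)"
proof -
  obtain M R where *: "\<And>x. \<bar>w x\<bar> \<le> M * indicator (cball 0 R) x"
    using assms by (auto simp: bounded_supp_def)
  have "\<bar>c * w x\<bar> \<le> (\<bar>c\<bar> * M) * indicator (cball 0 R) x" for x
    using mult_left_mono[OF *[of x], of "\<bar>c\<bar>"] by (simp add: abs_mult mult.assoc)
  then show ?thesis using assms unfolding bounded_supp_def by auto
qed

lemma bounded_supp_diff:
  assumes "bounded_supp v" "bounded_supp w" shows "bounded_supp (\<lambda>x. v x - w x)"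
proof -
  obtain M R where 1: "0 \<le> M" "0 \<le> R" "\<And>x. \<bar>v x\<bar> \<le> M * indicator (cball 0 R) x"
    using bounded_suppE[OF assms(1)] by blast
  obtain N S where 2: "0 \<le> N" "0 \<le> S" "\<And>x. \<bar>w x\<bar> \<le> N * indicator (cball 0 S) x"
    using bounded_suppE[OF assms(2)] by blast
  have "\<bar>v x - w x\<bar> \<le> (M + N) * indicator (cball 0 (max R S)) x" for x
    using 1(1) 2(1) 1(3)[of x] 2(3)[of x] by (auto simp: indicator_def of_bool_def split: if_splits)
  then show ?thesis using assms unfolding bounded_supp_def by auto
qed

lemma bounded_supp_powr_integrable:
  assumes "bounded_supp w" "0 < q" shows "integrable lborel (\<lambda>x. \<bar>w x\<bar> powr q)"
proof -
  have [measurable]: "w \<in> borel_measurable borel" using bounded_suppD[OF assms(1)] .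
  obtain M R where 1: "0 \<le> M" "0 \<le> R" "\<And>x. \<bar>w x\<bar> \<le> M * indicator (cball 0 R) x"
    using bounded_suppE[OF assms(1)] by blast
  have i: "integrable lborel (\<lambda>x::'a. indicator (cball 0 R) x *\<^sub>R (M powr q))"
    by (intro integrable_indicator) (auto simp: emeasure_lborel_cball_finite[unfolded infinity_ennreal_def])
  have le: "\<bar>w x\<bar> powr q \<le> indicator (cball 0 R) x *\<^sub>R (M powr q)" for x
    using 1(3)[of x] assms(2) powr_mono2[of q "\<bar>w x\<bar>" M] by (auto simp: indicator_def of_bool_def split: if_splits)
  show ?thesis by (rule Bochner_Integration.integrable_bound[OF i]) (use le in auto)
qed

lemma bounded_supp_mult_integrable:
  assumes "bounded_supp w" and f[measurable]: "f \<in> borel_measurable borel"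
    and int: "\<And>R. 0 \<le> R \<Longrightarrow> integrable lborel (\<lambda>x. indicator (cball 0 R) x * f x :: real)"
  shows "integrable lborel (\<lambda>x. f x * w x)"
proof -
  have [measurable]: "w \<in> borel_measurable borel" using bounded_suppD[OF assms(1)] .
  obtain M R where 1: "0 \<le> M" "0 \<le> R" "\<And>x. \<bar>w x\<bar> \<le> M * indicator (cball 0 R) x"
    using bounded_suppE[OF assms(1)] by blast
  have i: "integrable lborel (\<lambda>x. M * (indicator (cball 0 R) x * f x))" using int[OF 1(2)] by simp
  have le: "norm (f x * w x) \<le> norm (M * (indicator (cball 0 R) x * f x))" for x
    using mult_left_mono[OF 1(3)[of x], of "\<bar>f x\<bar>"] 1(1) by (simp add: abs_mult mult_ac)
  show ?thesis by (rule Bochner_Integration.integrable_bound[OF i]) (use le in auto)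
qed

text \<open>The classical proof: the product is written as (k^a w^q)^(1/s) (k^a)^(1/a - 1/s)
  (w^q)^(1/q - 1/s), Hoelder's inequality for three factors is applied in y, and the one factor that
  still depends on x is integrated by Tonelli.\<close>

lemma Young_convolution:
  fixes k w :: "'a::euclidean_space \<Rightarrow> real"
  assumes k[measurable]: "k \<in> borel_measurable borel" and k0: "\<And>x. 0 \<le> k x"
    and w: "bounded_supp w" and w0: "\<And>x. 0 \<le> w x"
    and a: "1 < a" and q: "1 < q" and s: "0 < s" and aqs: "1 / a + 1 / q = 1 + 1 / s"
    and ka: "integrable lborel (\<lambda>x. k x powr a)"
  shows "(\<integral>\<^sup>+x. ennreal ((\<integral>y. k (x - y) * w y \<partial>lborel) powr s) \<partial>lborel)
     \<le> ennreal ((\<integral>x. k x powr a \<partial>lborel) powr (s / a) * (\<integral>x. w x powr q \<partial>lborel) powr (s / q))"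
    and "integrable lborel (\<lambda>y. k (x - y) * w y)"
proof -
  have [measurable]: "w \<in> borel_measurable borel" using bounded_suppD[OF w] .
  obtain M R where 1: "0 \<le> M" "0 \<le> R" "\<And>x. \<bar>w x\<bar> \<le> M * indicator (cball 0 R) x"
    using bounded_suppE[OF w] by blast
  have wM: "w x \<le> M" for x using 1(3)[of x] 1(1) w0[of x] by (auto simp: indicator_def of_bool_def split: if_splits)
  define \<beta> \<delta> where "\<beta> = 1 / a - 1 / s" and "\<delta> = 1 / q - 1 / s"
  have ab1: "1 / a < 1" "1 / q < 1" using a q by auto
  \<comment> \<open>By \<open>aqs\<close> these numbers are 1 - 1/q and 1 - 1/a.\<close>
  have \<beta>: "0 < \<beta>" and \<delta>: "0 < \<delta>" using aqs ab1 unfolding \<beta>_def \<delta>_def by auto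
  have sum1: "1 / s + \<beta> + \<delta> = 1" using aqs unfolding \<beta>_def \<delta>_def by simp
  let ?Ik = "\<integral>x. k x powr a \<partial>lborel" and ?Iw = "\<integral>x. w x powr q \<partial>lborel"
  define G where "G x = (\<integral>y. k (x - y) powr a * w y powr q \<partial>lborel)" for x
  have kI: "integrable lborel (\<lambda>y. k (x - y) powr a)" "(\<integral>y. k (x - y) powr a \<partial>lborel) = ?Ik" for x
    using integrable_reflect[OF ka, of x] by auto
  have wI: "integrable lborel (\<lambda>y. w y powr q)"
    using bounded_supp_powr_integrable[OF w, of q] q w0 by (simp add: abs_of_nonneg)
  have GI: "integrable lborel (\<lambda>y. k (x - y) powr a * w y powr q)" for x
    by (rule Bochner_Integration.integrable_bound[of lborel "\<lambda>y. M powr q * k (x - y) powr a"])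
       (use kI wM w0 q in \<open>auto intro!: AE_I2 mult_right_mono powr_mono2 simp: mult.commute[of "k _ powr _"]\<close>)
  have pw: "(k (x - y) powr a * w y powr q) powr (1 / s) * (k (x - y) powr a) powr \<beta> * (w y powr q) powr \<delta>
      = k (x - y) * w y" for x y
  proof -
    have e: "a / s + a * \<beta> = 1" "q / s + q * \<delta> = 1" using a q s by (auto simp: \<beta>_def \<delta>_def field_simps)
    have "(k (x - y) powr a * w y powr q) powr (1 / s) * (k (x - y) powr a) powr \<beta> * (w y powr q) powr \<delta>
       = (k (x - y) powr (a / s) * k (x - y) powr (a * \<beta>)) * (w y powr (q / s) * w y powr (q * \<delta>))"
      using k0 w0 by (simp add: powr_mult powr_powr)
    also have "\<dots> = k (x - y) * w y"
      unfolding powr_add[symmetric] e using k0 w0 by simp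
    finally show ?thesis .
  qed
  note H = Holder_inequality3[OF _ \<beta> \<delta> sum1 GI _ kI(1) _ wI]
  show "integrable lborel (\<lambda>y. k (x - y) * w y)"
    using H(1)[of x x] s k0 w0 by (simp add: pw)
  have bd: "(\<integral>y. k (x - y) * w y \<partial>lborel) powr s \<le> G x * (?Ik powr (s * \<beta>) * ?Iw powr (s * \<delta>))" for x
  proof -
    have "(\<integral>y. k (x - y) * w y \<partial>lborel) \<le> G x powr (1 / s) * ?Ik powr \<beta> * ?Iw powr \<delta>"
      using H(2)[of x x] s k0 w0 by (simp add: pw kI G_def)
    then have "(\<integral>y. k (x - y) * w y \<partial>lborel) powr s \<le> (G x powr (1 / s) * ?Ik powr \<beta> * ?Iw powr \<delta>) powr s"
      using s k0 w0 by (intro powr_mono2) (auto intro!: integral_nonneg_AE)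
    also have "\<dots> = G x * (?Ik powr (s * \<beta>) * ?Iw powr (s * \<delta>))"
      using s k0 w0 by (simp add: powr_mult powr_powr mult_ac G_def integral_nonneg_AE)
    finally show ?thesis .
  qed
  have "(\<integral>\<^sup>+x. ennreal ((\<integral>y. k (x - y) * w y \<partial>lborel) powr s) \<partial>lborel)
      \<le> (\<integral>\<^sup>+x. ennreal (?Ik powr (s * \<beta>) * ?Iw powr (s * \<delta>)) * (\<integral>\<^sup>+y. ennreal (k (x - y) powr a * w y powr q) \<partial>lborel) \<partial>lborel)"
  proof (rule nn_integral_mono)
    fix x :: 'a
    have "(\<integral>\<^sup>+y. ennreal (k (x - y) powr a * w y powr q) \<partial>lborel) = ennreal (G x)"
      unfolding G_def by (rule nn_integral_eq_integral[OF GI]) auto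
    moreover have "0 \<le> G x" unfolding G_def by simp
    ultimately show "ennreal ((\<integral>y. k (x - y) * w y \<partial>lborel) powr s)
      \<le> ennreal (?Ik powr (s * \<beta>) * ?Iw powr (s * \<delta>)) * (\<integral>\<^sup>+y. ennreal (k (x - y) powr a * w y powr q) \<partial>lborel)"
      using bd[of x] by (simp add: ennreal_mult[symmetric] ennreal_leI mult.commute)
  qed
  also have "\<dots> = ennreal (?Ik powr (s * \<beta>) * ?Iw powr (s * \<delta>)) *
      (\<integral>\<^sup>+x. (\<integral>\<^sup>+y. ennreal (k (x - y) powr a * w y powr q) \<partial>lborel) \<partial>lborel)"
    by (rule nn_integral_cmult) measurable
  also have "(\<integral>\<^sup>+x. (\<integral>\<^sup>+y. ennreal (k (x - y) powr a * w y powr q) \<partial>lborel) \<partial>lborel)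
     = (\<integral>\<^sup>+y. (\<integral>\<^sup>+x. ennreal (k (x - y) powr a * w y powr q) \<partial>lborel) \<partial>lborel)"
    by (rule lborel_pair.Fubini') measurable
  also have "\<dots> = (\<integral>\<^sup>+y. ennreal (w y powr q) * ennreal ?Ik \<partial>lborel)"
  proof (rule nn_integral_cong)
    fix y :: 'a
    have "(\<integral>\<^sup>+x. ennreal (k (x - y) powr a * w y powr q) \<partial>lborel)
       = (\<integral>\<^sup>+x. ennreal (w y powr q) * ennreal (k (x - y) powr a) \<partial>lborel)"
      by (simp add: ennreal_mult mult.commute)
    also have "\<dots> = ennreal (w y powr q) * (\<integral>\<^sup>+x. ennreal (k (x - y) powr a) \<partial>lborel)"
      by (rule nn_integral_cmult) measurable
    also have "(\<integral>\<^sup>+x. ennreal (k (x - y) powr a) \<partial>lborel) = (\<integral>\<^sup>+x. ennreal (k x powr a) \<partial>lborel)"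
      by (rule nn_integral_translate) measurable
    also have "\<dots> = ennreal ?Ik" by (rule nn_integral_eq_integral[OF ka]) auto
    finally show "(\<integral>\<^sup>+x. ennreal (k (x - y) powr a * w y powr q) \<partial>lborel) = ennreal (w y powr q) * ennreal ?Ik" .
  qed
  also have "\<dots> = (\<integral>\<^sup>+y. ennreal (w y powr q) \<partial>lborel) * ennreal ?Ik"
    by (rule nn_integral_multc) measurable
  also have "(\<integral>\<^sup>+y. ennreal (w y powr q) \<partial>lborel) = ennreal ?Iw"
    by (rule nn_integral_eq_integral[OF wI]) auto
  also have "ennreal (?Ik powr (s * \<beta>) * ?Iw powr (s * \<delta>)) * (ennreal ?Iw * ennreal ?Ik)
     = ennreal ((?Ik powr (s * \<beta>) * ?Ik) * (?Iw powr (s * \<delta>) * ?Iw))"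
    by (simp add: ennreal_mult[symmetric] mult_ac)
  \<comment> \<open>Tonelli has supplied one further full power of each integral, and s * \<beta> +
    1 = s / a, s * \<delta> + 1 = s / q.\<close>
  also have "?Ik powr (s * \<beta>) * ?Ik = ?Ik powr (s / a)"
  proof -
    have "s / a = s * \<beta> + 1" using s by (simp add: \<beta>_def field_simps)
    then show ?thesis by (simp add: powr_add)
  qed
  also have "?Iw powr (s * \<delta>) * ?Iw = ?Iw powr (s / q)"
  proof -
    have "s / q = s * \<delta> + 1" using s by (simp add: \<delta>_def field_simps)
    then show ?thesis by (simp add: powr_add)
  qed
  finally show "(\<integral>\<^sup>+x. ennreal ((\<integral>y. k (x - y) * w y \<partial>lborel) powr s) \<partial>lborel)
     \<le> ennreal (?Ik powr (s / a) * ?Iw powr (s / q))" .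
qed

section \<open>Integrability of powers of the norm\<close>

text \<open>A substitute for polar coordinates: f is at most the sum of c k times the indicator of
  the ball of radius r k, whose volume is proportional to the n-th power of its radius. The balls
  may be nested, since an overlap only enlarges the sum.\<close>

lemma integrable_from_shells:
  fixes f :: "'a::euclidean_space \<Rightarrow> real"
  assumes [measurable]: "f \<in> borel_measurable borel" and f0: "\<And>x. 0 \<le> f x"
    and r: "\<And>k::nat. 0 \<le> r k" and c: "\<And>k. 0 \<le> c k"
    and le: "\<And>x. f x \<noteq> 0 \<Longrightarrow> \<exists>k. norm x \<le> r k \<and> f x \<le> c k"
    and s: "summable (\<lambda>k. c k * r k ^ DIM('a))"
  shows "integrable lborel f"
proof (rule integrableI_bounded)
  show "f \<in> borel_measurable lborel" by simp
  let ?V = "unit_ball_vol (real DIM('a))"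
  have "(\<integral>\<^sup>+x. ennreal (norm (f x)) \<partial>lborel)
      \<le> (\<integral>\<^sup>+(x::'a). (\<Sum>k. ennreal (c k) * indicator (cball 0 (r k)) x) \<partial>lborel)"
  proof (rule nn_integral_mono)
    fix x
    show "ennreal (norm (f x)) \<le> (\<Sum>k. ennreal (c k) * indicator (cball 0 (r k)) x)"
    proof (cases "f x = 0")
      case False
      then obtain k where k: "norm x \<le> r k" "f x \<le> c k" using le by blast
      have "ennreal (norm (f x)) \<le> (\<Sum>j\<in>{k}. ennreal (c j) * indicator (cball 0 (r j)) x)"
        using k f0 by (auto simp: indicator_def intro!: ennreal_leI)
      also have "\<dots> \<le> (\<Sum>k. ennreal (c k) * indicator (cball 0 (r k)) x)"
        by (rule sum_le_suminf) auto
      finally show ?thesis .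
    qed auto
  qed
  also have "\<dots> = (\<Sum>k. \<integral>\<^sup>+x. ennreal (c k) * indicator (cball 0 (r k)) (x::'a) \<partial>lborel)"
    by (rule nn_integral_suminf) (auto intro!: borel_measurable_times_ennreal borel_measurable_indicator)
  also have "\<dots> = (\<Sum>k. ennreal (?V * (c k * r k ^ DIM('a))))"
    by (subst nn_integral_cmult_indicator)
       (auto simp: emeasure_cball r c ennreal_mult[symmetric] mult_ac)
  also have "\<dots> < \<infinity>"
  proof -
    have "summable (\<lambda>k. ?V * (c k * r k ^ DIM('a)))" using s by (rule summable_mult)
    then have "(\<Sum>k. ennreal (?V * (c k * r k ^ DIM('a)))) \<noteq> top"
      by (intro ennreal_suminf_neq_top) (auto simp: c r)
    then show ?thesis by (simp add: top.not_eq_extremum)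
  qed
  finally show "(\<integral>\<^sup>+x. ennreal (norm (f x)) \<partial>lborel) < \<infinity>" .
qed

text \<open>On dyadic shells the bounds form a geometric series of ratio 2^(c - n), convergent
  because c < n.\<close>

lemma integrable_norm_powr_cball:
  assumes "0 < c" "c < real DIM('a::euclidean_space)"
  shows "integrable lborel (\<lambda>x::'a. indicator (cball 0 1) x * norm x powr (-c))"
proof (rule integrable_from_shells[where r = "\<lambda>k. 2 powr (- real k)" and c = "\<lambda>k. 2 powr (real (Suc k) * c)"])
  fix x :: 'a assume "indicator (cball 0 1) x * norm x powr (-c) \<noteq> 0"
  \<comment> \<open>The origin drops out because \<open>0 powr\<close> any exponent is 0.\<close>
  then have x: "norm x \<le> 1" "norm x > 0" by (auto simp: indicator_def of_bool_def split: if_splits)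
  \<comment> \<open>The shell is 2^(-k-1) < |x| \<le> 2^(-k); its lower end is the reason for
    \<open>Suc k\<close> in the bound on the function.\<close>
  define k where "k = nat \<lfloor>- log 2 (norm x)\<rfloor>"
  have "- log 2 (norm x) \<ge> 0" using x by simp
  then have k: "real k \<le> - log 2 (norm x)" "- log 2 (norm x) < real k + 1" unfolding k_def by linarith+
  have n: "norm x = 2 powr (log 2 (norm x))" using x by simp
  have "norm x \<le> 2 powr (- real k)" by (subst n) (use k in auto)
  moreover have "norm x powr (-c) \<le> 2 powr (real (Suc k) * c)"
  proof -
    have "norm x powr (-c) = 2 powr (log 2 (norm x) * (-c))" by (subst n) (simp only: powr_powr)
    also have "\<dots> \<le> 2 powr (real (Suc k) * c)"
      using mult_right_mono[of "- log 2 (norm x)" "real (Suc k)" c] k assms(1) by (intro powr_mono) auto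
    finally show ?thesis .
  qed
  ultimately show "\<exists>k. norm x \<le> 2 powr - real k \<and> indicator (cball 0 1) x * norm x powr - c \<le> 2 powr (real (Suc k) * c)"
    using x by (intro exI[of _ k]) (auto simp: indicator_def)
next
  have "(\<lambda>k. 2 powr (real (Suc k) * c) * (2 powr - real k) ^ DIM('a)) = (\<lambda>k. 2 powr c * (2 powr (c - real DIM('a))) ^ k)"
    by (auto simp: fun_eq_iff powr_realpow[symmetric] powr_powr powr_add[symmetric] algebra_simps)
  moreover have "summable \<dots>" using assms by (intro summable_mult summable_geometric) (auto simp: powr_less_one)
  ultimately show "summable (\<lambda>k. 2 powr (real (Suc k) * c) * (2 powr - real k) ^ DIM('a))" by simp
qed (measurable, auto)

text \<open>The mirror image with shells growing outward, from 2^k to 2^(k+1); the ratio is now 2^(n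
  - c).\<close>

lemma integrable_norm_powr_compl_cball:
  assumes "real DIM('a::euclidean_space) < c"
  shows "integrable lborel (\<lambda>x::'a. indicator (- cball 0 1) x * norm x powr (-c))"
proof (rule integrable_from_shells[where r = "\<lambda>k. 2 powr (real (Suc k))" and c = "\<lambda>k. 2 powr (- real k * c)"])
  fix x :: 'a assume "indicator (- cball 0 1) x * norm x powr (-c) \<noteq> 0"
  then have x: "norm x > 1" by (auto simp: indicator_def of_bool_def split: if_splits)
  then have x0: "norm x > 0" by linarith
  have c: "c > 0" using assms by (rule le_less_trans[rotated]) simp
  define k where "k = nat \<lfloor>log 2 (norm x)\<rfloor>"
  have "log 2 (norm x) \<ge> 0" using x by (subst zero_le_log_cancel_iff) auto
  then have k: "real k \<le> log 2 (norm x)" "log 2 (norm x) < real k + 1" unfolding k_def by linarith+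
  have n: "norm x = 2 powr (log 2 (norm x))" using x0 by (subst powr_log_cancel) auto
  have "norm x \<le> 2 powr (real (Suc k))" by (subst n) (use k in auto)
  moreover have "norm x powr (-c) \<le> 2 powr (- real k * c)"
  proof -
    have "norm x powr (-c) = 2 powr (log 2 (norm x) * (-c))" by (subst n) (simp only: powr_powr)
    also have "\<dots> \<le> 2 powr (- real k * c)"
      using mult_right_mono[of "real k" "log 2 (norm x)" c] k c by (intro powr_mono) auto
    finally show ?thesis .
  qed
  ultimately show "\<exists>k. norm x \<le> 2 powr real (Suc k) \<and> indicator (- cball 0 1) x * norm x powr - c \<le> 2 powr (- real k * c)"
    using x by (intro exI[of _ k]) (auto simp: indicator_def)
next
  have "(\<lambda>k. 2 powr (- real k * c) * (2 powr real (Suc k)) ^ DIM('a)) = (\<lambda>k. 2 powr real DIM('a) * (2 powr (real DIM('a) - c)) ^ k)"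
    by (auto simp: fun_eq_iff powr_realpow[symmetric] powr_powr powr_add[symmetric] algebra_simps)
  moreover have "summable \<dots>" using assms by (intro summable_mult summable_geometric) (auto simp: powr_less_one)
  ultimately show "summable (\<lambda>k. 2 powr (- real k * c) * (2 powr real (Suc k)) ^ DIM('a))" by simp
qed (measurable, auto)

section \<open>Representation of test functions by the Newton kernel\<close>

lemma integral_lborel_affine:
  fixes f :: "'a::euclidean_space \<Rightarrow> real"
  assumes [measurable]: "f \<in> borel_measurable borel" and "c > 0"
  shows "(\<integral>y. f y \<partial>lborel) = c ^ DIM('a) * (\<integral>z. f (t + c *\<^sub>R z) \<partial>lborel)"
proof -
  have "(\<integral>y. f y \<partial>lborel) =
      (\<integral>y. f y \<partial>density (distr lborel borel (\<lambda>x. t + c *\<^sub>R x)) (\<lambda>_. \<bar>c\<bar> ^ DIM('a)))"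
    using lborel_affine[of c t] assms(2) by simp
  also have "\<dots> = (\<integral>y. c ^ DIM('a) * f y \<partial>distr lborel borel (\<lambda>x. t + c *\<^sub>R x))"
    using assms(2) by (subst integral_density) (auto simp: zero_le_power)
  also have "\<dots> = c ^ DIM('a) * (\<integral>z. f (t + c *\<^sub>R z) \<partial>lborel)"
    by (subst integral_distr) auto
  finally show ?thesis .
qed

lemma continuous_bounded_supp:
  fixes f :: "'a::euclidean_space \<Rightarrow> real"
  assumes c: "continuous_on UNIV f" and R: "\<And>x. R < norm x \<Longrightarrow> f x = 0"
  shows "bounded_supp f"
proof -
  have "compact (f ` cball 0 R)"
    using c by (intro compact_continuous_image) (auto intro: continuous_on_subset)
  then obtain M where M: "\<forall>y\<in>f ` cball 0 R. norm y \<le> M"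
    using compact_imp_bounded bounded_iff by blast
  have "\<bar>f x\<bar> \<le> M * indicator (cball 0 R) x" for x
    using M R[of x] by (auto simp: indicator_def of_bool_def not_le)
  then show ?thesis
    unfolding bounded_supp_def using borel_measurable_continuous_onI[OF c] by blast
qed

text \<open>Difference quotients of a function of bounded support have integral 0 by translation
  invariance, and dominated convergence hands this on to the derivative. All integration by parts
  below comes from here, without iterated integrals or boundary terms.\<close>

lemma integral_directional_derivative_eq_0:
  fixes h h' :: "'a::euclidean_space \<Rightarrow> real"
  assumes h: "\<And>x. (h has_derivative D x) (at x)" and D: "\<And>x. D x b = h' x"
    and h': "continuous_on UNIV h'" and R: "\<And>x. R < norm x \<Longrightarrow> h x = 0" and b: "norm b \<le> 1"
  shows "(\<integral>x. h' x \<partial>lborel) = 0"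
proof -
  have ch: "continuous_on UNIV h"
    by (intro continuous_at_imp_continuous_on ballI has_derivative_continuous[OF h])
  have bs: "bounded_supp h" by (rule continuous_bounded_supp[OF ch R])
  have [measurable]: "h \<in> borel_measurable borel" "h' \<in> borel_measurable borel"
    using ch h' borel_measurable_continuous_onI by blast+
  have hI: "integrable lborel h"
    using bounded_supp_mult_integrable[OF bs, of "\<lambda>_. 1"]
    by (auto simp: emeasure_lborel_cball_finite[unfolded infinity_ennreal_def])
  have hI': "integrable lborel (\<lambda>x. h (x + t))" for t
  proof -
    have "integrable (distr lborel borel ((+) t)) h" using hI by (simp add: lborel_distr_plus)
    then show ?thesis by (subst (asm) integrable_distr_eq) (auto simp: add.commute)
  qed
  have line: "((\<lambda>t. h (x + t *\<^sub>R b)) has_real_derivative h' (x + t *\<^sub>R b)) (at t)" for x t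
  proof -
    have "((\<lambda>t. h (x + t *\<^sub>R b)) has_derivative (\<lambda>s. D (x + t *\<^sub>R b) (s *\<^sub>R b))) (at t)"
      by (rule has_derivative_compose[of "\<lambda>t. x + t *\<^sub>R b" "\<lambda>s. s *\<^sub>R b"])
         (auto intro!: derivative_eq_intros h)
    moreover have "D (x + t *\<^sub>R b) (s *\<^sub>R b) = h' (x + t *\<^sub>R b) * s" for s
      using linear_scale[OF has_derivative_linear[OF h]] D by (simp add: mult.commute)
    ultimately show ?thesis by (simp add: has_field_derivative_def)
  qed
  \<comment> \<open>Steps have length at most 1, so the quotients vanish outside radius R + 1, and
    for x inside it the mean value point stays within R + 2, where M bounds the derivative.\<close>
  have "compact (h' ` cball 0 (R + 2))"
    using h' by (intro compact_continuous_image) (auto intro: continuous_on_subset)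
  then obtain M where M: "\<forall>y\<in>h' ` cball 0 (R + 2). norm y \<le> M"
    using compact_imp_bounded bounded_iff by blast
  define s where "s m x = (h (x + (1 / real (Suc m)) *\<^sub>R b) - h x) / (1 / real (Suc m))" for m x
  have "(\<lambda>m. \<integral>x. s m x \<partial>lborel) \<longlonglongrightarrow> (\<integral>x. h' x \<partial>lborel)"
  proof (rule integral_dominated_convergence[where w = "\<lambda>x. indicator (cball 0 (R + 1)) x *\<^sub>R \<bar>M\<bar>"])
    show "integrable lborel (\<lambda>x::'a. indicator (cball 0 (R + 1)) x *\<^sub>R \<bar>M\<bar>)"
      by (intro integrable_indicator) (auto simp: emeasure_lborel_cball_finite[unfolded infinity_ennreal_def])
    show "AE x in lborel. (\<lambda>m. s m x) \<longlonglongrightarrow> h' x"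
    proof (rule AE_I2)
      fix x
      have "((\<lambda>t. (h (x + t *\<^sub>R b) - h x) / t) \<longlongrightarrow> h' x) (at 0)"
        using line[of x 0] by (simp add: DERIV_def)
      moreover have "filterlim (\<lambda>m. 1 / real (Suc m)) (at 0) sequentially"
        using LIMSEQ_inverse_real_of_nat by (intro filterlim_atI) (auto simp: inverse_eq_divide)
      ultimately show "(\<lambda>m. s m x) \<longlonglongrightarrow> h' x"
        unfolding s_def by (rule filterlim_compose)
    qed
    show "AE x in lborel. norm (s m x) \<le> indicator (cball 0 (R + 1)) x *\<^sub>R \<bar>M\<bar>" for m
    proof (rule AE_I2)
      fix x :: 'a
      define t where "t = 1 / real (Suc m)"
      have t: "0 < t" "t \<le> 1" by (auto simp: t_def)
      have tb: "norm (r *\<^sub>R b) \<le> 1" if "0 \<le> r" "r \<le> 1" for r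
        using that b mult_mono[of r 1 "norm b" 1] by simp
      show "norm (s m x) \<le> indicator (cball 0 (R + 1)) x *\<^sub>R \<bar>M\<bar>"
      proof (cases "norm x \<le> R + 1")
        case True
        obtain z where z: "0 < z" "z < t" "h (x + t *\<^sub>R b) - h (x + 0 *\<^sub>R b) = (t - 0) * h' (x + z *\<^sub>R b)"
          using MVT2[OF t(1), of "\<lambda>t. h (x + t *\<^sub>R b)" "\<lambda>t. h' (x + t *\<^sub>R b)"] line by blast
        have "norm (x + z *\<^sub>R b) \<le> R + 2"
          using True norm_triangle_ineq[of x "z *\<^sub>R b"] tb[of z] z t by linarith
        then have "\<bar>h' (x + z *\<^sub>R b)\<bar> \<le> \<bar>M\<bar>" using M by force
        moreover have "s m x = h' (x + z *\<^sub>R b)" using z t by (simp add: s_def t_def)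
        ultimately show ?thesis using True by simp
      next
        case False
        have "norm (x + t *\<^sub>R b) > R"
          using False norm_triangle_ineq4[of "x + t *\<^sub>R b" "t *\<^sub>R b"] tb[of t] t by simp
        then have "s m x = 0" using R[of x] R[of "x + t *\<^sub>R b"] False by (simp add: s_def t_def)
        then show ?thesis by simp
      qed
    qed
  qed (auto simp: s_def)
  moreover have "(\<integral>x. s m x \<partial>lborel) = 0" for m
    using hI hI' unfolding s_def by (simp add: integral_translate)
  ultimately show ?thesis by (simp add: LIMSEQ_const_iff)
qed

section \<open>Test functions and their Laplacians\<close>

lemma C_k_imp_continuous: "C_k k f \<Longrightarrow> continuous_on UNIV f"
  by (cases k) (auto simp: differentiable_imp_continuous_within continuous_at_imp_continuous_on)

text \<open>Off its closed support a function vanishes on a neighbourhood, so differentiation cannot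
  enlarge the support.\<close>

lemma test_function_partial:
  fixes \<phi> :: "'a::euclidean_space \<Rightarrow> real"
  assumes "\<phi> \<in> test_functions" "b \<in> Basis"
  shows "partial_deriv b \<phi> \<in> test_functions"
proof -
  have C: "C_k k (partial_deriv b \<phi>)" for k
    using assms by (auto simp: test_functions_def dest: spec[of _ "Suc k"])
  let ?S = "closure {x. \<phi> x \<noteq> 0}"
  have cS: "compact ?S" using assms by (auto simp: test_functions_def)
  have "partial_deriv b \<phi> x = 0" if "x \<notin> ?S" for x
  proof -
    have "((\<lambda>_. 0::real) has_derivative (\<lambda>_. 0)) (at x)" by simp
    then have "(\<phi> has_derivative (\<lambda>_. 0)) (at x)"
      by (rule has_derivative_transform_within_open[of _ _ _ _ "- ?S"])
         (use that closure_subset[of "{x. \<phi> x \<noteq> 0}"] in auto)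
    then show ?thesis using frechet_derivative_at[of \<phi> _ x] by (simp add: partial_deriv_def)
  qed
  then have "closure {x. partial_deriv b \<phi> x \<noteq> 0} \<subseteq> ?S"
    by (intro closure_minimal) auto
  then have "compact (closure {x. partial_deriv b \<phi> x \<noteq> 0})"
    using cS by (metis closed_closure compact_Int_closed inf.absorb_iff2)
  then show ?thesis using C by (auto simp: test_functions_def)
qed

lemma test_function_continuous: "\<phi> \<in> test_functions \<Longrightarrow> continuous_on UNIV \<phi>"
  using C_k_imp_continuous by (auto simp: test_functions_def)

lemma test_function_supportE:
  assumes "\<phi> \<in> test_functions" obtains R where "\<And>x. R < norm x \<Longrightarrow> \<phi> x = 0"
proof -
  have "bounded (closure {x. \<phi> x \<noteq> 0})"
    using assms by (auto simp: test_functions_def intro: compact_imp_bounded)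
  then obtain R where "\<forall>x\<in>closure {x. \<phi> x \<noteq> 0}. norm x \<le> R" using bounded_iff by blast
  then show thesis using that[of R] closure_subset[of "{x. \<phi> x \<noteq> 0}"] by force
qed

lemma test_function_has_derivative:
  assumes "\<phi> \<in> test_functions"
  shows "(\<phi> has_derivative frechet_derivative \<phi> (at x)) (at x)"
  using assms by (auto simp: test_functions_def frechet_derivative_works[symmetric] dest: spec[of _ "Suc 0"])

lemma test_function_bounded_supp: "\<phi> \<in> test_functions \<Longrightarrow> bounded_supp \<phi>"
  by (metis continuous_bounded_supp test_function_continuous test_function_supportE)

lemma test_function_laplacian:
  assumes "\<phi> \<in> test_functions"
  shows "continuous_on UNIV (laplacian \<phi>)" "bounded_supp (laplacian \<phi>)"
proof -
  have t: "partial_deriv b (partial_deriv b \<phi>) \<in> test_functions" if "b \<in> Basis" for b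
    using assms that by (intro test_function_partial)
  show c: "continuous_on UNIV (laplacian \<phi>)"
    unfolding laplacian_def[abs_def] by (intro continuous_on_sum test_function_continuous t)
  obtain r where r: "\<And>b x. b \<in> Basis \<Longrightarrow> r b < norm x \<Longrightarrow> partial_deriv b (partial_deriv b \<phi>) x = 0"
  proof -
    have "\<exists>R. \<forall>x. R < norm x \<longrightarrow> partial_deriv b (partial_deriv b \<phi>) x = 0" if "b \<in> Basis" for b
      using test_function_supportE[OF t[OF that]] by metis
    then show thesis using that by metis
  qed
  have "laplacian \<phi> x = 0" if "(MAX b\<in>Basis. r b) < norm x" for x
    using that r unfolding laplacian_def by (intro sum.neutral) auto
  then show "bounded_supp (laplacian \<phi>)" by (rule continuous_bounded_supp[OF c])
qed

section \<open>The regularised Newton kernel and Green's identity\<close>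

text \<open>For \<epsilon> = 0 and n at least 3 this is the fundamental solution of the Laplacian up
  to a constant factor. For \<epsilon> > 0 it is the bounded smooth profile familiar from extremals
  of the Sobolev inequality.\<close>

definition newton_kernel :: "real \<Rightarrow> 'a::euclidean_space \<Rightarrow> real" where
  "newton_kernel \<epsilon> z = ((norm z)\<^sup>2 + \<epsilon>\<^sup>2) powr (- (real DIM('a) - 2) / 2)"

lemma newton_kernel_measurable[measurable]: "newton_kernel \<epsilon> \<in> borel_measurable borel"
  unfolding newton_kernel_def by measurable

lemma newton_kernel_nonneg[simp]: "0 \<le> newton_kernel \<epsilon> z"
  by (simp add: newton_kernel_def)

lemma newton_kernel_0: "newton_kernel 0 (z::'a::euclidean_space) = norm z powr (- (real DIM('a) - 2))"
proof (cases "z = 0")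
  case False
  have "newton_kernel 0 z = (norm z powr 2) powr (- (real DIM('a) - 2) / 2)"
    using False by (simp add: newton_kernel_def)
  then show ?thesis unfolding powr_powr by (simp add: diff_divide_distrib)
qed (simp add: newton_kernel_def)

text \<open>The origin has to be excluded: there the unregularised kernel is 0 by the convention for
  \<open>powr\<close>. In the integrals below this costs only a null set.\<close>

lemma newton_kernel_le:
  assumes "z \<noteq> (0::'a::euclidean_space)" "2 \<le> DIM('a)"
  shows "newton_kernel \<epsilon> z \<le> newton_kernel 0 z"
  using assms unfolding newton_kernel_def by (intro powr_mono2') auto

lemma AE_neq: "AE y in lborel. y \<noteq> (x::'a::euclidean_space)"
  by (rule AE_I[where N = "{x}"]) auto

lemma newton_kernel_tendsto:
  assumes "z \<noteq> (0::'a::euclidean_space)"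
  shows "(\<lambda>m. newton_kernel (1 / real (Suc m)) z) \<longlonglongrightarrow> newton_kernel 0 z"
proof -
  have "(\<lambda>m. 1 / real (Suc m)) \<longlonglongrightarrow> 0"
    using LIMSEQ_inverse_real_of_nat by (simp add: inverse_eq_divide)
  then show ?thesis unfolding newton_kernel_def
    by (intro tendsto_intros) (use assms in auto)
qed

text \<open>After translation the kernel is at most |z|^(2-n) within distance 1 of its singularity
  and at most 1 elsewhere.\<close>

lemma newton_kernel_locally_integrable:
  assumes n: "3 \<le> DIM('a::euclidean_space)"
  shows "integrable lborel (\<lambda>y::'a. indicator (cball 0 R) y * newton_kernel \<epsilon> (x - y))"
proof -
  let ?c = "real DIM('a) - 2"
  define g :: "'a \<Rightarrow> real" where "g z = indicator (cball 0 1) z * norm z powr (- ?c) + indicator (cball 0 (R + norm x)) z" for z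
  have "integrable lborel g" unfolding g_def
    using n by (intro Bochner_Integration.integrable_add integrable_norm_powr_cball)
      (auto simp: emeasure_lborel_cball_finite[unfolded infinity_ennreal_def])
  then have "integrable lborel (\<lambda>y. g (x - y))" by (rule integrable_reflect)
  then show ?thesis
  proof (rule Bochner_Integration.integrable_bound)
    show "AE y in lborel. norm (indicator (cball 0 R) y * newton_kernel \<epsilon> (x - y)) \<le> norm (g (x - y))"
      using AE_neq[of x]
    proof eventually_elim
      case (elim y)
      let ?z = "x - y"
      have g0: "0 \<le> g ?z" by (simp add: g_def)
      have le: "newton_kernel \<epsilon> ?z \<le> norm ?z powr (- ?c)"
        using newton_kernel_le[of ?z \<epsilon>] elim n by (simp add: newton_kernel_0)
      show ?case
      proof (cases "norm y \<le> R")
        case True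
        show ?thesis
        proof (cases "norm ?z \<le> 1")
          case True
          then show ?thesis using le g0 by (auto simp: g_def indicator_def)
        next
          case False
          have "norm ?z powr (- ?c) \<le> norm ?z powr 0" using False n by (intro powr_mono) auto
          moreover have "norm ?z \<le> R + norm x" using True norm_triangle_ineq4[of x y] by simp
          ultimately show ?thesis using le g0 False elim by (auto simp: g_def indicator_def)
        qed
      next
        case False
        then show ?thesis using g0 by simp
      qed
    qed
  qed (auto intro!: borel_measurable_times borel_measurable_indicator measurable_compose[OF _ newton_kernel_measurable])
qed

lemma newton_kernel_mult_integrable:
  assumes "3 \<le> DIM('a::euclidean_space)" "bounded_supp w"
  shows "integrable lborel (\<lambda>y::'a. newton_kernel \<epsilon> (x - y) * w y)"
  by (rule bounded_supp_mult_integrable[OF assms(2)]) (measurable, rule newton_kernel_locally_integrable[OF assms(1)])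

lemma has_derivative_quadratic_powr:
  fixes x y :: "'a::euclidean_space"
  assumes "\<epsilon> > 0"
  shows "((\<lambda>y. ((norm (x - y))\<^sup>2 + \<epsilon>\<^sup>2) powr \<mu>) has_derivative
     (\<lambda>h. 2 * \<mu> * ((y - x) \<bullet> h) * ((norm (x - y))\<^sup>2 + \<epsilon>\<^sup>2) powr (\<mu> - 1))) (at y)"
proof -
  have pos: "(x - y) \<bullet> (x - y) + \<epsilon>\<^sup>2 > 0" for y using assms by (simp add: add_nonneg_pos)
  have 1: "((\<lambda>y. (x - y) \<bullet> (x - y) + \<epsilon>\<^sup>2) has_derivative (\<lambda>h. 2 * ((y - x) \<bullet> h))) (at y)"
    by (auto intro!: derivative_eq_intros simp: algebra_simps inner_commute)
  have 2: "((\<lambda>z. z powr \<mu>) has_real_derivative \<mu> * ((x - y) \<bullet> (x - y) + \<epsilon>\<^sup>2) powr (\<mu> - 1)) (at ((x - y) \<bullet> (x - y) + \<epsilon>\<^sup>2))"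
    by (rule has_real_derivative_powr[OF pos])
  from DERIV_compose_FDERIV[OF 2 1] show ?thesis
    by (simp add: power2_norm_eq_inner mult_ac)
qed

text \<open>The Laplacian of \<open>newton_kernel \<epsilon>\<close> is a negative multiple of \<open>bump\<close> rescaled by \<open>\<epsilon>\<close>.\<close>

definition bump :: "'a::euclidean_space \<Rightarrow> real" where
  "bump z = ((norm z)\<^sup>2 + 1) powr (- (real DIM('a) + 2) / 2)"

lemma bump_integrable: "integrable lborel (bump :: 'a::euclidean_space \<Rightarrow> real)"
proof -
  have "integrable lborel (\<lambda>z::'a. indicator (cball 0 1) z + indicator (- cball 0 1) z * norm z powr (- (real DIM('a) + 2)))"
    by (intro Bochner_Integration.integrable_add integrable_norm_powr_compl_cball)
       (auto simp: emeasure_lborel_cball_finite[unfolded infinity_ennreal_def])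
  then show ?thesis
  proof (rule Bochner_Integration.integrable_bound)
    show "bump \<in> borel_measurable (lborel :: 'a measure)" unfolding bump_def by measurable
    show "AE z in lborel. norm (bump (z::'a)) \<le> norm (indicator (cball 0 1) z + indicator (- cball 0 1) z * norm z powr (- (real DIM('a) + 2)))"
    proof (rule AE_I2)
      fix z :: 'a
      show "norm (bump z) \<le> norm (indicator (cball 0 1) z + indicator (- cball 0 1) z * norm z powr (- (real DIM('a) + 2)))"
      proof (cases "norm z \<le> 1")
        case True
        have "bump z \<le> 1 powr (- (real DIM('a) + 2) / 2)"
          unfolding bump_def by (rule powr_mono2') auto
        then show ?thesis using True by (simp add: bump_def)
      next
        case False
        then have z: "norm z > 0" "z \<noteq> 0" by auto
        have "bump z \<le> ((norm z)\<^sup>2) powr (- (real DIM('a) + 2) / 2)"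
          unfolding bump_def using z by (intro powr_mono2') auto
        also have "\<dots> = (norm z powr 2) powr (- (real DIM('a) + 2) / 2)" using z by simp
        also have "\<dots> = norm z powr (- (real DIM('a) + 2))" unfolding powr_powr by (simp add: diff_divide_distrib)
        finally show ?thesis using False by (simp add: bump_def)
      qed
    qed
  qed
qed

lemma integral_bump_pos: "0 < (\<integral>z. bump (z::'a::euclidean_space) \<partial>lborel)"
proof -
  have pos: "0 < bump (z::'a)" for z
    unfolding bump_def by (simp add: add_nonneg_pos) (smt (verit) zero_le_power2)
  have "(\<integral>z. bump (z::'a) \<partial>lborel) \<noteq> 0"
  proof
    assume "(\<integral>z. bump (z::'a) \<partial>lborel) = 0"
    then have "AE z in (lborel :: 'a measure). bump z = 0"
      using pos by (subst (asm) integral_nonneg_eq_0_iff_AE[OF bump_integrable]) (auto simp: less_imp_le)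
    then have "AE z in (lborel :: 'a measure). False" by eventually_elim (metis pos less_irrefl)
    then have "emeasure lborel (UNIV :: 'a set) = 0" by (subst (asm) AE_iff_measurable[of UNIV]) auto
    then show False by simp
  qed
  moreover have "0 \<le> (\<integral>z. bump (z::'a) \<partial>lborel)"
    using pos by (intro integral_nonneg_AE) (auto simp: less_imp_le)
  ultimately show ?thesis by simp
qed

text \<open>Green's second identity on the whole space for \<phi> and the smooth kernel. The
  Laplacian of the kernel is -n(n-2) \<epsilon>^2 (|x-y|^2 + \<epsilon>^2)^(-(n+2)/2), and the
  substitution y = x + \<epsilon> z removes every power of \<epsilon>.\<close>

lemma newton_kernel_integral_laplacian:
  fixes \<phi> :: "'a::euclidean_space \<Rightarrow> real"
  assumes n: "3 \<le> DIM('a)" and \<phi>: "\<phi> \<in> test_functions" and e: "\<epsilon> > 0"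
  shows "(\<integral>y. newton_kernel \<epsilon> (x - y) * laplacian \<phi> y \<partial>lborel)
      = - (real DIM('a) * (real DIM('a) - 2)) * (\<integral>z. \<phi> (x + \<epsilon> *\<^sub>R z) * bump z \<partial>lborel)"
proof -
  let ?n = "real DIM('a)"
  define m where "m = (?n - 2) / 2"
  define q where "q \<mu> y = ((norm (x - y))\<^sup>2 + \<epsilon>\<^sup>2) powr \<mu>" for \<mu> y
  have pos: "(norm (x - y))\<^sup>2 + \<epsilon>\<^sup>2 > 0" for y using e by (simp add: add_nonneg_pos)
  have kq: "newton_kernel \<epsilon> (x - y) = q (-m) y" for y
    by (simp add: newton_kernel_def q_def m_def diff_divide_distrib)
  have qD: "(q \<mu> has_derivative (\<lambda>h. 2 * \<mu> * ((y - x) \<bullet> h) * q (\<mu> - 1) y)) (at y)" for \<mu> y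
    unfolding q_def by (rule has_derivative_quadratic_powr[OF e])
  have qc[continuous_intros]: "continuous_on UNIV (q \<mu>)" for \<mu>
    by (intro continuous_at_imp_continuous_on ballI has_derivative_continuous[OF qD])
  have \<phi>c: "continuous_on UNIV \<phi>" by (rule test_function_continuous[OF \<phi>])
  obtain R where R: "\<And>x. R < norm x \<Longrightarrow> \<phi> x = 0" using test_function_supportE[OF \<phi>] by blast
  \<comment> \<open>With K for the kernel \<open>q (-m)\<close>, this is K times the second
    b-derivative of \<phi> minus \<phi> times that of K: one term of the divergence in Green's
    identity.\<close>
  define F where "F b y = q (-m) y * partial_deriv b (partial_deriv b \<phi>) y
      + 2 * m * \<phi> y * (q (-m-1) y - 2 * (m + 1) * ((y - x) \<bullet> b)\<^sup>2 * q (-m-2) y)" for b y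
  have Fint: "integrable lborel (F b)" and F0: "(\<integral>y. F b y \<partial>lborel) = 0" if b: "b \<in> Basis" for b
  proof -
    let ?p = "partial_deriv b \<phi>"
    have p: "?p \<in> test_functions" by (rule test_function_partial[OF \<phi> b])
    have pp: "partial_deriv b ?p \<in> test_functions" by (rule test_function_partial[OF p b])
    have pc: "continuous_on UNIV (partial_deriv b ?p)" by (rule test_function_continuous[OF pp])
    have Fc: "continuous_on UNIV (F b)"
      unfolding F_def[abs_def] by (intro continuous_intros pc \<phi>c)
    obtain S where S: "\<And>x. S < norm x \<Longrightarrow> ?p x = 0" using test_function_supportE[OF p] by blast
    obtain T where T: "\<And>x. T < norm x \<Longrightarrow> partial_deriv b ?p x = 0" using test_function_supportE[OF pp] by blast
    have "bounded_supp (F b)"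
      by (rule continuous_bounded_supp[OF Fc, of "max R T"]) (use R T in \<open>auto simp: F_def\<close>)
    from bounded_supp_mult_integrable[OF this, of "\<lambda>_. 1"] show "integrable lborel (F b)"
      by (auto simp: emeasure_lborel_cball_finite[unfolded infinity_ennreal_def])
    show "(\<integral>y. F b y \<partial>lborel) = 0"
    \<comment> \<open>The antiderivative \<open>h\<close> is K times the b-derivative of \<phi>
      minus \<phi> times the b-derivative of K, which explains the sign and the factor 2 *
      m.\<close>
    proof (rule integral_directional_derivative_eq_0[OF _ _ Fc, where b = b and R = "max R S"
          and h = "\<lambda>y. ?p y * q (-m) y + 2 * m * (\<phi> y * (((y - x) \<bullet> b) * q (-m-1) y))"])
      fix y
      show "((\<lambda>y. ?p y * q (-m) y + 2 * m * (\<phi> y * (((y - x) \<bullet> b) * q (-m-1) y))) has_derivative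
         (\<lambda>h. ?p y * (2 * (-m) * ((y - x) \<bullet> h) * q (-m - 1) y) + frechet_derivative ?p (at y) h * q (-m) y
            + 2 * m * (\<phi> y * (((y - x) \<bullet> b) * (2 * (-m-1) * ((y - x) \<bullet> h) * q (-m - 1 - 1) y) + (h \<bullet> b) * q (-m-1) y)
               + frechet_derivative \<phi> (at y) h * (((y - x) \<bullet> b) * q (-m-1) y)))) (at y)"
        by (intro has_derivative_add has_derivative_mult has_derivative_mult_right qD
             test_function_has_derivative[OF \<phi>] test_function_has_derivative[OF p])
           (auto intro!: derivative_eq_intros)
    next
      fix y
      have bb: "b \<bullet> b = 1" using b by simp
      have e: "-m - 1 - 1 = -m - 2" by simp
      show "?p y * (2 * (-m) * ((y - x) \<bullet> b) * q (-m - 1) y) + frechet_derivative ?p (at y) b * q (-m) y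
            + 2 * m * (\<phi> y * (((y - x) \<bullet> b) * (2 * (-m-1) * ((y - x) \<bullet> b) * q (-m - 1 - 1) y) + (b \<bullet> b) * q (-m-1) y)
               + frechet_derivative \<phi> (at y) b * (((y - x) \<bullet> b) * q (-m-1) y)) = F b y"
        unfolding F_def bb e partial_deriv_def[symmetric] by (simp add: algebra_simps power2_eq_square)
    qed (use R S b in auto)
  qed
  \<comment> \<open>The value m = (n - 2)/2 makes 2(m + 1) = n, so the terms with |x-y|^2 cancel and
    only \<epsilon>^2 survives; this is the harmonicity of the Newton kernel off its pole.\<close>
  have sumF: "(\<Sum>b\<in>Basis. F b y) = q (-m) y * laplacian \<phi> y + 2 * m * ?n * \<epsilon>\<^sup>2 * (\<phi> y * q (-m-2) y)" for y
  proof -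
    have q1: "q (-m-1) y = ((norm (x - y))\<^sup>2 + \<epsilon>\<^sup>2) * q (-m-2) y"
    proof -
      have "-m-1 = 1 + (-m-2)" by simp
      then show ?thesis using pos[of y] by (simp only: q_def powr_add) simp
    qed
    have "(\<Sum>b\<in>Basis. F b y) = q (-m) y * laplacian \<phi> y
       + 2 * m * \<phi> y * (?n * q (-m-1) y - 2 * (m + 1) * (\<Sum>b\<in>Basis. ((y - x) \<bullet> b)\<^sup>2) * q (-m-2) y)"
      by (simp add: F_def sum.distrib sum_subtractf sum_distrib_left[symmetric] sum_distrib_right[symmetric] laplacian_def)
    also have "(\<Sum>b\<in>Basis. ((y - x) \<bullet> b)\<^sup>2) = (norm (x - y))\<^sup>2"
      by (simp add: power2_norm_eq_inner norm_minus_commute[of x y] euclidean_inner[of "y - x" "y - x"] power2_eq_square[of "_ \<bullet> _"])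
    also have "2 * (m + 1) = ?n" by (simp add: m_def diff_divide_distrib)
    finally show ?thesis by (simp add: q1 algebra_simps)
  qed
  have i1: "integrable lborel (\<lambda>y. q (-m) y * laplacian \<phi> y)"
    using newton_kernel_mult_integrable[OF n test_function_laplacian(2)[OF \<phi>], of \<epsilon> x] by (simp add: kq)
  have i0: "integrable lborel (\<lambda>y. \<Sum>b\<in>Basis. F b y)" using Fint by auto
  have i2: "integrable lborel (\<lambda>y. 2 * m * ?n * \<epsilon>\<^sup>2 * (\<phi> y * q (-m-2) y))"
    using Bochner_Integration.integrable_diff[OF i0 i1] by (simp add: sumF)
  have "0 = (\<integral>y. (\<Sum>b\<in>Basis. F b y) \<partial>lborel)" using Fint F0 by simp
  also have "\<dots> = (\<integral>y. q (-m) y * laplacian \<phi> y \<partial>lborel) + (2 * m * ?n) * (\<integral>y. \<epsilon>\<^sup>2 * (\<phi> y * q (-m-2) y) \<partial>lborel)"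
    unfolding sumF using i1 i2 by (simp add: mult.assoc)
  also have "(\<integral>y. \<epsilon>\<^sup>2 * (\<phi> y * q (-m-2) y) \<partial>lborel)
      = \<epsilon> ^ DIM('a) * (\<integral>z. \<epsilon>\<^sup>2 * (\<phi> (x + \<epsilon> *\<^sub>R z) * q (-m-2) (x + \<epsilon> *\<^sub>R z)) \<partial>lborel)"
    using \<phi>c qc[of "-m-2"] e by (intro integral_lborel_affine borel_measurable_continuous_onI continuous_intros) auto
  also have "\<dots> = (\<integral>z. \<phi> (x + \<epsilon> *\<^sub>R z) * bump z \<partial>lborel)"
  proof -
    \<comment> \<open>Exponents of \<epsilon>: n from the change of variables, 2 from the factor in
      front, -(n + 2) from the kernel.\<close>
    have "\<epsilon> ^ DIM('a) * (\<epsilon>\<^sup>2 * q (-m-2) (x + \<epsilon> *\<^sub>R z)) = bump z" for z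
    proof -
      have "(norm (x - (x + \<epsilon> *\<^sub>R z)))\<^sup>2 + \<epsilon>\<^sup>2 = \<epsilon>\<^sup>2 * ((norm z)\<^sup>2 + 1)"
        by (simp add: power_mult_distrib algebra_simps)
      then have q2: "q (-m-2) (x + \<epsilon> *\<^sub>R z) = (\<epsilon>\<^sup>2) powr (-m-2) * ((norm z)\<^sup>2 + 1) powr (-m-2)"
        by (simp add: q_def powr_mult)
      have me: "-m-2 = - (?n + 2) / 2" by (simp add: m_def field_simps)
      have "(\<epsilon>\<^sup>2) powr (-m-2) = (\<epsilon> powr 2) powr (-m-2)" using e by simp
      then have e2: "(\<epsilon>\<^sup>2) powr (-m-2) = \<epsilon> powr (- (?n + 2))"
        unfolding powr_powr me by (simp add: diff_divide_distrib)
      have b: "bump z = ((norm z)\<^sup>2 + 1) powr (-m-2)" by (simp only: bump_def me)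
      have "\<epsilon> ^ DIM('a) * (\<epsilon>\<^sup>2 * q (-m-2) (x + \<epsilon> *\<^sub>R z))
         = (\<epsilon> powr ?n * \<epsilon> powr 2 * \<epsilon> powr (- (?n + 2))) * bump z"
        using e by (simp add: q2 e2 b powr_realpow)
      also have "\<epsilon> powr ?n * \<epsilon> powr 2 * \<epsilon> powr (- (?n + 2)) = 1"
        unfolding powr_add[symmetric] using e by simp
      finally show ?thesis by simp
    qed
    then have "\<epsilon> ^ DIM('a) * (\<epsilon>\<^sup>2 * (\<phi> (x + \<epsilon> *\<^sub>R z) * q (-m-2) (x + \<epsilon> *\<^sub>R z))) = \<phi> (x + \<epsilon> *\<^sub>R z) * bump z" for z
      by (metis mult.assoc mult.left_commute)
    then show ?thesis by (subst integral_mult_right_zero[symmetric]) (simp only:)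
  qed
  finally have "0 = (\<integral>y. q (-m) y * laplacian \<phi> y \<partial>lborel) + (2 * m * ?n) * (\<integral>z. \<phi> (x + \<epsilon> *\<^sub>R z) * bump z \<partial>lborel)" .
  moreover have "2 * m * ?n = ?n * (?n - 2)" by (simp add: m_def diff_divide_distrib)
  ultimately show ?thesis unfolding kq by simp
qed

text \<open>Both sides of the regularised identity converge as \<epsilon> tends to 0: one is
  dominated through the Newton kernel, the other because \<phi> is bounded and \<open>bump\<close>
  integrable. The constant A is left as an integral; its sign is what the later estimates
  use.\<close>

lemma test_function_representation:
  fixes \<phi> :: "'a::euclidean_space \<Rightarrow> real"
  assumes n: "3 \<le> DIM('a)" and \<phi>: "\<phi> \<in> test_functions"
  defines "A \<equiv> real DIM('a) * (real DIM('a) - 2) * (\<integral>z. bump (z::'a) \<partial>lborel)"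
  shows "A * \<phi> x = - (\<integral>y. newton_kernel 0 (x - y) * laplacian \<phi> y \<partial>lborel)" "0 < A"
proof -
  show "0 < A" using integral_bump_pos[where 'a='a] n by (simp add: A_def)
  let ?e = "\<lambda>m. 1 / real (Suc m)"
  have e0: "?e \<longlonglongrightarrow> 0" using LIMSEQ_inverse_real_of_nat by (simp add: inverse_eq_divide)
  note bs = test_function_laplacian(2)[OF \<phi>]
  have [measurable]: "laplacian \<phi> \<in> borel_measurable borel" "\<phi> \<in> borel_measurable borel"
    using bounded_suppD[OF bs] bounded_suppD[OF test_function_bounded_supp[OF \<phi>]] by auto
  have [measurable]: "bump \<in> borel_measurable (borel :: 'a measure)" unfolding bump_def by measurable
  have L: "(\<lambda>m. \<integral>y. newton_kernel (?e m) (x - y) * laplacian \<phi> y \<partial>lborel) \<longlonglongrightarrow> (\<integral>y. newton_kernel 0 (x - y) * laplacian \<phi> y \<partial>lborel)"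
  proof (rule integral_dominated_convergence[where w = "\<lambda>y. newton_kernel 0 (x - y) * \<bar>laplacian \<phi> y\<bar>"])
    show "integrable lborel (\<lambda>y. newton_kernel 0 (x - y) * \<bar>laplacian \<phi> y\<bar>)"
      by (rule newton_kernel_mult_integrable[OF n bounded_supp_abs[OF bs]])
    show "AE y in lborel. (\<lambda>m. newton_kernel (?e m) (x - y) * laplacian \<phi> y) \<longlonglongrightarrow> newton_kernel 0 (x - y) * laplacian \<phi> y"
      using AE_neq[of x] by eventually_elim (intro tendsto_mult newton_kernel_tendsto tendsto_const, auto)
    show "AE y in lborel. norm (newton_kernel (?e m) (x - y) * laplacian \<phi> y) \<le> newton_kernel 0 (x - y) * \<bar>laplacian \<phi> y\<bar>" for m
      using AE_neq[of x]
      by eventually_elim (use n in \<open>auto simp: abs_mult intro!: mult_right_mono newton_kernel_le\<close>)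
  qed measurable
  obtain M R where "0 \<le> M" "0 \<le> R" and M': "\<And>x. \<bar>\<phi> x\<bar> \<le> M * indicator (cball 0 R) x"
    using bounded_suppE[OF test_function_bounded_supp[OF \<phi>]] by metis
  note M = \<open>0 \<le> M\<close> M'
  have \<phi>M: "\<bar>\<phi> x\<bar> \<le> M" for x using M(2)[of x] M(1) by (cases "norm x \<le> R") auto
  have "(\<lambda>m. \<integral>z. \<phi> (x + ?e m *\<^sub>R z) * bump z \<partial>lborel) \<longlonglongrightarrow> (\<integral>z. \<phi> x * bump (z::'a) \<partial>lborel)"
  proof (rule integral_dominated_convergence[where w = "\<lambda>z::'a. M * bump z"])
    show "integrable lborel (\<lambda>z::'a. M * bump z)" by (simp add: bump_integrable)
    show "AE z in lborel. (\<lambda>m. \<phi> (x + ?e m *\<^sub>R z) * bump z) \<longlonglongrightarrow> \<phi> x * bump z"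
    proof (rule AE_I2)
      fix z
      have "(\<lambda>m. x + ?e m *\<^sub>R z) \<longlonglongrightarrow> x + 0 *\<^sub>R z" by (intro tendsto_intros e0)
      then have lim: "(\<lambda>m. x + ?e m *\<^sub>R z) \<longlonglongrightarrow> x" unfolding scaleR_zero_left add_0_right .
      have "isCont \<phi> x"
        using test_function_continuous[OF \<phi>] by (simp add: continuous_on_eq_continuous_at)
      from isCont_tendsto_compose[OF this lim] show "(\<lambda>m. \<phi> (x + ?e m *\<^sub>R z) * bump z) \<longlonglongrightarrow> \<phi> x * bump z"
        by (intro tendsto_mult tendsto_const)
    qed
    show "AE z in lborel. norm (\<phi> (x + ?e m *\<^sub>R z) * bump z) \<le> M * bump z" for m
      using \<phi>M by (intro AE_I2) (auto simp: abs_mult bump_def intro!: mult_right_mono)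
  qed measurable
  then have "(\<lambda>m. - (real DIM('a) * (real DIM('a) - 2)) * (\<integral>z. \<phi> (x + ?e m *\<^sub>R z) * bump z \<partial>lborel))
     \<longlonglongrightarrow> - (real DIM('a) * (real DIM('a) - 2)) * (\<integral>z. \<phi> x * bump (z::'a) \<partial>lborel)"
    by (rule tendsto_mult_left)
  then have "(\<lambda>m. \<integral>y. newton_kernel (?e m) (x - y) * laplacian \<phi> y \<partial>lborel)
     \<longlonglongrightarrow> - (real DIM('a) * (real DIM('a) - 2)) * (\<integral>z. \<phi> x * bump (z::'a) \<partial>lborel)"
    by (simp add: newton_kernel_integral_laplacian[OF n \<phi>])
  from LIMSEQ_unique[OF L this] show "A * \<phi> x = - (\<integral>y. newton_kernel 0 (x - y) * laplacian \<phi> y \<partial>lborel)"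
    by (simp add: A_def)
qed

section \<open>Weighted bounds for potentials\<close>

text \<open>A common class for the Newton kernel and its regularisation errors: each estimate is
  proved once, with a bound \<open>J k\<close> that tends to 0 along the errors.\<close>

definition dominated_kernel :: "('a::euclidean_space \<Rightarrow> real) \<Rightarrow> bool" where
  "dominated_kernel k \<longleftrightarrow> k \<in> borel_measurable borel \<and> (\<forall>z. 0 \<le> k z \<and> k z \<le> newton_kernel 0 z)"

text \<open>Integrals are normalised instead of norms, which spares outer roots. Bounded support is
  purely qualitative here: the constants below depend neither on the support nor on the supremum of
  w.\<close>

definition unit_source :: "real \<Rightarrow> ('a::euclidean_space \<Rightarrow> real) \<Rightarrow> bool" where
  "unit_source p w \<longleftrightarrow> bounded_supp w \<and> (\<integral>x. \<bar>w x\<bar> powr p \<partial>lborel) \<le> 1 \<and>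
     (\<integral>x. \<bar>w x\<bar> powr (real DIM('a) / 2) \<partial>lborel) \<le> 1"

definition convol :: "('a::euclidean_space \<Rightarrow> real) \<Rightarrow> ('a \<Rightarrow> real) \<Rightarrow> 'a \<Rightarrow> real" where
  "convol k w x = (\<integral>y. k (x - y) * w y \<partial>lborel)"

text \<open>Since \<open>newton_kernel 0 0 = 0\<close> by the convention for \<open>powr\<close>, the plain difference would be negative at \<open>0\<close>.\<close>

definition kernel_error :: "nat \<Rightarrow> 'a::euclidean_space \<Rightarrow> real" where
  "kernel_error m z =
     (if z = 0 then 0 else newton_kernel 0 z - newton_kernel (1 / real (Suc m)) z)"

lemma convol_measurable[measurable]:
  assumes [measurable]: "k \<in> borel_measurable borel" "w \<in> borel_measurable borel"
  shows "convol k w \<in> borel_measurable borel"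
  unfolding convol_def[abs_def] by measurable

lemma dominated_newton_kernel: "dominated_kernel (newton_kernel 0)"
  by (simp add: dominated_kernel_def)

lemma dominated_kernel_error: "2 \<le> DIM('a) \<Longrightarrow> dominated_kernel (kernel_error m :: 'a::euclidean_space \<Rightarrow> real)"
proof -
  assume n: "2 \<le> DIM('a)"
  have "kernel_error m \<in> borel_measurable (borel :: 'a measure)"
    unfolding kernel_error_def by measurable
  then show ?thesis
    using newton_kernel_le[where 'a='a] n by (auto simp: dominated_kernel_def kernel_error_def)
qed

lemma kernel_error_tendsto: "(\<lambda>m. kernel_error m z) \<longlonglongrightarrow> 0"
proof (cases "z = 0")
  case False
  from tendsto_diff[OF tendsto_const[of "newton_kernel 0 z"] newton_kernel_tendsto[OF False]]
  show ?thesis using False by (simp add: kernel_error_def)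
qed (simp add: kernel_error_def)

text \<open>Comparison with twice the larger term, valid for every positive s. This weak triangle
  inequality is used in place of Minkowski's.\<close>

lemma powr_add_le:
  fixes a b :: real
  assumes "0 \<le> a" "0 \<le> b" "0 < s"
  shows "(a + b) powr s \<le> 2 powr s * (a powr s + b powr s)"
proof -
  have "(a + b) powr s \<le> (2 * max a b) powr s" using assms by (intro powr_mono2) auto
  also have "\<dots> = 2 powr s * max a b powr s" using assms by (subst powr_mult) auto
  also have "\<dots> \<le> 2 powr s * (a powr s + b powr s)"
    by (intro mult_left_mono) (auto simp: max_def)
  finally show ?thesis .
qed

text \<open>Meant for the unit ball and its complement, each with its own exponent a. The power of
  the Newton kernel is integrable on the piece and dominates, so the errors tend to 0 there.\<close>

lemma dominated_piece:
  fixes S :: "'a::euclidean_space set"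
  assumes S: "S \<in> sets borel" and a: "0 < a" and n: "2 \<le> DIM('a)"
    and int: "integrable lborel (\<lambda>z::'a. indicator S z * newton_kernel 0 z powr a)"
  shows "dominated_kernel k \<Longrightarrow> integrable lborel (\<lambda>z. (indicator S z * k z) powr a)"
    and "(\<lambda>m. \<integral>z. (indicator S z * kernel_error m z) powr a \<partial>lborel) \<longlonglongrightarrow> 0"
proof -
  have le: "norm ((indicator S z * k z) powr a) \<le> indicator S z * newton_kernel 0 z powr a"
    if "dominated_kernel k" for k :: "'a \<Rightarrow> real" and z
    using that a by (auto simp: dominated_kernel_def indicator_def intro!: powr_mono2)
  have meas: "(\<lambda>z. (indicator S z * k z) powr a) \<in> borel_measurable lborel"
    if "dominated_kernel k" for k :: "'a \<Rightarrow> real"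
  proof -
    have [measurable]: "k \<in> borel_measurable borel" using that by (simp add: dominated_kernel_def)
    show ?thesis using S by measurable
  qed
  show "integrable lborel (\<lambda>z. (indicator S z * k z) powr a)" if "dominated_kernel k"
  proof (rule Bochner_Integration.integrable_bound[OF int meas[OF that]])
    show "AE z in lborel. norm ((indicator S z * k z) powr a) \<le> norm (indicator S z * newton_kernel 0 z powr a :: real)"
      using le[OF that] order_trans[OF _ abs_ge_self] by (intro AE_I2) (simp only: real_norm_def, blast)
  qed
  have "(\<lambda>m. \<integral>z. (indicator S z * kernel_error m z) powr a \<partial>lborel) \<longlonglongrightarrow> (\<integral>(z::'a). 0 \<partial>lborel)"
  proof (rule integral_dominated_convergence[OF _ _ int])
    show "AE z in lborel. (\<lambda>m. (indicator S z * kernel_error m (z::'a)) powr a) \<longlonglongrightarrow> 0"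
    proof (rule AE_I2)
      fix z :: 'a
      have "(\<lambda>m. indicator S z * kernel_error m z) \<longlonglongrightarrow> indicator S z * 0"
        by (intro tendsto_mult tendsto_const kernel_error_tendsto)
      then show "(\<lambda>m. (indicator S z * kernel_error m (z::'a)) powr a) \<longlonglongrightarrow> 0"
        using a dominated_kernel_error[OF n]
        by (intro tendsto_zero_powrI) (auto simp: dominated_kernel_def)
    qed
  qed (use le meas dominated_kernel_error[OF n] in auto)
  then show "(\<lambda>m. \<integral>z. (indicator S z * kernel_error m z) powr a \<partial>lborel) \<longlonglongrightarrow> 0" by simp
qed

text \<open>Crude interpolation: |w|^q is at most |w|^p where |w| \<le> 1 and at most |w|^(n/2)
  elsewhere; the 2 adds the two unit bounds.\<close>

lemma unit_source_powr_le:
  fixes w :: "'a::euclidean_space \<Rightarrow> real"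
  assumes w: "unit_source p w" and q: "p \<le> q" "q \<le> real DIM('a) / 2" and p: "0 < p"
  shows "(\<integral>x. \<bar>w x\<bar> powr q \<partial>lborel) \<le> 2"
proof -
  note int = bounded_supp_powr_integrable[of w]
  have w': "bounded_supp w" using w by (simp add: unit_source_def)
  have "(\<integral>x. \<bar>w x\<bar> powr q \<partial>lborel) \<le> (\<integral>x. \<bar>w x\<bar> powr p + \<bar>w x\<bar> powr (real DIM('a) / 2) \<partial>lborel)"
  proof (rule integral_mono)
    fix x
    show "\<bar>w x\<bar> powr q \<le> \<bar>w x\<bar> powr p + \<bar>w x\<bar> powr (real DIM('a) / 2)"
    proof (cases "\<bar>w x\<bar> \<le> 1")
      case True
      then have "\<bar>w x\<bar> powr q \<le> \<bar>w x\<bar> powr p" using q by (intro powr_mono') auto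
      then show ?thesis by (smt (verit) powr_ge_zero)
    next
      case False
      then have "\<bar>w x\<bar> powr q \<le> \<bar>w x\<bar> powr (real DIM('a) / 2)" using q by (intro powr_mono) auto
      then show ?thesis by (smt (verit) powr_ge_zero)
    qed
  qed (use p q int[OF w'] in auto)
  also have "\<dots> \<le> 2" using w int[OF w', of p] int[OF w', of "real DIM('a) / 2"] p
    by (simp add: unit_source_def)
  finally show ?thesis .
qed

text \<open>
  The kernel is split at \<open>norm z = 1\<close>. Since \<open>s\<close> exceeds the critical exponent, Young's inequality
  applies to the inner part with a source exponent slightly above, and to the outer part with the
  source exponent \<open>p\<close> below, the one dictated by scaling; so Hardy-Littlewood-Sobolev is not needed.
\<close>

lemma convol_Lp_bound:
  fixes p s :: real
  assumes n: "3 \<le> DIM('a::euclidean_space)" and p: "1 < p" "p < real DIM('a) / 2"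
    and s: "p_star DIM('a) p < s"
  obtains J :: "('a::euclidean_space \<Rightarrow> real) \<Rightarrow> real" where
    "\<And>k. 0 \<le> J k" "(\<lambda>m. J (kernel_error m)) \<longlonglongrightarrow> 0"
    "\<And>k w. dominated_kernel k \<Longrightarrow> unit_source p w \<Longrightarrow>
       (\<integral>\<^sup>+x. ennreal (convol k (\<lambda>y. \<bar>w y\<bar>) x powr s) \<partial>lborel) \<le> ennreal (J k)"
proof -
  let ?n = "real DIM('a)"
  have n0: "0 < ?n" by simp
  have d: "0 < ?n - 2 * p" using p by simp
  have ps: "p_star DIM('a) p = ?n * p / (?n - 2 * p)" by (simp add: p_star_def)
  have ps_pos: "0 < p_star DIM('a) p" using d p n0 by (simp add: ps)
  have s0: "0 < s" using s ps_pos by simp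
  have "1 / s < 1 / p_star DIM('a) p" using s ps_pos by (simp add: frac_less2)
  also have "1 / p_star DIM('a) p = 1 / p - 2 / ?n" using d p n0 by (simp add: ps field_simps)
  finally have sp: "1 / s < 1 / p - 2 / ?n" .
  have p1: "1 / p < 1" "0 < 1 / p" using p by auto
  have pn: "2 / ?n < 1 / p" using p n0 by (simp add: field_simps)
  have s1: "0 < 1 / s" using s0 by simp
  have n2: "0 < 2 / ?n" by simp
  \<comment> \<open>Here t is 1/q for the source exponent of the inner part. The bounds 2/n < t <
    1/p place q between p and n/2; 1/s < t makes the kernel exponent a1 exceed 1; t < 1/s + 2/n is
    equivalent to (n - 2) a1 < n, integrability at the singularity.\<close>
  obtain t where t: "1 / s < t" "2 / ?n < t" "t < 1 / s + 2 / ?n" "t < 1 / p"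
    using dense[of "max (1 / s) (2 / ?n)" "min (1 / s + 2 / ?n) (1 / p)"] sp pn s1 n2 by auto
  define q where "q = 1 / t"
  define a1 where "a1 = 1 / (1 + 1 / s - t)"
  \<comment> \<open>The outer part keeps the source exponent p. Since the critical exponent has
    reciprocal 1/p - 2/n, the strict inequality for s says exactly that (n - 2) a2 > n,
    integrability at infinity.\<close>
  define a2 where "a2 = 1 / (1 + 1 / s - 1 / p)"
  have t0: "0 < t" using t n2 by linarith
  have q: "p < q" "q < ?n / 2" "1 < q" "1 / q = t"
    using t t0 p n0 less_trans[OF t(4) p1(1)] by (auto simp: q_def field_simps)
  have b1: "0 < 1 + 1 / s - t" "1 + 1 / s - t < 1" "1 - 2 / ?n < 1 + 1 / s - t" using t p1 s1 by linarith+
  have b2: "0 < 1 + 1 / s - 1 / p" "1 + 1 / s - 1 / p < 1 - 2 / ?n" using p1 s1 sp by linarith+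
  have a1: "1 < a1" "1 / a1 + 1 / q = 1 + 1 / s" using b1 q by (auto simp: a1_def)
  have "1 + 1 / s - 1 / p < 1" using b2 n2 by linarith
  then have a2: "1 < a2" "1 / a2 + 1 / p = 1 + 1 / s" using b2 by (auto simp: a2_def less_divide_eq)
  have a1n: "(?n - 2) * a1 < ?n"
  proof -
    have "?n - 2 = ?n * (1 - 2 / ?n)" by (simp add: field_simps)
    also have "\<dots> < ?n * (1 + 1 / s - t)" using b1 n0 by (intro mult_strict_left_mono) auto
    finally show ?thesis using b1 by (simp add: a1_def pos_divide_less_eq)
  qed
  have a2n: "?n < (?n - 2) * a2"
  proof -
    have "?n * (1 + 1 / s - 1 / p) < ?n * (1 - 2 / ?n)" using b2 n0 by (intro mult_strict_left_mono) auto
    also have "\<dots> = ?n - 2" by (simp add: field_simps)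
    finally show ?thesis using b2 by (simp add: a2_def pos_less_divide_eq)
  qed
  have N: "indicator S z * newton_kernel 0 z powr a = indicator S z * norm z powr (- ((?n - 2) * a))"
    for S and z :: 'a and a
    by (simp add: newton_kernel_0 powr_powr algebra_simps)
  have i1: "integrable lborel (\<lambda>z::'a. indicator (cball 0 1) z * newton_kernel 0 z powr a1)"
    unfolding N using a1 a1n n by (intro integrable_norm_powr_cball) auto
  have i2: "integrable lborel (\<lambda>z::'a. indicator (- cball 0 1) z * newton_kernel 0 z powr a2)"
    unfolding N using a2n by (intro integrable_norm_powr_compl_cball) auto
  have n2': "2 \<le> DIM('a)" and a10: "0 < a1" and a20: "0 < a2" using n a1 a2 by auto
  note D1 = dominated_piece[OF _ a10 n2' i1, simplified]
  note D2 = dominated_piece[OF _ a20 n2' i2, simplified]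
  define I1 where "I1 k = (\<integral>z. (indicator (cball 0 1) z * k z) powr a1 \<partial>lborel)" for k :: "'a \<Rightarrow> real"
  define I2 where "I2 k = (\<integral>z. (indicator (- cball 0 1) z * k z) powr a2 \<partial>lborel)" for k :: "'a \<Rightarrow> real"
  \<comment> \<open>The leading factor pays for adding the two parts; \<open>2 powr (s / q)\<close>
    is the interpolation bound 2 on the source. Both exponents of I1 and I2 are positive, so J
    vanishes with them.\<close>
  define J where "J k = 2 powr s * (I1 k powr (s / a1) * 2 powr (s / q) + I2 k powr (s / a2))" for k
  show thesis
  proof (rule that[of J])
    show "0 \<le> J k" for k by (simp add: J_def)
    have I: "(\<lambda>m. I1 (kernel_error m)) \<longlonglongrightarrow> 0" "(\<lambda>m. I2 (kernel_error m)) \<longlonglongrightarrow> 0"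
      unfolding I1_def I2_def by (rule D1(2) D2(2))+
    have "0 < s / a1" "0 < s / a2" using s0 a10 a20 by auto
    then have "(\<lambda>m. J (kernel_error m)) \<longlonglongrightarrow> 2 powr s * (0 * 2 powr (s / q) + 0)"
      unfolding J_def
      by (intro tendsto_add tendsto_mult tendsto_const
          tendsto_zero_powrI[OF I(1) tendsto_const] tendsto_zero_powrI[OF I(2) tendsto_const])
         (auto simp: I1_def I2_def)
    then show "(\<lambda>m. J (kernel_error m)) \<longlonglongrightarrow> 0" by simp
  next
    fix k w :: "'a \<Rightarrow> real"
    assume k: "dominated_kernel k" and w: "unit_source p w"
    have [measurable]: "k \<in> borel_measurable borel" and k0: "\<And>z. 0 \<le> k z"
      using k by (auto simp: dominated_kernel_def)
    have ws: "bounded_supp (\<lambda>y. \<bar>w y\<bar>)" using w bounded_supp_abs by (auto simp: unit_source_def)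
    have wm[measurable]: "(\<lambda>y. \<bar>w y\<bar>) \<in> borel_measurable borel" by (rule bounded_suppD[OF ws])
    let ?k1 = "\<lambda>z. indicator (cball 0 1) z * k z" and ?k2 = "\<lambda>z. indicator (- cball 0 1) z * k z"
    have [measurable]: "?k1 \<in> borel_measurable borel" "?k2 \<in> borel_measurable borel"
      by (auto intro!: borel_measurable_times borel_measurable_indicator)
    note Y1 = Young_convolution[of ?k1 "\<lambda>y. \<bar>w y\<bar>" a1 q s, OF _ _ ws _ a1(1) q(3) s0 a1(2)]
    note Y2 = Young_convolution[of ?k2 "\<lambda>y. \<bar>w y\<bar>" a2 p s, OF _ _ ws _ a2(1) p(1) s0 a2(2)]
    have int1: "integrable lborel (\<lambda>y. ?k1 (x - y) * \<bar>w y\<bar>)" for x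
      by (rule Y1(2)) (use k0 D1(1)[OF k] in auto)
    have int2: "integrable lborel (\<lambda>y. ?k2 (x - y) * \<bar>w y\<bar>)" for x
      by (rule Y2(2)) (use k0 D2(1)[OF k] in auto)
    have split: "convol k (\<lambda>y. \<bar>w y\<bar>) x = convol ?k1 (\<lambda>y. \<bar>w y\<bar>) x + convol ?k2 (\<lambda>y. \<bar>w y\<bar>) x" for x
      unfolding convol_def
      by (subst Bochner_Integration.integral_add[OF int1 int2, symmetric])
         (auto intro!: Bochner_Integration.integral_cong simp: indicator_def)
    have nn: "0 \<le> convol ?k1 (\<lambda>y. \<bar>w y\<bar>) x" "0 \<le> convol ?k2 (\<lambda>y. \<bar>w y\<bar>) x" for x
      unfolding convol_def using k0 by (auto intro!: integral_nonneg_AE)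
    have "(\<integral>\<^sup>+x. ennreal (convol k (\<lambda>y. \<bar>w y\<bar>) x powr s) \<partial>lborel)
      \<le> (\<integral>\<^sup>+x. ennreal (2 powr s) * (ennreal (convol ?k1 (\<lambda>y. \<bar>w y\<bar>) x powr s) + ennreal (convol ?k2 (\<lambda>y. \<bar>w y\<bar>) x powr s)) \<partial>lborel)"
      unfolding split using powr_add_le[OF nn s0]
      by (intro nn_integral_mono) (simp add: ennreal_plus[symmetric] ennreal_mult[symmetric] ennreal_leI del: ennreal_plus)
    also have "\<dots> = ennreal (2 powr s) * ((\<integral>\<^sup>+x. ennreal (convol ?k1 (\<lambda>y. \<bar>w y\<bar>) x powr s) \<partial>lborel)
        + (\<integral>\<^sup>+x. ennreal (convol ?k2 (\<lambda>y. \<bar>w y\<bar>) x powr s) \<partial>lborel))"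
      by (subst nn_integral_cmult, measurable, subst nn_integral_add, measurable)
    also have "\<dots> \<le> ennreal (2 powr s) * (ennreal (I1 k powr (s / a1) * 2 powr (s / q)) + ennreal (I2 k powr (s / a2)))"
    proof (intro mult_left_mono add_mono)
      have "(\<integral>\<^sup>+x. ennreal (convol ?k1 (\<lambda>y. \<bar>w y\<bar>) x powr s) \<partial>lborel)
          \<le> ennreal (I1 k powr (s / a1) * (\<integral>x. \<bar>w x\<bar> powr q \<partial>lborel) powr (s / q))"
        unfolding convol_def I1_def by (rule Y1(1)) (use k0 D1(1)[OF k] in auto)
      also have "\<dots> \<le> ennreal (I1 k powr (s / a1) * 2 powr (s / q))"
        using unit_source_powr_le[OF w, of q] q p s0
        by (intro ennreal_leI mult_left_mono powr_mono2) auto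
      finally show "(\<integral>\<^sup>+x. ennreal (convol ?k1 (\<lambda>y. \<bar>w y\<bar>) x powr s) \<partial>lborel)
          \<le> ennreal (I1 k powr (s / a1) * 2 powr (s / q))" .
      have "(\<integral>\<^sup>+x. ennreal (convol ?k2 (\<lambda>y. \<bar>w y\<bar>) x powr s) \<partial>lborel)
          \<le> ennreal (I2 k powr (s / a2) * (\<integral>x. \<bar>w x\<bar> powr p \<partial>lborel) powr (s / p))"
        unfolding convol_def I2_def by (rule Y2(1)) (use k0 D2(1)[OF k] in auto)
      also have "\<dots> \<le> ennreal (I2 k powr (s / a2) * 1 powr (s / p))"
        using w p s0 by (intro ennreal_leI mult_left_mono powr_mono2) (auto simp: unit_source_def)
      finally show "(\<integral>\<^sup>+x. ennreal (convol ?k2 (\<lambda>y. \<bar>w y\<bar>) x powr s) \<partial>lborel)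
          \<le> ennreal (I2 k powr (s / a2))" by simp
    qed auto
    also have "\<dots> = ennreal (J k)"
      by (simp add: J_def ennreal_plus[symmetric] ennreal_mult[symmetric] del: ennreal_plus)
    finally show "(\<integral>\<^sup>+x. ennreal (convol k (\<lambda>y. \<bar>w y\<bar>) x powr s) \<partial>lborel) \<le> ennreal (J k)" .
  qed
qed

text \<open>Since u^\<rho> = (u^(\<rho>/\<alpha>))^\<alpha>, Hoelder's inequality trades the weight
  for a larger exponent \<rho>/\<alpha> of u.\<close>

lemma Holder_weight_bound:
  fixes u g :: "'a::euclidean_space \<Rightarrow> real"
  assumes [measurable]: "u \<in> borel_measurable borel" and u0: "\<And>x. 0 \<le> u x"
    and g: "integrable lborel g" "\<And>x. 0 \<le> g x" and \<alpha>: "0 < \<alpha>" "\<alpha> < 1" and "0 < \<rho>" and E: "0 \<le> E"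
    and le: "(\<integral>\<^sup>+x. ennreal (u x powr (\<rho> / \<alpha>)) \<partial>lborel) \<le> ennreal E"
  shows "(\<integral>\<^sup>+x. ennreal (u x powr \<rho> * g x powr (1 - \<alpha>)) \<partial>lborel) \<le> ennreal (E powr \<alpha> * (\<integral>x. g x \<partial>lborel) powr (1 - \<alpha>))"
proof -
  have i: "integrable lborel (\<lambda>x. u x powr (\<rho> / \<alpha>))"
  proof (rule integrableI_bounded)
    show "(\<integral>\<^sup>+x. ennreal (norm (u x powr (\<rho> / \<alpha>))) \<partial>lborel) < \<infinity>"
      using le_less_trans[OF le ennreal_less_top] by simp
  qed measurable
  have "ennreal (\<integral>x. u x powr (\<rho> / \<alpha>) \<partial>lborel) \<le> ennreal E"
    using le by (subst (asm) nn_integral_eq_integral[OF i]) auto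
  then have E': "(\<integral>x. u x powr (\<rho> / \<alpha>) \<partial>lborel) \<le> E" using E by simp
  note H = Holder_inequality[OF \<alpha>(1), of "1 - \<alpha>", OF _ _ i _ g, simplified]
  have eq: "(u x powr (\<rho> / \<alpha>)) powr \<alpha> = u x powr \<rho>" for x using \<alpha> by (simp add: powr_powr)
  have "(\<integral>\<^sup>+x. ennreal (u x powr \<rho> * g x powr (1 - \<alpha>)) \<partial>lborel) = ennreal (\<integral>x. u x powr \<rho> * g x powr (1 - \<alpha>) \<partial>lborel)"
    using H(1) \<alpha> by (intro nn_integral_eq_integral) (auto simp: eq)
  also have "\<dots> \<le> ennreal ((\<integral>x. u x powr (\<rho> / \<alpha>) \<partial>lborel) powr \<alpha> * (\<integral>x. g x \<partial>lborel) powr (1 - \<alpha>))"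
    using H(2) \<alpha> by (intro ennreal_leI) (auto simp: eq)
  also have "\<dots> \<le> ennreal (E powr \<alpha> * (\<integral>x. g x \<partial>lborel) powr (1 - \<alpha>))"
    using E' \<alpha> by (intro ennreal_leI mult_right_mono powr_mono2) auto
  finally show ?thesis .
qed

text \<open>
  The weight improves integrability at infinity, so that the critical exponent itself is covered by
  strictly larger unweighted exponents.
\<close>

lemma convol_weighted_bound:
  fixes p \<gamma> \<rho> :: real
  assumes n: "3 \<le> DIM('a::euclidean_space)" and p: "1 < p" "p < real DIM('a) / 2"
    and \<gamma>: "0 < \<gamma>" "\<gamma> < real DIM('a)" and \<rho>: "p_star DIM('a) p \<le> \<rho>"
  shows "\<exists>J :: ('a::euclidean_space \<Rightarrow> real) \<Rightarrow> real.
    (\<forall>k. 0 \<le> J k) \<and> (\<lambda>m. J (kernel_error m)) \<longlonglongrightarrow> 0 \<and>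
    (\<forall>k w. dominated_kernel k \<longrightarrow> unit_source p w \<longrightarrow>
       (\<integral>\<^sup>+x. ennreal (convol k (\<lambda>y. \<bar>w y\<bar>) x powr \<rho> * norm x powr (-\<gamma>)) \<partial>lborel) \<le> ennreal (J k))"
proof -
  let ?n = "real DIM('a)"
  have d: "0 < ?n - 2 * p" using p by simp
  have n0: "0 < ?n" by simp
  have ps_pos: "0 < p_star DIM('a) p" using d p n0 by (simp add: p_star_def)
  then have \<rho>0: "0 < \<rho>" using \<rho> by simp
  \<comment> \<open>The threshold is 1 - \<gamma>/n: below it \<gamma>/(1 - \<alpha>) < n and the
    weight is integrable at 0, above it \<gamma>/(1 - \<beta>) > n and it is integrable at infinity.
    The two values are the midpoints between the threshold and 0 and 1.\<close>
  define \<alpha> \<beta> where "\<alpha> = (1 - \<gamma> / ?n) / 2" and "\<beta> = 1 - \<gamma> / (2 * ?n)"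
  have gn: "0 < \<gamma> / ?n" "\<gamma> / ?n < 1" using \<gamma> by auto
  have \<alpha>: "0 < \<alpha>" "\<alpha> < 1" using gn by (auto simp: \<alpha>_def)
  have \<beta>: "0 < \<beta>" "\<beta> < 1" using gn by (auto simp: \<beta>_def)
  have s: "p_star DIM('a) p < \<rho> / \<alpha>" "p_star DIM('a) p < \<rho> / \<beta>"
    by (rule le_less_trans[OF \<rho>], use \<rho>0 \<alpha> \<beta> in \<open>simp add: less_divide_eq\<close>)+
  have wa: "0 < \<gamma> / (1 - \<alpha>)" "\<gamma> / (1 - \<alpha>) < ?n"
  proof -
    have e: "1 - \<alpha> = (?n + \<gamma>) / (2 * ?n)" by (simp add: \<alpha>_def field_simps)
    show "0 < \<gamma> / (1 - \<alpha>)" using \<alpha> \<gamma> by simp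
    have "\<gamma> < ?n * ((?n + \<gamma>) / (2 * ?n))" using \<gamma> n0 by (simp add: field_simps)
    then show "\<gamma> / (1 - \<alpha>) < ?n" using \<alpha> by (simp add: e[symmetric] pos_divide_less_eq)
  qed
  have wb: "?n < \<gamma> / (1 - \<beta>)"
  proof -
    have "?n * (1 - \<beta>) < \<gamma>" using \<gamma> n0 by (simp add: \<beta>_def)
    then show ?thesis using \<beta> by (simp add: pos_less_divide_eq)
  qed
  define g1 where "g1 x = indicator (cball 0 1) x * norm x powr (- (\<gamma> / (1 - \<alpha>)))" for x :: 'a
  define g2 where "g2 x = indicator (- cball 0 1) x * norm x powr (- (\<gamma> / (1 - \<beta>)))" for x :: 'a
  have g1: "integrable lborel g1" "\<And>x. 0 \<le> g1 x"
    unfolding g1_def using wa by (auto intro: integrable_norm_powr_cball)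
  have g2: "integrable lborel g2" "\<And>x. 0 \<le> g2 x"
    unfolding g2_def using wb by (auto intro: integrable_norm_powr_compl_cball)
  have gg: "norm x powr (-\<gamma>) = g1 x powr (1 - \<alpha>) + g2 x powr (1 - \<beta>)" for x
    using \<alpha> \<beta> by (cases "norm x \<le> 1") (auto simp: g1_def g2_def powr_powr)
  obtain J1 where J1: "\<And>k. 0 \<le> J1 k" "(\<lambda>m. J1 (kernel_error m :: 'a \<Rightarrow> real)) \<longlonglongrightarrow> 0"
    "\<And>k w. dominated_kernel k \<Longrightarrow> unit_source p w \<Longrightarrow>
       (\<integral>\<^sup>+x. ennreal (convol k (\<lambda>y. \<bar>w y\<bar>) x powr (\<rho> / \<alpha>)) \<partial>lborel) \<le> ennreal (J1 k)"
    using convol_Lp_bound[OF n p s(1)] by blast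
  obtain J2 where J2: "\<And>k. 0 \<le> J2 k" "(\<lambda>m. J2 (kernel_error m :: 'a \<Rightarrow> real)) \<longlonglongrightarrow> 0"
    "\<And>k w. dominated_kernel k \<Longrightarrow> unit_source p w \<Longrightarrow>
       (\<integral>\<^sup>+x. ennreal (convol k (\<lambda>y. \<bar>w y\<bar>) x powr (\<rho> / \<beta>)) \<partial>lborel) \<le> ennreal (J2 k)"
    using convol_Lp_bound[OF n p s(2)] by blast
  define J where "J k = J1 k powr \<alpha> * (\<integral>x. g1 x \<partial>lborel) powr (1 - \<alpha>) + J2 k powr \<beta> * (\<integral>x. g2 x \<partial>lborel) powr (1 - \<beta>)" for k
  show ?thesis
  proof (rule exI[of _ J], intro conjI allI impI)
    show "0 \<le> J k" for k by (simp add: J_def)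
    have "(\<lambda>m. J (kernel_error m)) \<longlonglongrightarrow> 0 * (\<integral>x. g1 x \<partial>lborel) powr (1 - \<alpha>) + 0 * (\<integral>x. g2 x \<partial>lborel) powr (1 - \<beta>)"
      unfolding J_def
      by (intro tendsto_add tendsto_mult tendsto_const
          tendsto_zero_powrI[OF J1(2) tendsto_const _ \<alpha>(1)] tendsto_zero_powrI[OF J2(2) tendsto_const _ \<beta>(1)])
         (simp_all add: J1(1) J2(1))
    then show "(\<lambda>m. J (kernel_error m)) \<longlonglongrightarrow> 0" by simp
  next
    fix k w :: "'a \<Rightarrow> real"
    assume k: "dominated_kernel k" and w: "unit_source p w"
    have [measurable]: "k \<in> borel_measurable borel" and k0: "\<And>z. 0 \<le> k z"
      using k by (auto simp: dominated_kernel_def)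
    have [measurable]: "(\<lambda>y. \<bar>w y\<bar>) \<in> borel_measurable borel"
      using w bounded_suppD bounded_supp_abs by (auto simp: unit_source_def)
    let ?u = "convol k (\<lambda>y. \<bar>w y\<bar>)"
    have u0: "0 \<le> ?u x" for x unfolding convol_def using k0 by (auto intro!: integral_nonneg_AE)
    have um[measurable]: "?u \<in> borel_measurable borel" by measurable
    have [measurable]: "g1 \<in> borel_measurable borel" "g2 \<in> borel_measurable borel"
      using g1 g2 borel_measurable_integrable by fastforce+
    have "(\<integral>\<^sup>+x. ennreal (?u x powr \<rho> * norm x powr (-\<gamma>)) \<partial>lborel)
       = (\<integral>\<^sup>+x. ennreal (?u x powr \<rho> * g1 x powr (1 - \<alpha>)) + ennreal (?u x powr \<rho> * g2 x powr (1 - \<beta>)) \<partial>lborel)"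
      by (simp add: gg distrib_left)
    also have "\<dots> = (\<integral>\<^sup>+x. ennreal (?u x powr \<rho> * g1 x powr (1 - \<alpha>)) \<partial>lborel) + (\<integral>\<^sup>+x. ennreal (?u x powr \<rho> * g2 x powr (1 - \<beta>)) \<partial>lborel)"
      by (rule nn_integral_add) measurable
    also have "\<dots> \<le> ennreal (J1 k powr \<alpha> * (\<integral>x. g1 x \<partial>lborel) powr (1 - \<alpha>)) + ennreal (J2 k powr \<beta> * (\<integral>x. g2 x \<partial>lborel) powr (1 - \<beta>))"
      by (intro add_mono Holder_weight_bound um u0 g1 g2 \<alpha> \<beta> \<rho>0 J1(1) J2(1) J1(3)[OF k w] J2(3)[OF k w])
    also have "\<dots> = ennreal (J k)" by (simp add: J_def)
    finally show "(\<integral>\<^sup>+x. ennreal (?u x powr \<rho> * norm x powr (-\<gamma>)) \<partial>lborel) \<le> ennreal (J k)" .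
  qed
qed

section \<open>Compactness for potentials\<close>

text \<open>The dual exponent satisfies (n-2) p/(p-1) > n precisely because p < n/2, which settles
  infinity; near 0 the regularised kernel is bounded.\<close>

lemma newton_kernel_dual_integrable:
  assumes p: "1 < p" "p < real DIM('a::euclidean_space) / 2" and e: "0 < \<epsilon>" and n: "3 \<le> DIM('a)"
  shows "integrable lborel (\<lambda>z::'a. newton_kernel \<epsilon> z powr (p / (p - 1)))"
proof -
  let ?n = "real DIM('a)" and ?q = "p / (p - 1)"
  have q: "?n < (?n - 2) * ?q"
  proof -
    have "?n * (p - 1) < (?n - 2) * p" using p by (simp add: algebra_simps)
    then show ?thesis using p by (simp add: field_simps)
  qed
  have q0: "0 < ?q" using p by simp
  let ?g = "\<lambda>z::'a. indicator (cball 0 1) z * newton_kernel \<epsilon> (0::'a) powr ?q + indicator (- cball 0 1) z * norm z powr (- ((?n - 2) * ?q))"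
  have "integrable lborel ?g"
    using q by (intro Bochner_Integration.integrable_add integrable_norm_powr_compl_cball)
       (auto simp: emeasure_lborel_cball_finite[unfolded infinity_ennreal_def])
  then show ?thesis
  proof (rule Bochner_Integration.integrable_bound)
    show "AE z in lborel. norm (newton_kernel \<epsilon> z powr ?q) \<le> norm (?g z)"
    proof (rule AE_I2)
      fix z :: 'a
      show "norm (newton_kernel \<epsilon> z powr ?q) \<le> norm (?g z)"
      proof (cases "norm z \<le> 1")
        case True
        have "newton_kernel \<epsilon> z \<le> newton_kernel \<epsilon> (0::'a)"
          using e n unfolding newton_kernel_def by (intro powr_mono2') auto
        then have "newton_kernel \<epsilon> z powr ?q \<le> newton_kernel \<epsilon> (0::'a) powr ?q"
          using q0 by (intro powr_mono2) auto
        then show ?thesis using True by simp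
      next
        case False
        then have z: "z \<noteq> 0" by auto
        have "newton_kernel \<epsilon> z powr ?q \<le> newton_kernel 0 z powr ?q"
          using newton_kernel_le[OF z, of \<epsilon>] n q0 by (intro powr_mono2) auto
        also have "\<dots> = norm z powr (- ((?n - 2) * ?q))"
          by (simp add: newton_kernel_0 powr_powr algebra_simps)
        finally show ?thesis using False by simp
      qed
    qed
  qed measurable
qed

text \<open>Hoelder's inequality between the source in L^p and the kernel in the dual space;
  reflection invariance makes the bound uniform in x.\<close>

lemma regular_convol_bound:
  assumes p: "1 < p" "p < real DIM('a::euclidean_space) / 2" and e: "0 < \<epsilon>" and n: "3 \<le> DIM('a)"
  obtains C where "0 < C"
    "\<And>w x::'a. unit_source p w \<Longrightarrow> convol (newton_kernel \<epsilon>) (\<lambda>y. \<bar>w y\<bar>) x \<le> C"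
proof -
  let ?q = "p / (p - 1)"
  note i = newton_kernel_dual_integrable[OF p e n]
  define C where "C = (\<integral>(z::'a). newton_kernel \<epsilon> z powr ?q \<partial>lborel) powr (1 - 1 / p)"
  have bd: "convol (newton_kernel \<epsilon>) (\<lambda>y. \<bar>w y\<bar>) x \<le> C" if w: "unit_source p w" for w :: "'a \<Rightarrow> real" and x
  proof -
    have ws: "bounded_supp w" using w by (simp add: unit_source_def)
    have iw: "integrable lborel (\<lambda>y. \<bar>w y\<bar> powr p)"
      using bounded_supp_powr_integrable[OF ws] p by simp
    have p1: "0 < 1 / p" "0 < 1 - 1 / p" "1 / p + (1 - 1 / p) = 1" using p by auto
    have e1: "(\<bar>w y\<bar> powr p) powr (1 / p) = \<bar>w y\<bar>" for y using p by (simp add: powr_powr)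
    have e2: "(newton_kernel \<epsilon> z powr ?q) powr (1 - 1 / p) = newton_kernel \<epsilon> z" for z :: 'a
    proof -
      have "?q * (1 - 1 / p) = 1" using p by (simp add: field_simps)
      then show ?thesis by (simp only: powr_powr) simp
    qed
    note H = Holder_inequality[OF p1 iw _ integrable_reflect(1)[OF i, of x]]
    have "convol (newton_kernel \<epsilon>) (\<lambda>y. \<bar>w y\<bar>) x
       \<le> (\<integral>y. \<bar>w y\<bar> powr p \<partial>lborel) powr (1 / p) * C"
      using H(2) unfolding e1 e2 C_def convol_def integrable_reflect(2)[OF i]
      by (simp add: mult.commute)
    also have "\<dots> \<le> 1 powr (1 / p) * C"
      using w p by (intro mult_right_mono powr_mono2) (auto simp: unit_source_def C_def)
    finally show ?thesis by simp
  qed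
  have "0 \<le> C" by (simp add: C_def)
  show thesis
  \<comment> \<open>The added 1 makes the constant positive, as it will be divided by.\<close>
  proof (rule that[of "C + 1"])
    show "0 < C + 1" using \<open>0 \<le> C\<close> by simp
    show "convol (newton_kernel \<epsilon>) (\<lambda>y. \<bar>w y\<bar>) x \<le> C + 1" if "unit_source p w" for w :: "'a \<Rightarrow> real" and x
      using bd[OF that, of x] by linarith
  qed
qed

text \<open>A modulus relative to the kernel survives integration against any source, where an
  absolute one would need a bound on the source in L^1. With Q = |z|^2 + \<epsilon>^2 and \<tau> =
  |h|/\<epsilon>, a shift changes Q by at most 2 \<tau> Q, since 2 |z| \<epsilon> \<le> Q and
  \<epsilon>^2 \<le> Q; continuity of the power at 1 does the rest.\<close>

lemma newton_kernel_relative_modulus: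
  assumes e: "0 < \<epsilon>" and \<eta>: "0 < \<eta>"
  obtains d where "0 < d" "\<And>h z::'a::euclidean_space. norm h < d \<Longrightarrow>
     \<bar>newton_kernel \<epsilon> (z + h) - newton_kernel \<epsilon> z\<bar> \<le> \<eta> * newton_kernel \<epsilon> z"
proof -
  let ?m = "- (real DIM('a) - 2) / 2"
  have "isCont (\<lambda>t::real. t powr ?m) 1" by (intro continuous_intros) auto
  then obtain \<delta> where \<delta>: "0 < \<delta>" "\<And>t::real. \<bar>t - 1\<bar> < \<delta> \<Longrightarrow> \<bar>t powr ?m - 1\<bar> < \<eta>"
    using \<eta> by (auto simp: continuous_at_eps_delta dist_real_def)
  \<comment> \<open>The 1 ensures \<tau> \<le> 1, used for the quadratic term; the other bound
    ensures 2 \<tau> < \<delta>.\<close>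
  define d where "d = \<epsilon> * min 1 (\<delta> / 3)"
  show thesis
  proof (rule that[of d])
    show "0 < d" using e \<delta> by (simp add: d_def)
    fix h z :: 'a assume h: "norm h < d"
    define Q where "Q = (norm z)\<^sup>2 + \<epsilon>\<^sup>2"
    define Q' where "Q' = (norm (z + h))\<^sup>2 + \<epsilon>\<^sup>2"
    define \<tau> where "\<tau> = norm h / \<epsilon>"
    have h1: "norm h < \<epsilon> * 1"
      by (rule less_le_trans[OF h]) (unfold d_def, rule mult_left_mono, use e in auto)
    have h2: "norm h < \<epsilon> * (\<delta> / 3)"
      by (rule less_le_trans[OF h]) (unfold d_def, rule mult_left_mono, use e in auto)
    have \<tau>: "0 \<le> \<tau>" "\<tau> \<le> 1" "3 * \<tau> < \<delta>" "norm h = \<tau> * \<epsilon>"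
      using h1 h2 e by (auto simp: \<tau>_def field_simps)
    have Q: "0 < Q" "0 \<le> Q'" using e by (auto simp: Q_def Q'_def add_nonneg_pos)
    have "\<bar>Q' - Q\<bar> = \<bar>2 * (z \<bullet> h) + (norm h)\<^sup>2\<bar>"
      by (simp add: Q_def Q'_def power2_norm_eq_inner inner_add_left inner_add_right inner_commute)
    also have "\<dots> \<le> 2 * (norm z * norm h) + (norm h)\<^sup>2"
      using Cauchy_Schwarz_ineq2[of z h] by (simp add: abs_le_iff) (smt (verit) zero_le_power2)
    also have "\<dots> = \<tau> * (2 * norm z * \<epsilon>) + \<tau> * (\<tau> * \<epsilon>\<^sup>2)"
      by (simp add: \<tau>(4) power2_eq_square algebra_simps)
    also have "\<dots> \<le> \<tau> * Q + \<tau> * Q"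
    proof (intro add_mono mult_left_mono)
      have "0 \<le> (norm z - \<epsilon>)\<^sup>2" by simp
      then show "2 * norm z * \<epsilon> \<le> Q" unfolding Q_def by (simp add: power2_diff)
      have "\<tau> * \<epsilon>\<^sup>2 \<le> 1 * \<epsilon>\<^sup>2" using \<tau> by (intro mult_right_mono) auto
      also have "\<dots> \<le> Q" by (simp add: Q_def)
      finally show "\<tau> * \<epsilon>\<^sup>2 \<le> Q" .
    qed (use \<tau> in auto)
    also have "\<dots> = 2 * \<tau> * Q" by simp
    finally have "\<bar>Q' - Q\<bar> \<le> 2 * \<tau> * Q" .
    moreover have "Q' / Q - 1 = (Q' - Q) / Q"
      using Q by (simp add: diff_divide_distrib)
    then have "\<bar>Q' / Q - 1\<bar> = \<bar>Q' - Q\<bar> / Q" using Q by simp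
    ultimately have "\<bar>Q' / Q - 1\<bar> \<le> 2 * \<tau>"
      using Q by (simp add: pos_divide_le_eq)
    also have "\<dots> < \<delta>" using \<tau> by linarith
    finally have "\<bar>(Q' / Q) powr ?m - 1\<bar> < \<eta>" by (rule \<delta>)
    moreover have "newton_kernel \<epsilon> (z + h) - newton_kernel \<epsilon> z = newton_kernel \<epsilon> z * ((Q' / Q) powr ?m - 1)"
    proof -
      have "Q' powr ?m = Q powr ?m * (Q' / Q) powr ?m"
        using Q by (subst powr_mult[symmetric]) auto
      moreover have "newton_kernel \<epsilon> (z + h) = Q' powr ?m" "newton_kernel \<epsilon> z = Q powr ?m"
        by (simp_all add: newton_kernel_def Q_def Q'_def)
      ultimately show ?thesis by (simp only: right_diff_distrib mult_1_right)
    qed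
    ultimately show "\<bar>newton_kernel \<epsilon> (z + h) - newton_kernel \<epsilon> z\<bar> \<le> \<eta> * newton_kernel \<epsilon> z"
      by (simp add: abs_mult mult.commute[of \<eta>] mult_left_mono)
  qed
qed

lemma abs_convol_le:
  assumes "\<And>z. 0 \<le> k z"
  shows "\<bar>convol k w x\<bar> \<le> convol k (\<lambda>y. \<bar>w y\<bar>) x"
  using integral_abs_bound[of lborel "\<lambda>y. k (x - y) * w y"] assms
  by (simp add: convol_def abs_mult)

text \<open>The relative modulus with \<eta> / C turns the difference into a multiple of the
  potential of |w|, which C bounds; hence one d serves all sources and all points.\<close>

lemma regular_convol_equicontinuous:
  assumes p: "1 < p" "p < real DIM('a::euclidean_space) / 2" and e: "0 < \<epsilon>" and n: "3 \<le> DIM('a)" and \<eta>: "0 < \<eta>"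
  obtains d where "0 < d" "\<And>w x h::'a. unit_source p w \<Longrightarrow> norm h < d \<Longrightarrow>
     \<bar>convol (newton_kernel \<epsilon>) w (x + h) - convol (newton_kernel \<epsilon>) w x\<bar> \<le> \<eta>"
proof -
  obtain C where C: "0 < C" "\<And>w x::'a. unit_source p w \<Longrightarrow> convol (newton_kernel \<epsilon>) (\<lambda>y. \<bar>w y\<bar>) x \<le> C"
    using regular_convol_bound[OF p e n] by blast
  obtain d where d: "0 < d" "\<And>h z::'a. norm h < d \<Longrightarrow>
     \<bar>newton_kernel \<epsilon> (z + h) - newton_kernel \<epsilon> z\<bar> \<le> \<eta> / C * newton_kernel \<epsilon> z"
    using newton_kernel_relative_modulus[OF e, of "\<eta> / C"] \<eta> C(1) by (metis divide_pos_pos)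
  show thesis
  proof (rule that[OF d(1)])
    fix w :: "'a \<Rightarrow> real" and x h :: 'a assume w: "unit_source p w" and h: "norm h < d"
    have ws: "bounded_supp w" using w by (simp add: unit_source_def)
    note i = newton_kernel_mult_integrable[OF n ws, of \<epsilon>]
    note ia = newton_kernel_mult_integrable[OF n bounded_supp_abs[OF ws], of \<epsilon>]
    have "\<bar>convol (newton_kernel \<epsilon>) w (x + h) - convol (newton_kernel \<epsilon>) w x\<bar>
       = \<bar>\<integral>y. newton_kernel \<epsilon> (x + h - y) * w y - newton_kernel \<epsilon> (x - y) * w y \<partial>lborel\<bar>"
      unfolding convol_def by (simp add: i)
    also have "\<dots> \<le> (\<integral>y. \<bar>newton_kernel \<epsilon> (x + h - y) * w y - newton_kernel \<epsilon> (x - y) * w y\<bar> \<partial>lborel)"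
      by (rule integral_abs_bound)
    also have "\<dots> \<le> (\<integral>y. \<eta> / C * (newton_kernel \<epsilon> (x - y) * \<bar>w y\<bar>) \<partial>lborel)"
    proof (rule integral_mono)
      fix y
      have "\<bar>newton_kernel \<epsilon> ((x - y) + h) - newton_kernel \<epsilon> (x - y)\<bar> * \<bar>w y\<bar> \<le> \<eta> / C * newton_kernel \<epsilon> (x - y) * \<bar>w y\<bar>"
        by (intro mult_right_mono d(2) h) auto
      then show "\<bar>newton_kernel \<epsilon> (x + h - y) * w y - newton_kernel \<epsilon> (x - y) * w y\<bar> \<le> \<eta> / C * (newton_kernel \<epsilon> (x - y) * \<bar>w y\<bar>)"
        by (simp add: abs_mult[symmetric] left_diff_distrib algebra_simps)
    qed (use i ia in auto)
    also have "\<dots> = \<eta> / C * convol (newton_kernel \<epsilon>) (\<lambda>y. \<bar>w y\<bar>) x" by (simp add: convol_def)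
    also have "\<dots> \<le> \<eta> / C * C" using C \<eta> w by (intro mult_left_mono) auto
    finally show "\<bar>convol (newton_kernel \<epsilon>) w (x + h) - convol (newton_kernel \<epsilon>) w x\<bar> \<le> \<eta>"
      using C(1) by simp
  qed
qed

text \<open>The Arzela-Ascoli argument in pointwise form: a single extraction over the countable set
  of pairs (dense point, m) serves all m at once, and equicontinuity spreads convergence from the
  dense set to every point.\<close>

lemma regular_convol_subsequence:
  fixes w :: "nat \<Rightarrow> 'a::euclidean_space \<Rightarrow> real"
  assumes p: "1 < p" "p < real DIM('a) / 2" and n: "3 \<le> DIM('a)" and w: "\<And>k. unit_source p (w k)"
  shows "\<exists>r :: nat \<Rightarrow> nat. strict_mono r \<and>
    (\<forall>m x. convergent (\<lambda>k. convol (newton_kernel (1 / real (Suc m))) (w (r k)) x))"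
proof -
  let ?K = "\<lambda>m::nat. newton_kernel (1 / real (Suc m)) :: 'a \<Rightarrow> real"
  have e: "0 < 1 / real (Suc m)" for m by simp
  have "\<exists>C. 0 < C \<and> (\<forall>w x::'a. unit_source p w \<longrightarrow> convol (?K m) (\<lambda>y. \<bar>w y\<bar>) x \<le> C)" for m
    by (rule regular_convol_bound[OF p e n, of m]) blast
  then obtain C where C0: "\<And>m. 0 < C m"
    and C: "\<And>m w x. unit_source p w \<Longrightarrow> convol (?K m) (\<lambda>y. \<bar>w y\<bar>) (x::'a) \<le> C m"
    by metis
  obtain D :: "'a set" where D: "countable D" "\<And>X. open X \<Longrightarrow> X \<noteq> {} \<Longrightarrow> \<exists>d\<in>D. d \<in> X"
    using countable_dense_setE by blast
  \<comment> \<open>Division by \<open>C m\<close> gives a bound independent of m, as the extraction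
    over all pairs requires.\<close>
  define f where "f k = (\<lambda>(x, m). convol (?K m) (w k) x / C m)" for k
  have fb: "norm (f k z) \<le> 1" if "z \<in> D \<times> UNIV" for k z
  proof -
    obtain x m where z: "z = (x, m)" by (cases z)
    have "\<bar>convol (?K m) (w k) x\<bar> \<le> C m"
      by (rule order_trans[OF abs_convol_le C[OF w]]) simp
    then show ?thesis using C0[of m] by (simp add: f_def z)
  qed
  have "countable (D \<times> (UNIV :: nat set))" using D by auto
  then obtain r where r: "strict_mono (r :: nat \<Rightarrow> nat)"
    and lim: "\<And>z. z \<in> D \<times> UNIV \<Longrightarrow> \<exists>l. (\<lambda>k. f (r k) z) \<longlonglongrightarrow> l"
    using function_convergent_subsequence[of "D \<times> UNIV" f 1] fb by blast
  show ?thesis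
  proof (intro exI conjI allI, rule r)
    fix m x
    let ?F = "\<lambda>k x. convol (?K m) (w (r k)) x"
    have "Cauchy (\<lambda>k. ?F k x)"
    \<comment> \<open>Two comparisons of x with a nearby dense point y and one use of convergence at
      y, each costing at most \<eta> / 4.\<close>
    proof (rule metric_CauchyI)
      fix \<eta> :: real assume \<eta>: "0 < \<eta>"
      obtain d where d: "0 < d" "\<And>w x h::'a. unit_source p w \<Longrightarrow> norm h < d \<Longrightarrow>
          \<bar>convol (?K m) w (x + h) - convol (?K m) w x\<bar> \<le> \<eta> / 4"
        using regular_convol_equicontinuous[OF p e n, of "\<eta> / 4" m] \<eta> by (metis zero_less_divide_iff zero_less_numeral)
      obtain y where y: "y \<in> D" "y \<in> ball x d"
        using D(2)[of "ball x d"] d(1) by auto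
      have near: "\<bar>?F k x - ?F k y\<bar> \<le> \<eta> / 4" for k
        using d(2)[OF w, of "x - y" "r k" y] y by (simp add: dist_norm)
      obtain l where "(\<lambda>k. f (r k) (y, m)) \<longlonglongrightarrow> l" using lim[of "(y, m)"] y by auto
      then have "(\<lambda>k. C m * f (r k) (y, m)) \<longlonglongrightarrow> C m * l" by (rule tendsto_mult_left)
      then have "Cauchy (\<lambda>k. ?F k y)"
        using C0[of m] by (intro LIMSEQ_imp_Cauchy[of _ "C m * l"]) (simp add: f_def)
      then obtain N where N: "\<And>k l. N \<le> k \<Longrightarrow> N \<le> l \<Longrightarrow> dist (?F k y) (?F l y) < \<eta> / 4"
        using \<eta> unfolding Cauchy_def by (metis zero_less_divide_iff zero_less_numeral)
      have "dist (?F k x) (?F l x) < \<eta>" if "N \<le> k" "N \<le> l" for k l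
        using N[OF that] near[of k] near[of l] \<eta> unfolding dist_real_def by linarith
      then show "\<exists>N. \<forall>k\<ge>N. \<forall>l\<ge>N. dist (?F k x) (?F l x) < \<eta>" by blast
    qed
    then show "convergent (\<lambda>k. ?F k x)" by (rule Cauchy_convergent)
  qed
qed

section \<open>From pointwise convergence to Cauchy sequences in the weighted space\<close>

text \<open>Lets bounds for unit sources act on differences. The weak triangle inequality gives the
  factor (2/4)^q, at most 1/2 as q > 1, which then averages the two integrals.\<close>

lemma unit_source_diff:
  fixes v w :: "'a::euclidean_space \<Rightarrow> real"
  assumes v: "unit_source p v" and w: "unit_source p w" and p: "1 < p" "p < real DIM('a) / 2"
  shows "unit_source p (\<lambda>x. (v x - w x) / 4)"
proof -
  have vs: "bounded_supp v" and ws: "bounded_supp w" using v w by (auto simp: unit_source_def)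
  have *: "(\<integral>x. \<bar>(v x - w x) / 4\<bar> powr q \<partial>lborel) \<le> 1"
    if q: "1 < q" and "(\<integral>x. \<bar>v x\<bar> powr q \<partial>lborel) \<le> 1" "(\<integral>x. \<bar>w x\<bar> powr q \<partial>lborel) \<le> 1" for q
  proof -
    have i: "integrable lborel (\<lambda>x. \<bar>v x\<bar> powr q)" "integrable lborel (\<lambda>x. \<bar>w x\<bar> powr q)"
      using q by (auto intro!: bounded_supp_powr_integrable vs ws)
    have "(\<integral>x. \<bar>(v x - w x) / 4\<bar> powr q \<partial>lborel) \<le> (\<integral>x. (\<bar>v x\<bar> powr q + \<bar>w x\<bar> powr q) / 2 \<partial>lborel)"
    proof (rule integral_mono)
      have "bounded_supp (\<lambda>x. 1 / 4 * (v x - w x))"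
        by (intro bounded_supp_cmult bounded_supp_diff vs ws)
      from bounded_supp_powr_integrable[OF this, of q]
      show "integrable lborel (\<lambda>x. \<bar>(v x - w x) / 4\<bar> powr q)" using q by simp
      show "integrable lborel (\<lambda>x. (\<bar>v x\<bar> powr q + \<bar>w x\<bar> powr q) / 2)" using i by simp
      fix x
      have "\<bar>(v x - w x) / 4\<bar> powr q \<le> (1 / 4 * (\<bar>v x\<bar> + \<bar>w x\<bar>)) powr q"
        using q by (intro powr_mono2) auto
      also have "\<dots> = (1 / 4) powr q * (\<bar>v x\<bar> + \<bar>w x\<bar>) powr q" by (subst powr_mult) auto
      also have "\<dots> \<le> (1 / 4) powr q * (2 powr q * (\<bar>v x\<bar> powr q + \<bar>w x\<bar> powr q))"
        using q by (intro mult_left_mono powr_add_le) auto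
      also have "\<dots> = (1 / 2) powr q * (\<bar>v x\<bar> powr q + \<bar>w x\<bar> powr q)"
        by (simp add: powr_mult[symmetric] mult.assoc[symmetric])
      also have "\<dots> \<le> (1 / 2) powr 1 * (\<bar>v x\<bar> powr q + \<bar>w x\<bar> powr q)"
        using q by (intro mult_right_mono powr_mono') auto
      finally show "\<bar>(v x - w x) / 4\<bar> powr q \<le> (\<bar>v x\<bar> powr q + \<bar>w x\<bar> powr q) / 2" by simp
    qed
    also have "\<dots> \<le> 1" using that i by simp
    finally show ?thesis .
  qed
  have "bounded_supp (\<lambda>x. 1 / 4 * (v x - w x))"
    by (intro bounded_supp_cmult bounded_supp_diff vs ws)
  then show ?thesis
    using *[of p] *[of "real DIM('a) / 2"] v w p by (auto simp: unit_source_def)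
qed

lemma convol_newton_diff:
  assumes n: "3 \<le> DIM('a::euclidean_space)" and v: "bounded_supp v" and w: "bounded_supp w"
  shows "convol (newton_kernel \<epsilon>) (\<lambda>y. c * (v y - w y)) (x::'a)
     = c * (convol (newton_kernel \<epsilon>) v x - convol (newton_kernel \<epsilon>) w x)"
proof -
  have "(\<lambda>y. newton_kernel \<epsilon> (x - y) * (c * (v y - w y)))
    = (\<lambda>y. c * (newton_kernel \<epsilon> (x - y) * v y - newton_kernel \<epsilon> (x - y) * w y))"
    by (auto simp: algebra_simps)
  then show ?thesis
    using newton_kernel_mult_integrable[OF n v, of \<epsilon> x] newton_kernel_mult_integrable[OF n w, of \<epsilon> x]
    by (simp add: convol_def)
qed

lemma convol_kernel_error:
  assumes n: "3 \<le> DIM('a::euclidean_space)" and w: "bounded_supp w"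
  shows "convol (newton_kernel 0) w (x::'a)
    = convol (kernel_error m) w x + convol (newton_kernel (1 / real (Suc m))) w x"
proof -
  note [measurable] = bounded_suppD[OF w]
  have [measurable]: "kernel_error m \<in> borel_measurable (borel :: 'a measure)"
    using dominated_kernel_error[where 'a='a, of m] n by (simp add: dominated_kernel_def)
  have "convol (kernel_error m) w x
    = (\<integral>y. newton_kernel 0 (x - y) * w y - newton_kernel (1 / real (Suc m)) (x - y) * w y \<partial>lborel)"
    unfolding convol_def
  proof (rule integral_cong_AE)
    \<comment> \<open>At y = x the two sides can differ, because \<open>kernel_error\<close> is set
      to 0 at the origin.\<close>
    show "AE y in lborel. kernel_error m (x - y) * w y
        = newton_kernel 0 (x - y) * w y - newton_kernel (1 / real (Suc m)) (x - y) * w y"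
      using AE_neq[of x] by eventually_elim (simp add: kernel_error_def algebra_simps)
  qed measurable
  then show ?thesis
    by (simp add: convol_def newton_kernel_mult_integrable[OF n w])
qed

lemma integrable_norm_powr_ball:
  assumes "0 < c" "c < real DIM('a::euclidean_space)"
  shows "integrable lborel (\<lambda>x::'a. indicator (cball 0 R) x * norm x powr (-c))"
proof -
  have "integrable lborel (\<lambda>x::'a. indicator (cball 0 1) x * norm x powr (-c) + indicator (cball 0 R) x)"
    using assms by (intro Bochner_Integration.integrable_add integrable_norm_powr_cball)
       (auto simp: emeasure_lborel_cball_finite[unfolded infinity_ennreal_def])
  then show ?thesis
  proof (rule Bochner_Integration.integrable_bound)
    show "AE x in lborel. norm (indicator (cball 0 R) (x::'a) * norm x powr (-c))
       \<le> norm (indicator (cball 0 1) x * norm x powr (-c) + indicator (cball 0 R) x)"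
    proof (rule AE_I2)
      fix x :: 'a
      show "norm (indicator (cball 0 R) x * norm x powr (-c))
       \<le> norm (indicator (cball 0 1) x * norm x powr (-c) + indicator (cball 0 R) x)"
      proof (cases "norm x \<le> 1")
        case False
        have "norm x powr (-c) \<le> norm x powr 0" using False assms by (intro powr_mono) auto
        then show ?thesis using False by (auto simp: indicator_def split: if_splits)
      qed (auto simp: indicator_def)
    qed
  qed (auto intro!: borel_measurable_times borel_measurable_indicator)
qed

text \<open>Three errors of size e/3, controlled in this order: R for the tail, then m for the
  kernel error, then N for the regularised potentials on the ball of radius R. The first two bounds
  are uniform over all pairs of sources, so one subsequence works for every e.\<close>

lemma weighted_potential_Cauchy_subsequence:
  fixes w :: "nat \<Rightarrow> 'a::euclidean_space \<Rightarrow> real" and \<gamma> \<rho> :: real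
  assumes n: "3 \<le> DIM('a)" and p: "1 < p" "p < real DIM('a) / 2"
    and \<gamma>: "0 < \<gamma>" "\<gamma> < real DIM('a)" and \<rho>: "p_star DIM('a) p \<le> \<rho>" "0 < \<rho>"
    and w: "\<And>k. unit_source p (w k)"
  shows "\<exists>r :: nat \<Rightarrow> nat. strict_mono r \<and> (\<forall>e>0. \<exists>N. \<forall>k\<ge>N. \<forall>l\<ge>N.
      (\<integral>\<^sup>+x. ennreal (\<bar>convol (newton_kernel 0) (w (r k)) x - convol (newton_kernel 0) (w (r l)) x\<bar> powr \<rho>
         * norm x powr (-\<gamma>)) \<partial>lborel) \<le> ennreal e)"
proof -
  define I :: "real \<Rightarrow> (('a \<Rightarrow> real) \<Rightarrow> real) \<Rightarrow> bool" where
    "I g J \<longleftrightarrow> (\<forall>k. 0 \<le> J k) \<and> (\<lambda>m. J (kernel_error m)) \<longlonglongrightarrow> 0 \<and>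
    (\<forall>k w. dominated_kernel k \<longrightarrow> unit_source p w \<longrightarrow>
       (\<integral>\<^sup>+x. ennreal (convol k (\<lambda>y. \<bar>w y\<bar>) x powr \<rho> * norm x powr (-g)) \<partial>lborel) \<le> ennreal (J k))" for g J
  have \<gamma>2: "0 < \<gamma> / 2" "\<gamma> / 2 < real DIM('a)" using \<gamma> by auto
  obtain J where "I \<gamma> J"
    using convol_weighted_bound[OF n p \<gamma> \<rho>(1), folded I_def] by (rule exE)
  then have J: "0 \<le> J k" "(\<lambda>m. J (kernel_error m)) \<longlonglongrightarrow> 0"
    "dominated_kernel k \<Longrightarrow> unit_source p w \<Longrightarrow>
       (\<integral>\<^sup>+x. ennreal (convol k (\<lambda>y. \<bar>w y\<bar>) x powr \<rho> * norm x powr (-\<gamma>)) \<partial>lborel) \<le> ennreal (J k)" for k w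
    by (auto simp: I_def)
  obtain J' where "I (\<gamma> / 2) J'"
    using convol_weighted_bound[OF n p \<gamma>2 \<rho>(1), folded I_def] by (rule exE)
  then have J': "0 \<le> J' k"
    "dominated_kernel k \<Longrightarrow> unit_source p w \<Longrightarrow>
       (\<integral>\<^sup>+x. ennreal (convol k (\<lambda>y. \<bar>w y\<bar>) x powr \<rho> * norm x powr (-(\<gamma> / 2))) \<partial>lborel) \<le> ennreal (J' k)" for k w
    by (auto simp: I_def)
  obtain r :: "nat \<Rightarrow> nat" where r': "strict_mono r \<and>
    (\<forall>m x. convergent (\<lambda>k. convol (newton_kernel (1 / real (Suc m))) (w (r k)) x))"
    using regular_convol_subsequence[OF p n w] by (rule exE)
  then have r: "strict_mono r"
    and lim: "\<And>m x. convergent (\<lambda>k. convol (newton_kernel (1 / real (Suc m))) (w (r k)) x)"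
    by (rule conjunct1, simp only:)
  let ?K = "newton_kernel 0 :: 'a \<Rightarrow> real"
  have ws: "bounded_supp (w k)" for k using w by (simp add: unit_source_def)
  show ?thesis
  proof (rule exI[of _ r], intro conjI allI impI, rule r)
    fix e :: real assume e: "0 < e"
    \<comment> \<open>Beyond R half of the weight is at most R^(-\<gamma>/2), and the other half is
      still admissible, with bound \<open>J'\<close>. The factor \<open>4 powr \<rho>\<close> undoes
      the division by 4 in \<open>v\<close> below.\<close>
    have "((\<lambda>R. R powr (-(\<gamma>/2)) * (4 powr \<rho> * J' ?K)) \<longlongrightarrow> 0 * (4 powr \<rho> * J' ?K)) at_top"
      using \<gamma> by (intro tendsto_mult tendsto_const tendsto_neg_powr filterlim_ident) auto
    then have "eventually (\<lambda>R. R powr (-(\<gamma>/2)) * (4 powr \<rho> * J' ?K) < e / 3) at_top"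
      using e by (elim order_tendstoD(2)) simp
    then have "eventually (\<lambda>R. 1 \<le> R \<and> R powr (-(\<gamma>/2)) * (4 powr \<rho> * J' ?K) < e / 3) at_top"
      by (intro eventually_conj eventually_ge_at_top)
    then obtain R :: real where R: "1 \<le> R" "R powr (-(\<gamma>/2)) * (4 powr \<rho> * J' ?K) < e / 3"
      using eventually_happens' trivial_limit_at_top_linorder by blast
    \<comment> \<open>Here 8 is 2 * 4: one weak triangle inequality and the scaling by 4.\<close>
    have "(\<lambda>m. 8 powr \<rho> * J (kernel_error m)) \<longlonglongrightarrow> 8 powr \<rho> * 0"
      by (intro tendsto_mult tendsto_const J(2))
    then have "eventually (\<lambda>m. 8 powr \<rho> * J (kernel_error m) < e / 3) sequentially"
      using e by (elim order_tendstoD(2)) simp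
    then obtain m where m: "8 powr \<rho> * J (kernel_error m) < e / 3"
      using eventually_happens' sequentially_bot by blast
    let ?Km = "newton_kernel (1 / real (Suc m)) :: 'a \<Rightarrow> real" and ?D = "kernel_error m :: 'a \<Rightarrow> real"
    have D: "dominated_kernel ?D" using n by (intro dominated_kernel_error) simp
    define F where "F k x = convol ?Km (w (r k)) x" for k x
    define G where "G x = lim (\<lambda>k. F k x)" for x
    have FG: "(\<lambda>k. F k x) \<longlonglongrightarrow> G x" for x
      unfolding F_def G_def using lim[of m x] by (simp only: convergent_LIMSEQ_iff)
    have [measurable]: "w k \<in> borel_measurable borel" for k by (rule bounded_suppD[OF ws])
    have Fm[measurable]: "F k \<in> borel_measurable borel" for k unfolding F_def[abs_def] by measurable
    have Gm[measurable]: "G \<in> borel_measurable borel"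
      by (rule borel_measurable_LIMSEQ_metric[OF Fm FG])
    obtain C where C: "0 < C" "\<And>w x. unit_source p w \<Longrightarrow> convol ?Km (\<lambda>y. \<bar>w y\<bar>) x \<le> C"
      using regular_convol_bound[OF p, of "1 / real (Suc m)"] n by auto
    have Fb: "\<bar>F k x\<bar> \<le> C" for k x
      unfolding F_def by (rule order_trans[OF abs_convol_le C(2)[OF w]]) simp
    have Gb: "\<bar>G x\<bar> \<le> C" for x
      using tendsto_rabs[OF FG[of x]] Fb by (intro LIMSEQ_le_const2) auto
    \<comment> \<open>Convergence of F is only pointwise, but on a ball the weight is integrable and
      F, G are bounded by C, so the integrals of g tend to 0.\<close>
    define g where "g k x = indicator (cball 0 R) x * (\<bar>F k x - G x\<bar> powr \<rho> * norm x powr (-\<gamma>))" for k x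
    have [measurable]: "cball 0 R \<in> sets (borel :: 'a measure)" by simp
    have gm[measurable]: "g k \<in> borel_measurable borel" for k unfolding g_def[abs_def] by measurable
    have g0: "0 \<le> g k x" for k x by (simp add: g_def)
    have gb: "norm (g k x) \<le> (2 * C) powr \<rho> * (indicator (cball 0 R) x * norm x powr (-\<gamma>))" for k x
    proof -
      have "\<bar>F k x - G x\<bar> powr \<rho> \<le> (2 * C) powr \<rho>"
        using Fb[of k x] Gb[of x] \<rho>(2) by (intro powr_mono2) auto
      then show ?thesis by (auto simp: g_def indicator_def intro: mult_right_mono)
    qed
    have gdom: "integrable lborel (\<lambda>x::'a. (2 * C) powr \<rho> * (indicator (cball 0 R) x * norm x powr (-\<gamma>)))"
      using integrable_norm_powr_ball[OF \<gamma>] by simp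
    have gi: "integrable lborel (g k)" for k
      by (rule Bochner_Integration.integrable_bound[OF gdom]) (measurable, use order_trans[OF gb abs_ge_self] in simp)
    have "(\<lambda>k. \<integral>x. g k x \<partial>lborel) \<longlonglongrightarrow> (\<integral>(x::'a). 0 \<partial>lborel)"
    proof (rule integral_dominated_convergence[OF _ _ gdom])
      show "AE x in lborel. (\<lambda>k. g k x) \<longlonglongrightarrow> 0"
      proof (rule AE_I2)
        fix x
        have "(\<lambda>k. \<bar>F k x - G x\<bar>) \<longlonglongrightarrow> 0"
          using tendsto_rabs[OF tendsto_diff[OF FG[of x] tendsto_const[of "G x"]]] by simp
        then have "(\<lambda>k. \<bar>F k x - G x\<bar> powr \<rho>) \<longlonglongrightarrow> 0"
          using \<rho>(2) by (intro tendsto_zero_powrI[OF _ tendsto_const]) auto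
        then have "(\<lambda>k. indicator (cball 0 R) x * (\<bar>F k x - G x\<bar> powr \<rho> * norm x powr (-\<gamma>))) \<longlonglongrightarrow> indicator (cball 0 R) x * (0 * norm x powr (-\<gamma>))"
          by (intro tendsto_mult tendsto_const)
        then show "(\<lambda>k. g k x) \<longlonglongrightarrow> 0" by (simp add: g_def)
      qed
    qed (use gb gm in auto)
    then have "(\<lambda>k. 4 powr \<rho> * (\<integral>x. g k x \<partial>lborel)) \<longlonglongrightarrow> 4 powr \<rho> * 0" by (intro tendsto_mult tendsto_const) simp
    \<comment> \<open>Both indices k and l contribute, each half of a third; the 4 comes from two
      weak triangle inequalities.\<close>
    then have "eventually (\<lambda>k. 4 powr \<rho> * (\<integral>x. g k x \<partial>lborel) < e / 6) sequentially"
      using e by (elim order_tendstoD(2)) simp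
    then obtain N where N: "\<And>k. N \<le> k \<Longrightarrow> 4 powr \<rho> * (\<integral>x. g k x \<partial>lborel) < e / 6"
      by (auto simp: eventually_sequentially)
    have "(\<integral>\<^sup>+x. ennreal (\<bar>convol ?K (w (r k)) x - convol ?K (w (r l)) x\<bar> powr \<rho> * norm x powr (-\<gamma>)) \<partial>lborel) \<le> ennreal e"
      if "N \<le> k" "N \<le> l" for k l
    proof -
      \<comment> \<open>Scaled so that \<open>unit_source_diff\<close> makes it a unit source and
        both weighted bounds apply.\<close>
      define v where "v x = (w (r k) x - w (r l) x) / 4" for x
      have v: "unit_source p v" unfolding v_def by (rule unit_source_diff[OF w w p])
      have vs: "bounded_supp v" using v by (simp add: unit_source_def)
      have [measurable]: "(\<lambda>y. \<bar>v y\<bar>) \<in> borel_measurable borel" by (rule bounded_suppD[OF bounded_supp_abs[OF vs]])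
      have [measurable]: "?D \<in> borel_measurable borel" using D by (simp add: dominated_kernel_def)
      have cv: "convol (newton_kernel \<epsilon>) v x = 1 / 4 * (convol (newton_kernel \<epsilon>) (w (r k)) x - convol (newton_kernel \<epsilon>) (w (r l)) x)" for \<epsilon> x
        using convol_newton_diff[OF n ws ws, of \<epsilon> "1/4"] by (simp add: v_def[abs_def])
      define a where "a x = convol ?K (\<lambda>y. \<bar>v y\<bar>) x powr \<rho> * norm x powr (-(\<gamma>/2))" for x
      define b where "b x = convol ?D (\<lambda>y. \<bar>v y\<bar>) x powr \<rho> * norm x powr (-\<gamma>)" for x
      have [measurable]: "a \<in> borel_measurable borel" "b \<in> borel_measurable borel"
        unfolding a_def[abs_def] b_def[abs_def] by measurable
      have ab0: "0 \<le> a x" "0 \<le> b x" for x by (auto simp: a_def b_def)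
      let ?c1 = "R powr (-(\<gamma>/2)) * 4 powr \<rho>"
      have pt: "\<bar>convol ?K (w (r k)) x - convol ?K (w (r l)) x\<bar> powr \<rho> * norm x powr (-\<gamma>)
         \<le> ?c1 * a x + (8 powr \<rho> * b x + (4 powr \<rho> * g k x + 4 powr \<rho> * g l x))" for x
      proof -
        define d where "d = \<bar>convol ?K (w (r k)) x - convol ?K (w (r l)) x\<bar>"
        have d: "d = 4 * \<bar>convol ?K v x\<bar>" by (simp add: d_def cv abs_mult)
        have dK: "d powr \<rho> \<le> 4 powr \<rho> * convol ?K (\<lambda>y. \<bar>v y\<bar>) x powr \<rho>"
          unfolding d using abs_convol_le[of ?K v x] \<rho>(2)
          by (subst powr_mult[symmetric]) (auto intro!: powr_mono2)
        show ?thesis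
        proof (cases "norm x \<le> R")
          case False
          have "norm x powr (-\<gamma>) = norm x powr (-(\<gamma>/2)) * norm x powr (-(\<gamma>/2))"
            by (simp add: powr_add[symmetric])
          also have "\<dots> \<le> R powr (-(\<gamma>/2)) * norm x powr (-(\<gamma>/2))"
            using False R \<gamma> by (intro mult_right_mono powr_mono2') auto
          finally have "d powr \<rho> * norm x powr (-\<gamma>)
             \<le> (4 powr \<rho> * convol ?K (\<lambda>y. \<bar>v y\<bar>) x powr \<rho>) * (R powr (-(\<gamma>/2)) * norm x powr (-(\<gamma>/2)))"
            by (intro mult_mono dK) auto
          also have "\<dots> = ?c1 * a x" by (simp add: a_def mult_ac)
          finally show ?thesis using ab0[of x] g0[of k x] g0[of l x] by (simp add: d_def add_increasing2)
        next
          case True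
          have D0: "0 \<le> convol ?D (\<lambda>y. \<bar>v y\<bar>) x"
            unfolding convol_def using D by (auto simp: dominated_kernel_def intro!: integral_nonneg_AE)
          have ineq: "4 * \<bar>a + b\<bar> \<le> 4 * c + 4 * \<bar>b\<bar>" if "\<bar>a\<bar> \<le> c" for a b c :: real
          proof -
            have "\<bar>a + b\<bar> \<le> c + \<bar>b\<bar>" by (rule order_trans[OF abs_triangle_ineq add_right_mono[OF that]])
            from mult_left_mono[OF this, of 4] show ?thesis by (simp add: distrib_left)
          qed
          have "\<bar>convol ?D v x\<bar> \<le> convol ?D (\<lambda>y. \<bar>v y\<bar>) x"
            using D by (intro abs_convol_le) (simp add: dominated_kernel_def)
          then have "d \<le> 4 * convol ?D (\<lambda>y. \<bar>v y\<bar>) x + 4 * \<bar>convol ?Km v x\<bar>"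
            unfolding d convol_kernel_error[OF n vs, of x m] by (rule ineq)
          also have "4 * \<bar>convol ?Km v x\<bar> = \<bar>F k x - F l x\<bar>" by (simp add: cv F_def abs_mult)
          finally have "d powr \<rho> \<le> (4 * convol ?D (\<lambda>y. \<bar>v y\<bar>) x + \<bar>F k x - F l x\<bar>) powr \<rho>"
            using \<rho>(2) by (intro powr_mono2) (auto simp: d_def)
          also have "\<dots> \<le> 2 powr \<rho> * ((4 * convol ?D (\<lambda>y. \<bar>v y\<bar>) x) powr \<rho> + \<bar>F k x - F l x\<bar> powr \<rho>)"
            using D0 \<rho>(2) by (intro powr_add_le) auto
          also have "\<dots> = 8 powr \<rho> * convol ?D (\<lambda>y. \<bar>v y\<bar>) x powr \<rho> + 2 powr \<rho> * \<bar>F k x - F l x\<bar> powr \<rho>"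
            using D0 by (simp add: powr_mult[symmetric] distrib_left)
          also have "\<bar>F k x - F l x\<bar> powr \<rho> \<le> (\<bar>F k x - G x\<bar> + \<bar>F l x - G x\<bar>) powr \<rho>"
            using \<rho>(2) by (intro powr_mono2) auto
          also have "\<dots> \<le> 2 powr \<rho> * (\<bar>F k x - G x\<bar> powr \<rho> + \<bar>F l x - G x\<bar> powr \<rho>)"
            using \<rho>(2) by (intro powr_add_le) auto
          also have "2 powr \<rho> * (2 powr \<rho> * (\<bar>F k x - G x\<bar> powr \<rho> + \<bar>F l x - G x\<bar> powr \<rho>))
            = 4 powr \<rho> * \<bar>F k x - G x\<bar> powr \<rho> + 4 powr \<rho> * \<bar>F l x - G x\<bar> powr \<rho>"
            by (simp add: powr_mult[symmetric] mult.assoc[symmetric] distrib_left)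
          finally have "d powr \<rho> * norm x powr (-\<gamma>)
             \<le> (8 powr \<rho> * convol ?D (\<lambda>y. \<bar>v y\<bar>) x powr \<rho> + (4 powr \<rho> * \<bar>F k x - G x\<bar> powr \<rho> + 4 powr \<rho> * \<bar>F l x - G x\<bar> powr \<rho>)) * norm x powr (-\<gamma>)"
            by (intro mult_right_mono) auto
          also have "\<dots> = 8 powr \<rho> * b x + (4 powr \<rho> * g k x + 4 powr \<rho> * g l x)"
            using True by (simp add: b_def g_def algebra_simps)
          finally show ?thesis using ab0[of x] by (simp add: d_def add_increasing)
        qed
      qed
      have "(\<integral>\<^sup>+x. ennreal (\<bar>convol ?K (w (r k)) x - convol ?K (w (r l)) x\<bar> powr \<rho> * norm x powr (-\<gamma>)) \<partial>lborel)
         \<le> (\<integral>\<^sup>+x. ennreal ?c1 * ennreal (a x) + (ennreal (8 powr \<rho>) * ennreal (b x) + (ennreal (4 powr \<rho>) * ennreal (g k x) + ennreal (4 powr \<rho>) * ennreal (g l x))) \<partial>lborel)"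
        using ab0 g0 pt by (intro nn_integral_mono) (simp add: ennreal_plus[symmetric] ennreal_mult[symmetric] ennreal_leI del: ennreal_plus)
      also have "\<dots> = ennreal ?c1 * (\<integral>\<^sup>+x. ennreal (a x) \<partial>lborel) + (ennreal (8 powr \<rho>) * (\<integral>\<^sup>+x. ennreal (b x) \<partial>lborel)
          + (ennreal (4 powr \<rho>) * (\<integral>\<^sup>+x. ennreal (g k x) \<partial>lborel) + ennreal (4 powr \<rho>) * (\<integral>\<^sup>+x. ennreal (g l x) \<partial>lborel)))"
        by (simp add: nn_integral_add nn_integral_cmult)
      also have "\<dots> \<le> ennreal ?c1 * ennreal (J' ?K) + (ennreal (8 powr \<rho>) * ennreal (J ?D)
          + (ennreal (4 powr \<rho>) * ennreal (\<integral>x. g k x \<partial>lborel) + ennreal (4 powr \<rho>) * ennreal (\<integral>x. g l x \<partial>lborel)))"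
        using J'(2)[OF dominated_newton_kernel v] J(3)[OF D v] g0
        by (intro add_mono mult_left_mono) (auto simp: a_def b_def nn_integral_eq_integral[OF gi])
      also have "\<dots> = ennreal (?c1 * J' ?K + (8 powr \<rho> * J ?D + (4 powr \<rho> * (\<integral>x. g k x \<partial>lborel) + 4 powr \<rho> * (\<integral>x. g l x \<partial>lborel))))"
        using J J' g0 by (simp add: ennreal_plus[symmetric] ennreal_mult[symmetric] del: ennreal_plus)
      also have "\<dots> \<le> ennreal e"
        using R(2) m N[OF that(1)] N[OF that(2)] by (intro ennreal_leI) (simp add: mult.assoc)
      finally show ?thesis .
    qed
    then show "\<exists>N. \<forall>k\<ge>N. \<forall>l\<ge>N.
      (\<integral>\<^sup>+x. ennreal (\<bar>convol ?K (w (r k)) x - convol ?K (w (r l)) x\<bar> powr \<rho> * norm x powr (-\<gamma>)) \<partial>lborel) \<le> ennreal e" by blast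
  qed
qed

section \<open>Lebesgue spaces\<close>

lemma nn_Lp_imp_Lp:
  assumes s: "0 < s" and u[measurable]: "u \<in> borel_measurable M" and c: "0 \<le> c"
    and le: "(\<integral>\<^sup>+x. ennreal (\<bar>u x\<bar> powr s) \<partial>M) \<le> ennreal c"
  shows "u \<in> Lp_space s M" "Lp_norm s M u \<le> c powr (1 / s)"
proof -
  have i: "integrable M (\<lambda>x. \<bar>u x\<bar> powr s)"
  proof (rule integrableI_bounded)
    show "(\<integral>\<^sup>+x. ennreal (norm (\<bar>u x\<bar> powr s)) \<partial>M) < \<infinity>"
      using le_less_trans[OF le ennreal_less_top] by simp
  qed measurable
  then show "u \<in> Lp_space s M" using u by (simp add: Lp_space_def)
  have "ennreal (\<integral>x. \<bar>u x\<bar> powr s \<partial>M) \<le> ennreal c"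
    using le by (subst (asm) nn_integral_eq_integral[OF i]) auto
  then show "Lp_norm s M u \<le> c powr (1 / s)"
    using s c unfolding Lp_norm_def by (intro powr_mono2) auto
qed

lemma Lp_spaceD: "u \<in> Lp_space s M \<Longrightarrow> u \<in> borel_measurable M"
  by (simp add: Lp_space_def)

lemma Lp_space_nn_integral:
  assumes "u \<in> Lp_space s M"
  shows "(\<integral>\<^sup>+x. ennreal (\<bar>u x\<bar> powr s) \<partial>M) = ennreal (\<integral>x. \<bar>u x\<bar> powr s \<partial>M)"
  using assms by (intro nn_integral_eq_integral) (auto simp: Lp_space_def)

lemma nn_integral_powr_add_le:
  assumes [measurable]: "u \<in> borel_measurable M" "v \<in> borel_measurable M" and s: "0 < s"
  shows "(\<integral>\<^sup>+x. ennreal (\<bar>u x + v x\<bar> powr s) \<partial>M)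
     \<le> ennreal (2 powr s) * ((\<integral>\<^sup>+x. ennreal (\<bar>u x\<bar> powr s) \<partial>M) + (\<integral>\<^sup>+x. ennreal (\<bar>v x\<bar> powr s) \<partial>M))"
proof -
  have pt: "\<bar>u x + v x\<bar> powr s \<le> 2 powr s * (\<bar>u x\<bar> powr s + \<bar>v x\<bar> powr s)" for x
  proof -
    have "\<bar>u x + v x\<bar> powr s \<le> (\<bar>u x\<bar> + \<bar>v x\<bar>) powr s" using s by (intro powr_mono2) auto
    also have "\<dots> \<le> 2 powr s * (\<bar>u x\<bar> powr s + \<bar>v x\<bar> powr s)" using s by (intro powr_add_le) auto
    finally show ?thesis .
  qed
  have "(\<integral>\<^sup>+x. ennreal (\<bar>u x + v x\<bar> powr s) \<partial>M)
     \<le> (\<integral>\<^sup>+x. ennreal (2 powr s) * (ennreal (\<bar>u x\<bar> powr s) + ennreal (\<bar>v x\<bar> powr s)) \<partial>M)"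
    using pt by (intro nn_integral_mono)
      (simp add: ennreal_plus[symmetric] ennreal_mult[symmetric] ennreal_leI del: ennreal_plus)
  also have "\<dots> = ennreal (2 powr s) * ((\<integral>\<^sup>+x. ennreal (\<bar>u x\<bar> powr s) \<partial>M) + (\<integral>\<^sup>+x. ennreal (\<bar>v x\<bar> powr s) \<partial>M))"
    by (simp add: nn_integral_cmult nn_integral_add)
  finally show ?thesis .
qed

text \<open>The constant 4 has one factor 2 from \<open>powr_add_le\<close> and one from bounding
  the sum of the integrals by twice the larger, using 2 \<le> 2^s.\<close>

lemma Lp_add:
  assumes u: "u \<in> Lp_space s M" and v: "v \<in> Lp_space s M" and s: "1 \<le> s"
  shows "(\<lambda>x. u x + v x) \<in> Lp_space s M"
    and "Lp_norm s M (\<lambda>x. u x + v x) \<le> 4 * (Lp_norm s M u + Lp_norm s M v)"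
proof -
  note [measurable] = Lp_spaceD[OF u] Lp_spaceD[OF v]
  let ?U = "\<integral>x. \<bar>u x\<bar> powr s \<partial>M" and ?V = "\<integral>x. \<bar>v x\<bar> powr s \<partial>M"
  have s0: "0 < s" using s by simp
  have UV: "0 \<le> ?U" "0 \<le> ?V" by simp_all
  have "(\<integral>\<^sup>+x. ennreal (\<bar>u x + v x\<bar> powr s) \<partial>M) \<le> ennreal (2 powr s) * (ennreal ?U + ennreal ?V)"
    using nn_integral_powr_add_le[OF Lp_spaceD[OF u] Lp_spaceD[OF v] s0]
    by (simp only: Lp_space_nn_integral[OF u] Lp_space_nn_integral[OF v])
  also have "\<dots> = ennreal (2 powr s * (?U + ?V))"
    using UV by (simp add: ennreal_plus[symmetric] ennreal_mult[symmetric] del: ennreal_plus)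
  finally have le: "(\<integral>\<^sup>+x. ennreal (\<bar>u x + v x\<bar> powr s) \<partial>M) \<le> ennreal (2 powr s * (?U + ?V))" .
  have m: "(\<lambda>x. u x + v x) \<in> borel_measurable M" by measurable
  have c: "0 \<le> 2 powr s * (?U + ?V)" using UV by simp
  note N = nn_Lp_imp_Lp[OF s0 m c le]
  show "(\<lambda>x. u x + v x) \<in> Lp_space s M" by (rule N(1))
  let ?X = "max ?U ?V"
  have "Lp_norm s M (\<lambda>x. u x + v x) \<le> (2 powr s * (?U + ?V)) powr (1 / s)" by (rule N(2))
  also have "\<dots> \<le> (2 powr s * (2 powr s * ?X)) powr (1 / s)"
  proof (rule powr_mono2)
    have "?U + ?V \<le> 2 powr 1 * ?X" by simp
    also have "\<dots> \<le> 2 powr s * ?X" using s UV by (intro mult_right_mono powr_mono) (auto simp: le_max_iff_disj)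
    finally show "2 powr s * (?U + ?V) \<le> 2 powr s * (2 powr s * ?X)" by (intro mult_left_mono) auto
  qed (use s0 c in auto)
  also have "\<dots> = 4 * ?X powr (1 / s)"
    using s0 UV by (simp add: powr_mult powr_powr)
  also have "?X powr (1 / s) \<le> ?U powr (1 / s) + ?V powr (1 / s)"
    by (simp add: max_def)
  finally show "Lp_norm s M (\<lambda>x. u x + v x) \<le> 4 * (Lp_norm s M u + Lp_norm s M v)"
    by (simp add: Lp_norm_def)
qed

lemma Lp_uminus:
  "u \<in> Lp_space s M \<Longrightarrow> (\<lambda>x. - u x) \<in> Lp_space s M" "Lp_norm s M (\<lambda>x. - u x) = Lp_norm s M u"
  by (auto simp: Lp_space_def Lp_norm_def)

lemma Lp_diff:
  assumes "u \<in> Lp_space s M" and "v \<in> Lp_space s M" and s: "1 \<le> s"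
  shows "(\<lambda>x. u x - v x) \<in> Lp_space s M"
    and "Lp_norm s M (\<lambda>x. u x - v x) \<le> 4 * (Lp_norm s M u + Lp_norm s M v)"
  using Lp_add[OF assms(1) Lp_uminus(1)[OF assms(2)] s] by (simp_all add: Lp_uminus(2))

lemma Lp_norm_tendsto_0_AE_subsequence:
  assumes u: "\<And>k::nat. u k \<in> Lp_space s M" and s: "0 < s"
    and lim: "(\<lambda>k. Lp_norm s M (u k)) \<longlonglongrightarrow> 0"
  shows "\<exists>r :: nat \<Rightarrow> nat. strict_mono r \<and> (AE x in M. (\<lambda>k. u (r k) x) \<longlonglongrightarrow> 0)"
proof -
  have "(\<lambda>k. \<integral>x. norm (\<bar>u k x\<bar> powr s) \<partial>M) \<longlonglongrightarrow> 0"
  proof -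
    have "(\<lambda>k. Lp_norm s M (u k) powr s) \<longlonglongrightarrow> 0"
      using s by (intro tendsto_zero_powrI[OF lim tendsto_const]) (auto simp: Lp_norm_def)
    then show ?thesis using s by (simp add: Lp_norm_def powr_powr)
  qed
  then obtain r where r: "strict_mono r" "AE x in M. (\<lambda>k. \<bar>u (r k) x\<bar> powr s) \<longlonglongrightarrow> 0"
    using tendsto_L1_AE_subseq[of M "\<lambda>k x. \<bar>u k x\<bar> powr s"] u by (auto simp: Lp_space_def)
  have "AE x in M. (\<lambda>k. u (r k) x) \<longlonglongrightarrow> 0"
    using r(2)
  proof eventually_elim
    case (elim x)
    have "(\<lambda>k. (\<bar>u (r k) x\<bar> powr s) powr (1 / s)) \<longlonglongrightarrow> 0"
      using s by (intro tendsto_zero_powrI[OF elim tendsto_const]) auto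
    then have "(\<lambda>k. \<bar>u (r k) x\<bar>) \<longlonglongrightarrow> 0" using s by (simp add: powr_powr)
    then show ?case by (simp add: tendsto_rabs_zero_iff)
  qed
  with r show ?thesis by blast
qed

section \<open>Fatou's lemma and completeness\<close>

text \<open>The vehicle for all limit passages: bounds go from test functions to elements of the
  completion, and Cauchy estimates to the limit. A bound from index N on suffices for a limit
  inferior.\<close>

lemma nn_integral_powr_Fatou:
  assumes [measurable]: "\<And>k. f k \<in> borel_measurable M" "v \<in> borel_measurable M" and s: "0 < s"
    and lim: "AE x in M. (\<lambda>k. f k x) \<longlonglongrightarrow> v x"
    and le: "\<And>k::nat. N \<le> k \<Longrightarrow> (\<integral>\<^sup>+x. ennreal (\<bar>f k x\<bar> powr s) \<partial>M) \<le> c"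
  shows "(\<integral>\<^sup>+x. ennreal (\<bar>v x\<bar> powr s) \<partial>M) \<le> c"
proof -
  have "(\<integral>\<^sup>+x. ennreal (\<bar>v x\<bar> powr s) \<partial>M) = (\<integral>\<^sup>+x. liminf (\<lambda>k. ennreal (\<bar>f k x\<bar> powr s)) \<partial>M)"
  proof (rule nn_integral_cong_AE)
    show "AE x in M. ennreal (\<bar>v x\<bar> powr s) = liminf (\<lambda>k. ennreal (\<bar>f k x\<bar> powr s))"
      using lim
    proof eventually_elim
      case (elim x)
      have "(\<lambda>k. \<bar>f k x\<bar> powr s) \<longlonglongrightarrow> \<bar>v x\<bar> powr s"
        using s by (intro tendsto_powr' tendsto_rabs elim tendsto_const) auto
      then have "(\<lambda>k. ennreal (\<bar>f k x\<bar> powr s)) \<longlonglongrightarrow> ennreal (\<bar>v x\<bar> powr s)"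
        by (rule tendsto_ennrealI)
      then show ?case by (rule lim_imp_Liminf[OF sequentially_bot, symmetric])
    qed
  qed
  also have "\<dots> \<le> liminf (\<lambda>k. \<integral>\<^sup>+x. ennreal (\<bar>f k x\<bar> powr s) \<partial>M)"
    by (rule nn_integral_liminf) simp
  also have "\<dots> \<le> liminf (\<lambda>k::nat. c)"
    using le by (intro Liminf_mono) (auto simp: eventually_sequentially)
  also have "\<dots> = c" by (simp add: Liminf_const)
  finally show ?thesis .
qed

text \<open>Riesz-Fischer without a triangle inequality for norms: along a fast subsequence the
  increments are dominated pointwise by a geometric series, whatever the exponent s > 0.\<close>

lemma Lp_complete:
  fixes u :: "nat \<Rightarrow> 'a \<Rightarrow> real"
  assumes u[measurable]: "\<And>k. u k \<in> borel_measurable M" and s: "0 < s"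
    and C: "\<And>e. 0 < e \<Longrightarrow> \<exists>N. \<forall>k\<ge>N. \<forall>l\<ge>N. (\<integral>\<^sup>+x. ennreal (\<bar>u k x - u l x\<bar> powr s) \<partial>M) \<le> ennreal e"
  shows "\<exists>v \<in> borel_measurable M. \<forall>e>0. \<exists>N. \<forall>k\<ge>N. (\<integral>\<^sup>+x. ennreal (\<bar>u k x - v x\<bar> powr s) \<partial>M) \<le> ennreal e"
proof -
  \<comment> \<open>Chosen so that \<theta> j to the power 1/s is 2^(-j). The increments to the
    power s, divided by \<theta> j, still have summable integrals; hence they are bounded by some K
    almost everywhere, and the increments by K^(1/s) 2^(-j).\<close>
  define \<theta> where "\<theta> j = (1/2) powr (s * real j)" for j :: nat
  have \<theta>: "0 < \<theta> j" for j by (simp add: \<theta>_def)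
  have "\<exists>N. \<forall>k\<ge>N. \<forall>l\<ge>N. (\<integral>\<^sup>+x. ennreal (\<bar>u k x - u l x\<bar> powr s) \<partial>M) \<le> ennreal (\<theta> j * (1/2)^j)" for j
    using \<theta> by (intro C) simp
  then obtain N where N: "\<And>j k l. N j \<le> k \<Longrightarrow> N j \<le> l \<Longrightarrow>
      (\<integral>\<^sup>+x. ennreal (\<bar>u k x - u l x\<bar> powr s) \<partial>M) \<le> ennreal (\<theta> j * (1/2)^j)"
    by metis
  \<comment> \<open>Summing the thresholds makes q monotone and at least N j; the added j forces it
    to infinity.\<close>
  define q where "q j = (\<Sum>i\<le>j. N i) + j" for j
  have qN: "N j \<le> q j" for j
    unfolding q_def by (rule trans_le_add1) (rule member_le_sum, auto)
  have qS: "q j \<le> q (Suc j)" for j by (simp add: q_def)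
  have qj: "j \<le> q j" for j by (simp add: q_def)
  define g where "g j x = \<bar>u (q (Suc j)) x - u (q j) x\<bar> powr s / \<theta> j" for j x
  have gm[measurable]: "g j \<in> borel_measurable M" for j unfolding g_def[abs_def] by measurable
  have g0: "0 \<le> g j x" for j x using \<theta>[of j] by (simp add: g_def)
  have "(\<integral>\<^sup>+x. (\<Sum>j. ennreal (g j x)) \<partial>M) = (\<Sum>j. \<integral>\<^sup>+x. ennreal (g j x) \<partial>M)"
    by (rule nn_integral_suminf) measurable
  also have "\<dots> \<le> (\<Sum>j. ennreal ((1/2)^j))"
  proof (intro suminf_le summableI)
    fix j
    have "(\<integral>\<^sup>+x. ennreal (g j x) \<partial>M) = (\<integral>\<^sup>+x. ennreal (1 / \<theta> j) * ennreal (\<bar>u (q (Suc j)) x - u (q j) x\<bar> powr s) \<partial>M)"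
      using \<theta>[of j] by (simp add: g_def ennreal_mult[symmetric])
    also have "\<dots> = ennreal (1 / \<theta> j) * (\<integral>\<^sup>+x. ennreal (\<bar>u (q (Suc j)) x - u (q j) x\<bar> powr s) \<partial>M)"
      by (rule nn_integral_cmult) measurable
    also have "\<dots> \<le> ennreal (1 / \<theta> j) * ennreal (\<theta> j * (1/2)^j)"
      by (intro mult_left_mono N order_trans[OF qN qS] qN) auto
    also have "\<dots> = ennreal ((1/2)^j)" using \<theta>[of j] by (simp add: ennreal_mult[symmetric])
    finally show "(\<integral>\<^sup>+x. ennreal (g j x) \<partial>M) \<le> ennreal ((1/2)^j)" .
  qed
  also have "\<dots> < \<infinity>"
  proof -
    have "summable (\<lambda>j. (1/2::real)^j)" by (rule summable_geometric) simp
    then have "(\<Sum>j. ennreal ((1/2)^j)) \<noteq> top" by (rule ennreal_suminf_neq_top) simp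
    then show ?thesis unfolding infinity_ennreal_def by (rule top.not_eq_extremum[THEN iffD1])
  qed
  finally have "AE x in M. (\<Sum>j. ennreal (g j x)) \<noteq> \<infinity>"
    by (intro nn_integral_PInf_AE) auto
  then have conv: "AE x in M. convergent (\<lambda>j. u (q j) x)"
  proof eventually_elim
    case (elim x)
    then obtain K where K: "0 \<le> K" "(\<Sum>j. ennreal (g j x)) = ennreal K"
      by (cases "\<Sum>j. ennreal (g j x)") auto
    have gK: "g j x \<le> K" for j
    proof -
      have "(\<Sum>i\<in>{j}. ennreal (g i x)) \<le> (\<Sum>j. ennreal (g j x))" by (rule sum_le_suminf) auto
      then show ?thesis using K by simp
    qed
    have "\<bar>u (q (Suc j)) x - u (q j) x\<bar> powr s \<le> K * \<theta> j" for j
      using \<theta>[of j] gK[of j] by (simp add: g_def pos_divide_le_eq)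
    then have "(\<bar>u (q (Suc j)) x - u (q j) x\<bar> powr s) powr (1 / s) \<le> (K * \<theta> j) powr (1 / s)" for j
      using s by (intro powr_mono2) auto
    moreover have "(K * \<theta> j) powr (1 / s) = K powr (1 / s) * (1/2)^j" for j
      using s K by (simp add: powr_mult \<theta>_def powr_powr powr_realpow)
    ultimately have "norm (u (q (Suc j)) x - u (q j) x) \<le> K powr (1 / s) * (1/2)^j" for j
      using s by (simp add: powr_powr)
    then have "summable (\<lambda>j. u (q (Suc j)) x - u (q j) x)"
      by (intro summable_comparison_test'[OF summable_mult[OF summable_geometric]]) auto
    then have "convergent (\<lambda>m. \<Sum>j<m. u (q (Suc j)) x - u (q j) x)"
      by (simp add: summable_iff_convergent)
    moreover have "(\<Sum>j<m. u (q (Suc j)) x - u (q j) x) = u (q m) x - u (q 0) x" for m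
      by (rule sum_lessThan_telescope)
    ultimately have "convergent (\<lambda>m. (u (q m) x - u (q 0) x) + u (q 0) x)"
      by (intro convergent_add convergent_const) (simp only:)
    then show ?case by simp
  qed
  define v where "v x = lim (\<lambda>j. u (q j) x)" for x
  have vm[measurable]: "v \<in> borel_measurable M"
    unfolding v_def[abs_def] by (rule borel_measurable_lim_metric) measurable
  have lim: "AE x in M. (\<lambda>j. u (q j) x) \<longlonglongrightarrow> v x"
    using conv by eventually_elim (simp add: v_def convergent_LIMSEQ_iff)
  have "\<exists>N. \<forall>k\<ge>N. (\<integral>\<^sup>+x. ennreal (\<bar>u k x - v x\<bar> powr s) \<partial>M) \<le> ennreal e" if e: "0 < e" for e
  proof -
    obtain N where N: "\<And>k l. N \<le> k \<Longrightarrow> N \<le> l \<Longrightarrow> (\<integral>\<^sup>+x. ennreal (\<bar>u k x - u l x\<bar> powr s) \<partial>M) \<le> ennreal e"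
      using C[OF e] by blast
    have "(\<integral>\<^sup>+x. ennreal (\<bar>u k x - v x\<bar> powr s) \<partial>M) \<le> ennreal e" if k: "N \<le> k" for k
    proof (rule nn_integral_powr_Fatou[where f = "\<lambda>j x. u k x - u (q j) x" and N = N])
      show "AE x in M. (\<lambda>j. u k x - u (q j) x) \<longlonglongrightarrow> u k x - v x"
        using lim by eventually_elim (intro tendsto_diff tendsto_const)
      show "(\<integral>\<^sup>+x. ennreal (\<bar>u k x - u (q j) x\<bar> powr s) \<partial>M) \<le> ennreal e" if "N \<le> j" for j
        using N[OF k order_trans[OF that qj]] .
    qed (use s in measurable)
    then show ?thesis by blast
  qed
  with vm show ?thesis by blast
qed

section \<open>Transfer to the completed space\<close>

lemma nn_integral_power_weight:
  assumes [measurable]: "f \<in> borel_measurable borel" and f0: "\<And>x. 0 \<le> f x"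
  shows "(\<integral>\<^sup>+x. ennreal (f x) \<partial>power_weight \<gamma>)
    = (\<integral>\<^sup>+x. ennreal (f x * norm x powr (-\<gamma>)) \<partial>(lborel :: 'a::euclidean_space measure))"
proof -
  have w: "(\<lambda>x::'a. ennreal (norm x powr (- \<gamma>))) \<in> borel_measurable lebesgue"
    by (rule measurable_completion) measurable
  have f: "(\<lambda>x. ennreal (f x)) \<in> borel_measurable lebesgue"
    by (rule measurable_completion) measurable
  have "(\<integral>\<^sup>+x. ennreal (f x) \<partial>power_weight \<gamma>) = (\<integral>\<^sup>+x. ennreal (norm x powr (- \<gamma>)) * ennreal (f x) \<partial>lebesgue)"
    unfolding power_weight_def by (rule nn_integral_density[OF w f])
  also have "\<dots> = (\<integral>\<^sup>+x. ennreal (f x * norm x powr (-\<gamma>)) \<partial>lebesgue)"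
    using f0 by (simp add: ennreal_mult[symmetric] mult.commute)
  also have "\<dots> = (\<integral>\<^sup>+x. ennreal (f x * norm x powr (-\<gamma>)) \<partial>lborel)"
    by (rule nn_integral_completion)
  finally show ?thesis .
qed

lemma borel_measurable_power_weight:
  "borel_measurable (power_weight \<gamma>) = borel_measurable lebesgue"
  unfolding power_weight_def by (rule measurable_cong_sets) auto

text \<open>The weighted measure is absolutely continuous with respect to Lebesgue measure.\<close>

lemma AE_power_weight:
  assumes "AE x in lebesgue. P (x::'a::euclidean_space)" shows "AE x in power_weight \<gamma>. P x"
proof -
  have w: "(\<lambda>x::'a. ennreal (norm x powr (- \<gamma>))) \<in> borel_measurable lebesgue"
    by (rule measurable_completion) measurable
  show ?thesis unfolding power_weight_def by (subst AE_density[OF w]) (use assms in auto)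
qed

section \<open>Potentials paired with their sources\<close>

text \<open>Keeps of a test function and its Laplacian only the potential representation. The
  relation is closed under differences, so one bound covers both \<phi> and \<phi> k - \<phi>
  l.\<close>

definition newton_pair :: "real \<Rightarrow> ('a::euclidean_space \<Rightarrow> real) \<Rightarrow> ('a \<Rightarrow> real) \<Rightarrow> bool" where
  "newton_pair A \<phi> w \<longleftrightarrow> bounded_supp w \<and> \<phi> \<in> borel_measurable borel \<and>
     (\<forall>x. A * \<phi> x = - convol (newton_kernel 0) w x)"

lemma newton_pair_diff:
  fixes \<phi> :: "'a::euclidean_space \<Rightarrow> real"
  assumes n: "3 \<le> DIM('a)" and p: "newton_pair A \<phi> v" and q: "newton_pair A \<psi> w"
  shows "newton_pair A (\<lambda>x. \<phi> x - \<psi> x) (\<lambda>x. v x - w x)"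
proof -
  have "bounded_supp v" "bounded_supp w" using p q by (auto simp: newton_pair_def)
  from convol_newton_diff[OF n this, of 0 1] bounded_supp_diff[OF this] p q show ?thesis
    by (simp add: newton_pair_def right_diff_distrib borel_measurable_diff)
qed

lemma newton_pair_laplacian:
  assumes n: "3 \<le> DIM('a::euclidean_space)"
  shows "\<exists>A>0. \<forall>\<phi>::'a \<Rightarrow> real. \<phi> \<in> test_functions \<longrightarrow> newton_pair A \<phi> (laplacian \<phi>)"
proof -
  have "0 < real DIM('a) * (real DIM('a) - 2) * (\<integral>z. bump (z::'a) \<partial>lborel)"
    using integral_bump_pos[where 'a='a] n by simp
  then show ?thesis
    using test_function_representation(1)[OF n] test_function_laplacian(2)
      borel_measurable_continuous_onI[OF test_function_continuous]
    unfolding newton_pair_def convol_def by blast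
qed

text \<open>Equivalent to \<open>laplacian_norm\<close>, but additive in its two parts.\<close>

definition source_norm :: "real \<Rightarrow> ('a::euclidean_space \<Rightarrow> real) \<Rightarrow> real" where
  "source_norm p w = Lp_norm p lebesgue w + Lp_norm (real DIM('a) / 2) lebesgue w"

lemma Lp_norm_nonneg[simp]: "0 \<le> Lp_norm s M u"
  by (simp add: Lp_norm_def)

lemma source_norm_nonneg[simp]: "0 \<le> source_norm p w"
  by (simp add: source_norm_def)

text \<open>Each summand is at most the whole norm, as omitting the other power under the root only
  decreases it; hence the 2.\<close>

lemma source_norm_le:
  fixes w :: "'a::euclidean_space \<Rightarrow> real"
  shows "source_norm p w \<le> 2 * laplacian_norm p w"
proof -
  let ?m = "real DIM('a) / 2" and ?a = "Lp_norm (real DIM('a) / 2) lebesgue w" and ?b = "Lp_norm p lebesgue w"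
  have m: "0 < ?m" "2 / real DIM('a) = 1 / ?m" by auto
  have "t \<le> (?a powr ?m + ?b powr ?m) powr (1 / ?m)" if "t = ?a \<or> t = ?b" for t
  proof -
    have t0: "0 \<le> t" using that by auto
    have "t = (t powr ?m) powr (1 / ?m)" using t0 m by (simp add: powr_powr)
    also have "\<dots> \<le> (?a powr ?m + ?b powr ?m) powr (1 / ?m)"
      using that by (intro powr_mono2) auto
    finally show ?thesis .
  qed
  moreover have "laplacian_norm p w = (?a powr ?m + ?b powr ?m) powr (1 / ?m)"
    unfolding laplacian_norm_def Let_def m(2) ..
  ultimately have "?a \<le> laplacian_norm p w" "?b \<le> laplacian_norm p w" by metis+
  then show ?thesis unfolding source_norm_def by linarith
qed

lemma source_norm_add:
  fixes v w :: "'a::euclidean_space \<Rightarrow> real"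
  assumes v: "v \<in> Lp_space p lebesgue \<inter> Lp_space (real DIM('a) / 2) lebesgue"
    and w: "w \<in> Lp_space p lebesgue \<inter> Lp_space (real DIM('a) / 2) lebesgue"
    and p: "1 < p" "p < real DIM('a) / 2"
  shows "source_norm p (\<lambda>x. v x + w x) \<le> 4 * (source_norm p v + source_norm p w)"
    and "source_norm p (\<lambda>x. v x - w x) \<le> 4 * (source_norm p v + source_norm p w)"
proof -
  have p': "1 \<le> p" "1 \<le> real DIM('a) / 2" using p by auto
  have vw: "v \<in> Lp_space p lebesgue" "w \<in> Lp_space p lebesgue"
    "v \<in> Lp_space (real DIM('a) / 2) lebesgue" "w \<in> Lp_space (real DIM('a) / 2) lebesgue"
    using v w by simp_all
  show "source_norm p (\<lambda>x. v x + w x) \<le> 4 * (source_norm p v + source_norm p w)"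
    using Lp_add(2)[OF vw(1,2) p'(1)] Lp_add(2)[OF vw(3,4) p'(2)] unfolding source_norm_def by argo
  show "source_norm p (\<lambda>x. v x - w x) \<le> 4 * (source_norm p v + source_norm p w)"
    using Lp_diff(2)[OF vw(1,2) p'(1)] Lp_diff(2)[OF vw(3,4) p'(2)] unfolding source_norm_def by argo
qed

lemma bounded_supp_Lp_space:
  assumes w: "bounded_supp w" and q: "0 < q"
  shows "w \<in> Lp_space q lebesgue"
    and "Lp_norm q lebesgue w = (\<integral>x. \<bar>w x\<bar> powr q \<partial>lborel) powr (1 / q)"
proof -
  have [measurable]: "w \<in> borel_measurable borel" by (rule bounded_suppD[OF w])
  have i: "integrable lborel (\<lambda>x. \<bar>w x\<bar> powr q)" by (rule bounded_supp_powr_integrable[OF w q])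
  have "w \<in> borel_measurable lebesgue" by (rule measurable_completion) measurable
  moreover have "integrable lebesgue (\<lambda>x. \<bar>w x\<bar> powr q)"
    using i by (subst integrable_completion) auto
  ultimately show "w \<in> Lp_space q lebesgue" by (simp add: Lp_space_def)
  show "Lp_norm q lebesgue w = (\<integral>x. \<bar>w x\<bar> powr q \<partial>lborel) powr (1 / q)"
    unfolding Lp_norm_def by (subst integral_completion) auto
qed

text \<open>Division is by a number t strictly above the norm, because the norm itself may be
  0.\<close>

lemma unit_source_scale:
  fixes w :: "'a::euclidean_space \<Rightarrow> real"
  assumes w: "bounded_supp w" and p: "1 < p" "p < real DIM('a) / 2" and t: "source_norm p w < t"
  shows "unit_source p (\<lambda>x. w x / t)"
proof -
  have t0: "0 < t" using t source_norm_nonneg[of p w] by linarith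
  have *: "(\<integral>x. \<bar>w x / t\<bar> powr q \<partial>lborel) \<le> 1" if q: "0 < q" and le: "Lp_norm q lebesgue w \<le> t" for q
  proof -
    let ?I = "\<integral>x. \<bar>w x\<bar> powr q \<partial>lborel"
    have "?I = (?I powr (1 / q)) powr q" using q by (simp add: powr_powr)
    also have "\<dots> \<le> t powr q"
      using le q unfolding bounded_supp_Lp_space(2)[OF w q] by (intro powr_mono2) auto
    finally have "?I \<le> t powr q" .
    moreover have "(\<integral>x. \<bar>w x / t\<bar> powr q \<partial>lborel) = ?I / t powr q"
      using t0 by (simp add: powr_divide)
    ultimately show ?thesis using t0 by (simp add: pos_divide_le_eq)
  qed
  have "bounded_supp (\<lambda>x. 1 / t * w x)" by (rule bounded_supp_cmult[OF w])
  then have "bounded_supp (\<lambda>x. w x / t)" by simp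
  moreover have "Lp_norm p lebesgue w \<le> t" "Lp_norm (real DIM('a) / 2) lebesgue w \<le> t"
    using t Lp_norm_nonneg[of p lebesgue w] Lp_norm_nonneg[of "real DIM('a) / 2" lebesgue w]
    unfolding source_norm_def by linarith+
  ultimately show ?thesis using * p by (simp add: unit_source_def)
qed

lemma convol_scale: "convol k (\<lambda>y. w y / t) x = convol k w x / t"
  by (simp add: convol_def)

lemma newton_pair_bound:
  fixes p \<gamma> \<rho> :: real
  assumes n: "3 \<le> DIM('a::euclidean_space)" and p: "1 < p" "p < real DIM('a) / 2"
    and \<gamma>: "0 < \<gamma>" "\<gamma> < real DIM('a)" and \<rho>: "p_star DIM('a) p \<le> \<rho>" "0 < \<rho>" and A: "0 < A"
  shows "\<exists>C>0. \<forall>\<phi> w t. newton_pair A \<phi> w \<longrightarrow> source_norm p (w :: 'a \<Rightarrow> real) < t \<longrightarrow>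
     (\<integral>\<^sup>+x. ennreal (\<bar>\<phi> x\<bar> powr \<rho>) \<partial>power_weight \<gamma>) \<le> ennreal ((C * t) powr \<rho>)"
proof -
  obtain J :: "('a \<Rightarrow> real) \<Rightarrow> real" where J0: "(\<forall>k. 0 \<le> J k) \<and> (\<lambda>m. J (kernel_error m)) \<longlonglongrightarrow> 0 \<and>
    (\<forall>k w. dominated_kernel k \<longrightarrow> unit_source p w \<longrightarrow>
       (\<integral>\<^sup>+x. ennreal (convol k (\<lambda>y. \<bar>w y\<bar>) x powr \<rho> * norm x powr (-\<gamma>)) \<partial>lborel) \<le> ennreal (J k))"
    using convol_weighted_bound[OF n p \<gamma> \<rho>(1)] by (rule exE)
  let ?K = "newton_kernel 0 :: 'a \<Rightarrow> real"
  \<comment> \<open>The added 1 keeps the final constant C positive.\<close>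
  define j where "j = J ?K + 1"
  have j: "0 < j" using J0 by (simp add: j_def add_nonneg_pos)
  have J: "(\<integral>\<^sup>+x. ennreal (convol ?K (\<lambda>y. \<bar>w y\<bar>) x powr \<rho> * norm x powr (-\<gamma>)) \<partial>lborel) \<le> ennreal j"
    if "unit_source p w" for w
  proof -
    have "(\<integral>\<^sup>+x. ennreal (convol ?K (\<lambda>y. \<bar>w y\<bar>) x powr \<rho> * norm x powr (-\<gamma>)) \<partial>lborel) \<le> ennreal (J ?K)"
      using J0 that dominated_newton_kernel by blast
    also have "\<dots> \<le> ennreal j" by (rule ennreal_leI) (simp add: j_def)
    finally show ?thesis .
  qed
  define C where "C = j powr (1 / \<rho>) / A"
  have C: "0 < C" using j A by (simp add: C_def)
  have "(\<integral>\<^sup>+x. ennreal (\<bar>\<phi> x\<bar> powr \<rho>) \<partial>power_weight \<gamma>) \<le> ennreal ((C * t) powr \<rho>)"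
    if \<phi>: "newton_pair A \<phi> w" and t: "source_norm p w < t" for \<phi> w :: "'a \<Rightarrow> real" and t
  proof -
    have t0: "0 < t" using t source_norm_nonneg[of p w] by linarith
    have w: "bounded_supp w" using \<phi> by (simp add: newton_pair_def)
    have [measurable]: "\<phi> \<in> borel_measurable borel" using \<phi> by (simp add: newton_pair_def)
    have us: "unit_source p (\<lambda>x. w x / t)" by (rule unit_source_scale[OF w p t])
    let ?u = "convol ?K (\<lambda>y. \<bar>w y / t\<bar>)"
    have [measurable]: "(\<lambda>y. \<bar>w y / t\<bar>) \<in> borel_measurable borel"
      using us by (intro bounded_suppD bounded_supp_abs) (simp add: unit_source_def)
    have pt: "\<bar>\<phi> x\<bar> powr \<rho> * norm x powr (-\<gamma>) \<le> (t / A) powr \<rho> * (?u x powr \<rho> * norm x powr (-\<gamma>))" for x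
    proof -
      have "A * \<phi> x = - (t * convol ?K (\<lambda>y. w y / t) x)"
        using \<phi> t0 by (simp add: newton_pair_def convol_scale)
      then have "\<phi> x = - (t / A) * convol ?K (\<lambda>y. w y / t) x" using A by (simp add: field_simps)
      then have "\<bar>\<phi> x\<bar> = t / A * \<bar>convol ?K (\<lambda>y. w y / t) x\<bar>" using t0 A by (simp add: abs_mult)
      also have "\<dots> \<le> t / A * ?u x"
        using t0 A by (intro mult_left_mono abs_convol_le) auto
      finally have "\<bar>\<phi> x\<bar> powr \<rho> \<le> (t / A * ?u x) powr \<rho>" using \<rho>(2) by (intro powr_mono2) auto
      also have "\<dots> = (t / A) powr \<rho> * ?u x powr \<rho>"
        using t0 A by (subst powr_mult) (auto simp: convol_def intro!: integral_nonneg_AE)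
      finally show ?thesis by (simp add: mult.assoc[symmetric] mult_right_mono)
    qed
    have "(\<integral>\<^sup>+x. ennreal (\<bar>\<phi> x\<bar> powr \<rho>) \<partial>power_weight \<gamma>) = (\<integral>\<^sup>+x. ennreal (\<bar>\<phi> x\<bar> powr \<rho> * norm x powr (-\<gamma>)) \<partial>lborel)"
      by (rule nn_integral_power_weight) auto
    also have "\<dots> \<le> (\<integral>\<^sup>+x. ennreal ((t / A) powr \<rho>) * ennreal (?u x powr \<rho> * norm x powr (-\<gamma>)) \<partial>lborel)"
      using pt by (intro nn_integral_mono) (simp add: ennreal_mult[symmetric] ennreal_leI)
    also have "\<dots> = ennreal ((t / A) powr \<rho>) * (\<integral>\<^sup>+x. ennreal (?u x powr \<rho> * norm x powr (-\<gamma>)) \<partial>lborel)"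
      by (rule nn_integral_cmult) measurable
    also have "\<dots> \<le> ennreal ((t / A) powr \<rho>) * ennreal j"
      by (intro mult_left_mono J us) auto
    also have "\<dots> = ennreal ((t / A) powr \<rho> * j)" using j by (simp add: ennreal_mult[symmetric])
    also have "(t / A) powr \<rho> * j = (C * t) powr \<rho>"
    proof -
      have "(C * t) powr \<rho> = (j powr (1 / \<rho>) * (t / A)) powr \<rho>" by (simp add: C_def)
      also have "\<dots> = (j powr (1 / \<rho>)) powr \<rho> * (t / A) powr \<rho>" using t0 A by (subst powr_mult) auto
      also have "(j powr (1 / \<rho>)) powr \<rho> = j" using \<rho>(2) j by (simp add: powr_powr)
      finally show ?thesis by (simp add: mult.commute)
    qed
    finally show ?thesis .
  qed
  with C show ?thesis by blast
qed

text \<open>Division by the common bound t makes all sources unit sources; the power of t / A then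
  factors out of the weighted integral.\<close>

lemma newton_pair_Cauchy_subsequence:
  fixes p \<gamma> \<rho> :: real and \<phi> w :: "nat \<Rightarrow> 'a::euclidean_space \<Rightarrow> real"
  assumes n: "3 \<le> DIM('a)" and p: "1 < p" "p < real DIM('a) / 2"
    and \<gamma>: "0 < \<gamma>" "\<gamma> < real DIM('a)" and \<rho>: "p_star DIM('a) p \<le> \<rho>" "0 < \<rho>" and A: "0 < A"
    and \<phi>: "\<And>k. newton_pair A (\<phi> k) (w k)" and t: "\<And>k. source_norm p (w k) < t"
  shows "\<exists>r :: nat \<Rightarrow> nat. strict_mono r \<and> (\<forall>e>0. \<exists>N. \<forall>k\<ge>N. \<forall>l\<ge>N.
     (\<integral>\<^sup>+x. ennreal (\<bar>\<phi> (r k) x - \<phi> (r l) x\<bar> powr \<rho>) \<partial>power_weight \<gamma>) \<le> ennreal e)"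
proof -
  have t0: "0 < t" using t[of 0] source_norm_nonneg[of p "w 0"] by linarith
  have us: "unit_source p (\<lambda>x. w k x / t)" for k
    using \<phi> t p by (intro unit_source_scale) (auto simp: newton_pair_def)
  let ?K = "newton_kernel 0 :: 'a \<Rightarrow> real"
  obtain r :: "nat \<Rightarrow> nat" where r0: "strict_mono r \<and> (\<forall>e>0. \<exists>N. \<forall>k\<ge>N. \<forall>l\<ge>N.
      (\<integral>\<^sup>+x. ennreal (\<bar>convol ?K (\<lambda>x. w (r k) x / t) x - convol ?K (\<lambda>x. w (r l) x / t) x\<bar> powr \<rho>
         * norm x powr (-\<gamma>)) \<partial>lborel) \<le> ennreal e)"
    using weighted_potential_Cauchy_subsequence[OF n p \<gamma> \<rho> us] by (rule exE)
  have \<phi>K: "\<phi> k x = - (t / A) * convol ?K (\<lambda>y. w k y / t) x" for k x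
  proof -
    have "A * \<phi> k x = - (t * convol ?K (\<lambda>y. w k y / t) x)"
      using \<phi>[of k] t0 by (simp add: newton_pair_def convol_scale)
    then show ?thesis using A by (simp add: field_simps)
  qed
  have [measurable]: "\<phi> k \<in> borel_measurable borel" for k using \<phi>[of k] by (simp add: newton_pair_def)
  have wm[measurable]: "(\<lambda>y. w k y / t) \<in> borel_measurable borel" for k
    using us[of k] by (intro bounded_suppD) (simp add: unit_source_def)
  have eq: "(\<integral>\<^sup>+x. ennreal (\<bar>\<phi> k x - \<phi> l x\<bar> powr \<rho>) \<partial>power_weight \<gamma>) = ennreal ((t / A) powr \<rho>) *
     (\<integral>\<^sup>+x. ennreal (\<bar>convol ?K (\<lambda>x. w k x / t) x - convol ?K (\<lambda>x. w l x / t) x\<bar> powr \<rho> * norm x powr (-\<gamma>)) \<partial>lborel)" for k l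
  proof -
    have "(\<integral>\<^sup>+x. ennreal (\<bar>\<phi> k x - \<phi> l x\<bar> powr \<rho>) \<partial>power_weight \<gamma>) = (\<integral>\<^sup>+x. ennreal (\<bar>\<phi> k x - \<phi> l x\<bar> powr \<rho> * norm x powr (-\<gamma>)) \<partial>lborel)"
      by (rule nn_integral_power_weight) auto
    also have "\<dots> = (\<integral>\<^sup>+x. ennreal ((t / A) powr \<rho>) *
       ennreal (\<bar>convol ?K (\<lambda>x. w k x / t) x - convol ?K (\<lambda>x. w l x / t) x\<bar> powr \<rho> * norm x powr (-\<gamma>)) \<partial>lborel)"
    proof (rule nn_integral_cong)
      fix x
      let ?a = "convol ?K (\<lambda>x. w k x / t) x" and ?b = "convol ?K (\<lambda>x. w l x / t) x"
      have "\<phi> k x - \<phi> l x = - (t / A) * (?a - ?b)" by (simp only: \<phi>K right_diff_distrib)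
      then have "\<bar>\<phi> k x - \<phi> l x\<bar> = t / A * \<bar>?a - ?b\<bar>" using t0 A by (simp add: abs_mult)
      then have "\<bar>\<phi> k x - \<phi> l x\<bar> powr \<rho> = (t / A) powr \<rho> * \<bar>?a - ?b\<bar> powr \<rho>"
        using t0 A by (simp only: powr_mult)
      then show "ennreal (\<bar>\<phi> k x - \<phi> l x\<bar> powr \<rho> * norm x powr (-\<gamma>))
         = ennreal ((t / A) powr \<rho>) * ennreal (\<bar>?a - ?b\<bar> powr \<rho> * norm x powr (-\<gamma>))"
        by (simp only: mult.assoc) (simp add: ennreal_mult[symmetric])
    qed
    also have "\<dots> = ennreal ((t / A) powr \<rho>) *
     (\<integral>\<^sup>+x. ennreal (\<bar>convol ?K (\<lambda>x. w k x / t) x - convol ?K (\<lambda>x. w l x / t) x\<bar> powr \<rho> * norm x powr (-\<gamma>)) \<partial>lborel)"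
      by (rule nn_integral_cmult) measurable
    finally show ?thesis .
  qed
  have "\<exists>N. \<forall>k\<ge>N. \<forall>l\<ge>N. (\<integral>\<^sup>+x. ennreal (\<bar>\<phi> (r k) x - \<phi> (r l) x\<bar> powr \<rho>) \<partial>power_weight \<gamma>) \<le> ennreal e"
    if e: "0 < e" for e
  proof -
    let ?c = "(t / A) powr \<rho>"
    have c: "0 < ?c" using t0 A by simp
    then have ec: "0 < e / ?c" using e by simp
    obtain N where N: "\<forall>k\<ge>N. \<forall>l\<ge>N.
      (\<integral>\<^sup>+x. ennreal (\<bar>convol ?K (\<lambda>x. w (r k) x / t) x - convol ?K (\<lambda>x. w (r l) x / t) x\<bar> powr \<rho>
         * norm x powr (-\<gamma>)) \<partial>lborel) \<le> ennreal (e / ?c)"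
      using conjunct2[OF r0, rule_format, OF ec] by (rule exE)
    have "(\<integral>\<^sup>+x. ennreal (\<bar>\<phi> (r k) x - \<phi> (r l) x\<bar> powr \<rho>) \<partial>power_weight \<gamma>) \<le> ennreal e" if "N \<le> k" "N \<le> l" for k l
    proof -
      have "(\<integral>\<^sup>+x. ennreal (\<bar>\<phi> (r k) x - \<phi> (r l) x\<bar> powr \<rho>) \<partial>power_weight \<gamma>) \<le> ennreal ?c * ennreal (e / ?c)"
        unfolding eq using N that by (intro mult_left_mono) auto
      also have "\<dots> = ennreal e" using c e by (subst ennreal_mult[symmetric]) auto
      finally show ?thesis .
    qed
    then show ?thesis by blast
  qed
  with r0 show ?thesis by blast
qed

section \<open>Passage from test functions to the completion\<close>

text \<open>A subsequence upgrades convergence in the critical Lebesgue space to convergence almost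
  everywhere, the form that Fatou's lemma takes. The 8 is the 4 of the weak triangle inequality
  times the 2 of \<open>source_norm_le\<close>.\<close>

lemma E_space_sequence:
  fixes u :: "'a::euclidean_space \<Rightarrow> real"
  assumes u: "u \<in> E_space p" and p: "1 < p" "p < real DIM('a) / 2" and n: "2 \<le> DIM('a)"
  shows "\<exists>\<phi> :: nat \<Rightarrow> 'a \<Rightarrow> real. (\<forall>k. \<phi> k \<in> test_functions) \<and> (AE x in lebesgue. (\<lambda>k. \<phi> k x) \<longlonglongrightarrow> u x) \<and>
     (\<forall>\<delta>>0. \<exists>N. \<forall>k\<ge>N. source_norm p (laplacian (\<phi> k)) < 8 * E_norm p u + \<delta>) \<and>
     (\<forall>\<delta>>0. \<exists>N. \<forall>k\<ge>N. \<forall>l\<ge>N. source_norm p (\<lambda>x. laplacian (\<phi> k) x - laplacian (\<phi> l) x) < \<delta>)"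
proof -
  let ?n = "real DIM('a)" and ?w = "distr_laplacian u" and ?s = "p_star DIM('a) p"
  have "0 < ?n - 2 * p" "p < ?n" using p by auto
  \<comment> \<open>The critical exponent exceeds p, since it is p times n/(n - 2p) with 0 < n - 2p
    < n.\<close>
  then have s: "1 \<le> ?s" using p by (auto simp: p_star_def pos_le_divide_eq algebra_simps)
     (smt (verit) mult_less_cancel_right1 p(1))
  obtain \<phi> :: "nat \<Rightarrow> 'a \<Rightarrow> real" where \<phi>: "\<And>k. \<phi> k \<in> test_functions"
    "(\<lambda>k. Lp_norm ?s lebesgue (\<lambda>x. \<phi> k x - u x)) \<longlonglongrightarrow> 0"
    "(\<lambda>k. laplacian_norm p (\<lambda>x. laplacian (\<phi> k) x - ?w x)) \<longlonglongrightarrow> 0"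
    using u unfolding E_space_def by blast
  have w: "?w \<in> Lp_space p lebesgue \<inter> Lp_space (?n / 2) lebesgue" and us: "u \<in> Lp_space ?s lebesgue"
    using u unfolding E_space_def by blast+
  have d: "(\<lambda>x. \<phi> k x - u x) \<in> Lp_space ?s lebesgue" for k
    using s by (intro Lp_diff us bounded_supp_Lp_space test_function_bounded_supp \<phi>) auto
  obtain r :: "nat \<Rightarrow> nat" where r: "strict_mono r" "AE x in lebesgue. (\<lambda>k. \<phi> (r k) x - u x) \<longlonglongrightarrow> 0"
    using Lp_norm_tendsto_0_AE_subsequence[OF d _ \<phi>(2)] s by auto
  have ae: "AE x in lebesgue. (\<lambda>k. \<phi> (r k) x) \<longlonglongrightarrow> u x"
    using r(2) by eventually_elim (simp add: LIM_zero_iff)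
  define z where "z k x = laplacian (\<phi> (r k)) x - ?w x" for k x
  have Lz: "laplacian (\<phi> (r k)) \<in> Lp_space p lebesgue \<inter> Lp_space (?n / 2) lebesgue" for k
    using p by (auto intro!: bounded_supp_Lp_space test_function_laplacian \<phi>)
  have z: "z k \<in> Lp_space p lebesgue \<inter> Lp_space (?n / 2) lebesgue" for k
    unfolding z_def[abs_def] using p w Lz by (auto intro!: Lp_diff)
  have lim: "(\<lambda>k. laplacian_norm p (z k)) \<longlonglongrightarrow> 0"
    using LIMSEQ_subseq_LIMSEQ[OF \<phi>(3) r(1)] by (simp add: o_def z_def[abs_def])
  have small: "\<exists>N. \<forall>k\<ge>N. laplacian_norm p (z k) < \<delta>" if "0 < \<delta>" for \<delta>
    using order_tendstoD(2)[OF lim that] by (simp add: eventually_sequentially)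
  have 1: "\<exists>N. \<forall>k\<ge>N. source_norm p (laplacian (\<phi> (r k))) < 8 * E_norm p u + \<delta>" if \<delta>: "0 < \<delta>" for \<delta>
  proof -
    obtain N where N: "\<forall>k\<ge>N. laplacian_norm p (z k) < \<delta> / 8" using small[of "\<delta> / 8"] \<delta> by auto
    have "source_norm p (laplacian (\<phi> (r k))) < 8 * E_norm p u + \<delta>" if "N \<le> k" for k
    proof -
      have "source_norm p (\<lambda>x. z k x + ?w x) \<le> 4 * (source_norm p (z k) + source_norm p ?w)"
        by (rule source_norm_add(1)[OF z w p])
      also have "\<dots> \<le> 4 * (2 * laplacian_norm p (z k) + 2 * laplacian_norm p ?w)"
        by (intro mult_left_mono add_mono source_norm_le) auto
      also have "\<dots> < 8 * E_norm p u + \<delta>"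
        using N that by (auto simp: E_norm_def algebra_simps)
      finally show ?thesis by (simp add: z_def)
    qed
    then show ?thesis by blast
  qed
  have 2: "\<exists>N. \<forall>k\<ge>N. \<forall>l\<ge>N. source_norm p (\<lambda>x. laplacian (\<phi> (r k)) x - laplacian (\<phi> (r l)) x) < \<delta>"
    if \<delta>: "0 < \<delta>" for \<delta>
  proof -
    \<comment> \<open>Both k and l contribute 8 times their distance to u.\<close>
    obtain N where N: "\<forall>k\<ge>N. laplacian_norm p (z k) < \<delta> / 16" using small[of "\<delta> / 16"] \<delta> by auto
    have "source_norm p (\<lambda>x. laplacian (\<phi> (r k)) x - laplacian (\<phi> (r l)) x) < \<delta>" if kl: "N \<le> k" "N \<le> l" for k l
    proof -
      have "source_norm p (\<lambda>x. z k x - z l x) \<le> 4 * (source_norm p (z k) + source_norm p (z l))"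
        by (rule source_norm_add(2)[OF z z p])
      also have "\<dots> \<le> 4 * (2 * laplacian_norm p (z k) + 2 * laplacian_norm p (z l))"
        by (intro mult_left_mono add_mono source_norm_le) auto
      also have "\<dots> < \<delta>" using N[rule_format, OF kl(1)] N[rule_format, OF kl(2)] by simp
      finally show ?thesis by (simp add: z_def)
    qed
    then show ?thesis by blast
  qed
  show ?thesis
    by (rule exI[of _ "\<lambda>k. \<phi> (r k)"]) (use \<phi>(1) ae 1 2 in blast)
qed

text \<open>Fatou's lemma along the approximating sequence, used twice. Applied to \<phi> k it gives
  continuity of the embedding; applied to \<phi> k - \<phi> l with k fixed it shows that \<phi> k
  approximates u in the weighted norm, because the Laplacians form a Cauchy sequence.\<close>

lemma E_space_bound:
  fixes p \<gamma> \<rho> :: real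
  assumes n: "3 \<le> DIM('a::euclidean_space)" and p: "1 < p" "p < real DIM('a) / 2"
    and \<gamma>: "0 < \<gamma>" "\<gamma> < real DIM('a)" and \<rho>: "p_star DIM('a) p \<le> \<rho>" "0 < \<rho>"
    and A: "0 < A" "\<And>\<phi>::'a \<Rightarrow> real. \<phi> \<in> test_functions \<Longrightarrow> newton_pair A \<phi> (laplacian \<phi>)"
  shows "\<exists>C>0. \<forall>u \<in> (E_space p :: ('a \<Rightarrow> real) set).
     (\<forall>t>8 * E_norm p u. (\<integral>\<^sup>+x. ennreal (\<bar>u x\<bar> powr \<rho>) \<partial>power_weight \<gamma>) \<le> ennreal ((C * t) powr \<rho>)) \<and>
     (\<forall>t>0. \<exists>\<phi>\<in>test_functions. source_norm p (laplacian \<phi>) < 8 * E_norm p u + 1 \<and>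
        (\<integral>\<^sup>+x. ennreal (\<bar>\<phi> x - u x\<bar> powr \<rho>) \<partial>power_weight \<gamma>) \<le> ennreal ((C * t) powr \<rho>))"
proof -
  obtain C where C: "0 < C" and bound: "\<And>\<phi> w t. newton_pair A \<phi> w \<Longrightarrow> source_norm p (w :: 'a \<Rightarrow> real) < t \<Longrightarrow>
     (\<integral>\<^sup>+x. ennreal (\<bar>\<phi> x\<bar> powr \<rho>) \<partial>power_weight \<gamma>) \<le> ennreal ((C * t) powr \<rho>)"
    using newton_pair_bound[OF n p \<gamma> \<rho> A(1)] by auto
  have n2: "2 \<le> DIM('a)" using n by simp
  show ?thesis
  proof (rule exI[of _ C], intro conjI ballI allI impI C)
    fix u :: "'a \<Rightarrow> real" and t
    assume u: "u \<in> E_space p"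
    obtain \<phi> :: "nat \<Rightarrow> 'a \<Rightarrow> real" where \<phi>: "(\<forall>k. \<phi> k \<in> test_functions) \<and> (AE x in lebesgue. (\<lambda>k. \<phi> k x) \<longlonglongrightarrow> u x) \<and>
     (\<forall>\<delta>>0. \<exists>N. \<forall>k\<ge>N. source_norm p (laplacian (\<phi> k)) < 8 * E_norm p u + \<delta>) \<and>
     (\<forall>\<delta>>0. \<exists>N. \<forall>k\<ge>N. \<forall>l\<ge>N. source_norm p (\<lambda>x. laplacian (\<phi> k) x - laplacian (\<phi> l) x) < \<delta>)"
      using E_space_sequence[OF u p n2] by (rule exE)
    note \<phi>N = \<phi>[THEN conjunct2, THEN conjunct2, THEN conjunct1]
    note \<phi>C = \<phi>[THEN conjunct2, THEN conjunct2, THEN conjunct2]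
    have pr: "newton_pair A (\<phi> k) (laplacian (\<phi> k))" for k using A(2) \<phi> by simp
    have ae: "AE x in power_weight \<gamma>. (\<lambda>k. \<phi> k x) \<longlonglongrightarrow> u x"
      using \<phi> by (intro AE_power_weight) simp
    have um: "u \<in> borel_measurable (power_weight \<gamma>)"
      using u unfolding borel_measurable_power_weight by (auto simp: E_space_def dest: Lp_spaceD)
    have \<phi>m: "\<phi> k \<in> borel_measurable (power_weight \<gamma>)" for k
      unfolding borel_measurable_power_weight using pr[of k]
      by (intro measurable_completion) (simp add: newton_pair_def)
    show "(\<integral>\<^sup>+x. ennreal (\<bar>u x\<bar> powr \<rho>) \<partial>power_weight \<gamma>) \<le> ennreal ((C * t) powr \<rho>)" if t: "8 * E_norm p u < t"
    proof -
      have pos: "0 < t - 8 * E_norm p u" using t by simp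
      obtain N where N: "\<forall>k\<ge>N. source_norm p (laplacian (\<phi> k)) < 8 * E_norm p u + (t - 8 * E_norm p u)"
        using \<phi>N[rule_format, OF pos] by (rule exE)
      have le: "(\<integral>\<^sup>+x. ennreal (\<bar>\<phi> k x\<bar> powr \<rho>) \<partial>power_weight \<gamma>) \<le> ennreal ((C * t) powr \<rho>)" if "N \<le> k" for k
        by (rule bound[OF pr]) (use N[rule_format, OF that] in simp)
      show ?thesis by (rule nn_integral_powr_Fatou[OF \<phi>m um \<rho>(2) ae le])
    qed
    show "\<exists>\<phi>\<in>test_functions. source_norm p (laplacian \<phi>) < 8 * E_norm p u + 1 \<and>
        (\<integral>\<^sup>+x. ennreal (\<bar>\<phi> x - u x\<bar> powr \<rho>) \<partial>power_weight \<gamma>) \<le> ennreal ((C * t) powr \<rho>)" if t: "0 < t"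
    proof -
      obtain N1 where N1: "\<forall>k\<ge>N1. source_norm p (laplacian (\<phi> k)) < 8 * E_norm p u + 1"
        using \<phi>N[rule_format, OF zero_less_one] by (rule exE)
      obtain N2 where N2: "\<forall>k\<ge>N2. \<forall>l\<ge>N2. source_norm p (\<lambda>x. laplacian (\<phi> k) x - laplacian (\<phi> l) x) < t"
        using \<phi>C[rule_format, OF t] by (rule exE)
      define k where "k = max N1 N2"
      have "(\<integral>\<^sup>+x. ennreal (\<bar>\<phi> k x - u x\<bar> powr \<rho>) \<partial>power_weight \<gamma>) \<le> ennreal ((C * t) powr \<rho>)"
      proof (rule nn_integral_powr_Fatou[where f = "\<lambda>l x. \<phi> k x - \<phi> l x" and N = N2])
        show "AE x in power_weight \<gamma>. (\<lambda>l. \<phi> k x - \<phi> l x) \<longlonglongrightarrow> \<phi> k x - u x"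
          using ae by eventually_elim (intro tendsto_diff tendsto_const)
        show "(\<integral>\<^sup>+x. ennreal (\<bar>\<phi> k x - \<phi> l x\<bar> powr \<rho>) \<partial>power_weight \<gamma>) \<le> ennreal ((C * t) powr \<rho>)" if "N2 \<le> l" for l
          by (rule bound[OF newton_pair_diff[OF n pr pr]]) (use N2 that in \<open>simp add: k_def\<close>)
      qed (use \<phi>m um \<rho>(2) in \<open>auto intro: borel_measurable_diff\<close>)
      moreover have "source_norm p (laplacian (\<phi> k)) < 8 * E_norm p u + 1" using N1 by (simp add: k_def)
      ultimately show ?thesis using \<phi> by blast
    qed
  qed
qed

lemma p_star_pos: "1 < p \<Longrightarrow> p < real n / 2 \<Longrightarrow> 0 < p_star n p"
  unfolding p_star_def by (intro divide_pos_pos mult_pos_pos) auto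

lemma E_norm_nonneg: "0 \<le> E_norm p u"
  by (simp add: E_norm_def laplacian_norm_def Let_def)

text \<open>For compactness each u k is traded for a test function at weighted distance at most
  C/(k+1) with a comparable source norm. A subsequence of these is Cauchy, and its limit in the
  weighted space is also the limit of the u k.\<close>

theorem E_space_compact_embedding:
  fixes p \<gamma> \<rho> :: real
  assumes n: "3 \<le> DIM('a::euclidean_space)" and p: "1 < p" "p < real DIM('a) / 2"
    and \<gamma>: "0 < \<gamma>" "\<gamma> < real DIM('a)" and \<rho>: "p_star DIM('a) p \<le> \<rho>"
  shows "compact_embedding (E_space p :: ('a \<Rightarrow> real) set) (E_norm p)
           (Lp_space \<rho> (power_weight \<gamma>)) (Lp_norm \<rho> (power_weight \<gamma>))"
proof -
  have \<rho>0: "0 < \<rho>" using p_star_pos[OF p] \<rho> by simp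
  let ?M = "power_weight \<gamma> :: 'a measure"
  obtain A where A: "0 < A" "\<And>\<phi>::'a \<Rightarrow> real. \<phi> \<in> test_functions \<Longrightarrow> newton_pair A \<phi> (laplacian \<phi>)"
    using newton_pair_laplacian[OF n] by blast
  obtain C where CE: "0 < C \<and> (\<forall>u \<in> (E_space p :: ('a \<Rightarrow> real) set).
     (\<forall>t>8 * E_norm p u. (\<integral>\<^sup>+x. ennreal (\<bar>u x\<bar> powr \<rho>) \<partial>?M) \<le> ennreal ((C * t) powr \<rho>)) \<and>
     (\<forall>t>0. \<exists>\<phi>\<in>test_functions. source_norm p (laplacian \<phi>) < 8 * E_norm p u + 1 \<and>
        (\<integral>\<^sup>+x. ennreal (\<bar>\<phi> x - u x\<bar> powr \<rho>) \<partial>?M) \<le> ennreal ((C * t) powr \<rho>)))"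
    using E_space_bound[OF n p \<gamma> \<rho> \<rho>0 A] by (rule exE)
  note C = conjunct1[OF CE] and E0 = conjunct2[OF CE]
  have um: "u \<in> borel_measurable ?M" if "u \<in> E_space p" for u
    using that unfolding borel_measurable_power_weight by (auto simp: E_space_def dest: Lp_spaceD)
  have in_Y: "u \<in> Lp_space \<rho> ?M" and le_Y: "Lp_norm \<rho> ?M u \<le> 8 * C * E_norm p u" if u: "u \<in> E_space p" for u
  proof -
    have le: "(\<integral>\<^sup>+x. ennreal (\<bar>u x\<bar> powr \<rho>) \<partial>?M) \<le> ennreal ((C * t) powr \<rho>)" if "8 * E_norm p u < t" for t
      using E0 u that by blast
    note Y = nn_Lp_imp_Lp[OF \<rho>0 um[OF u] powr_ge_zero le]
    show "u \<in> Lp_space \<rho> ?M" by (rule Y(1)[of "8 * E_norm p u + 1"]) simp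
    have "Lp_norm \<rho> ?M u / C \<le> t" if t: "8 * E_norm p u < t" for t
    proof -
      have "0 < t" using t E_norm_nonneg[of p u] by simp
      then show ?thesis using Y(2)[OF t] C \<rho>0 by (simp add: powr_powr pos_divide_le_eq mult.commute)
    qed
    \<comment> \<open>The estimate is known for every t above the right-hand side; letting t
      decrease to it also covers elements of norm 0.\<close>
    then have "Lp_norm \<rho> ?M u / C \<le> 8 * E_norm p u" by (rule dense_ge)
    then show "Lp_norm \<rho> ?M u \<le> 8 * C * E_norm p u" using C by (simp add: pos_divide_le_eq mult_ac)
  qed
  have cpt: "\<exists>r v. strict_mono (r :: nat \<Rightarrow> nat) \<and> v \<in> Lp_space \<rho> ?M \<and>
      (\<lambda>k. Lp_norm \<rho> ?M (\<lambda>x. u (r k) x - v x)) \<longlonglongrightarrow> 0"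
    if u: "\<And>k::nat. u k \<in> E_space p" and B: "\<And>k. E_norm p (u k) \<le> B" for u and B
  proof -
    let ?t = "\<lambda>k. inverse (real (Suc k))"
    define Q where "Q k \<phi> \<longleftrightarrow> \<phi> \<in> test_functions \<and> source_norm p (laplacian \<phi>) < 8 * E_norm p (u k) + 1 \<and>
        (\<integral>\<^sup>+x. ennreal (\<bar>\<phi> x - u k x\<bar> powr \<rho>) \<partial>?M) \<le> ennreal ((C * ?t k) powr \<rho>)" for k \<phi>
    have "\<exists>\<phi>. Q k \<phi>" for k
    proof -
      have t: "0 < ?t k" by simp
      show ?thesis unfolding Q_def
        using conjunct2[OF E0[rule_format, OF u[of k]], rule_format, OF t] unfolding Bex_def .
    qed
    then obtain \<phi> where "\<And>k. Q k (\<phi> k)" by metis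
    then have \<phi>: "\<phi> k \<in> test_functions"
      "source_norm p (laplacian (\<phi> k)) < 8 * E_norm p (u k) + 1"
      "(\<integral>\<^sup>+x. ennreal (\<bar>\<phi> k x - u k x\<bar> powr \<rho>) \<partial>?M) \<le> ennreal ((C * ?t k) powr \<rho>)" for k
      by (simp_all only: Q_def)
    have sn: "source_norm p (laplacian (\<phi> k)) < 8 * B + 1" for k
      using \<phi>(2)[of k] B[of k] by linarith
    obtain r :: "nat \<Rightarrow> nat" where r0: "strict_mono r \<and> (\<forall>e>0. \<exists>N. \<forall>k\<ge>N. \<forall>l\<ge>N.
       (\<integral>\<^sup>+x. ennreal (\<bar>\<phi> (r k) x - \<phi> (r l) x\<bar> powr \<rho>) \<partial>?M) \<le> ennreal e)"
      using newton_pair_Cauchy_subsequence[OF n p \<gamma> \<rho> \<rho>0 A(1) A(2)[OF \<phi>(1)] sn] by (rule exE)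
    have \<phi>m[measurable]: "\<phi> k \<in> borel_measurable ?M" for k
      unfolding borel_measurable_power_weight using A(2)[OF \<phi>(1), of k]
      by (intro measurable_completion) (simp add: newton_pair_def)
    note [measurable] = um[OF u]
    obtain v where vm[measurable]: "v \<in> borel_measurable ?M"
      and v: "\<forall>e>0. \<exists>N. \<forall>k\<ge>N. (\<integral>\<^sup>+x. ennreal (\<bar>\<phi> (r k) x - v x\<bar> powr \<rho>) \<partial>?M) \<le> ennreal e"
      using Lp_complete[of "\<lambda>k. \<phi> (r k)" ?M \<rho>, OF \<phi>m \<rho>0] r0 by blast
    have dm: "(\<lambda>x. u (r k) x - v x) \<in> borel_measurable ?M" for k by measurable
    have small: "\<exists>N. \<forall>k\<ge>N. (\<integral>\<^sup>+x. ennreal (\<bar>u (r k) x - v x\<bar> powr \<rho>) \<partial>?M) \<le> ennreal (\<delta> powr \<rho>)"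
      if \<delta>: "0 < \<delta>" for \<delta>
    proof -
      \<comment> \<open>Half of \<delta>^\<rho> for each of the two distances, after removal of the
        factor \<open>2 powr \<rho>\<close> from the weak triangle inequality.\<close>
      define e where "e = \<delta> powr \<rho> / (2 * 2 powr \<rho>)"
      have e: "0 < e" "2 powr \<rho> * (e + e) = \<delta> powr \<rho>" using \<delta> by (auto simp: e_def)
      obtain N1 where N1: "\<forall>k\<ge>N1. (\<integral>\<^sup>+x. ennreal (\<bar>\<phi> (r k) x - v x\<bar> powr \<rho>) \<partial>?M) \<le> ennreal e"
        using v e(1) by blast
      have "(\<lambda>k. C * ?t (r k)) \<longlonglongrightarrow> C * 0"
        using LIMSEQ_subseq_LIMSEQ[OF LIMSEQ_inverse_real_of_nat conjunct1[OF r0]]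
        by (intro tendsto_mult tendsto_const) (simp add: o_def)
      then have "(\<lambda>k. C * ?t (r k)) \<longlonglongrightarrow> 0" by simp
      then have "(\<lambda>k. (C * ?t (r k)) powr \<rho>) \<longlonglongrightarrow> 0"
        using C \<rho>0 by (intro tendsto_zero_powrI[OF _ tendsto_const]) auto
      from order_tendstoD(2)[OF this e(1)] obtain N2 where N2: "\<forall>k\<ge>N2. (C * ?t (r k)) powr \<rho> < e"
        by (auto simp: eventually_sequentially)
      have "(\<integral>\<^sup>+x. ennreal (\<bar>u (r k) x - v x\<bar> powr \<rho>) \<partial>?M) \<le> ennreal (\<delta> powr \<rho>)" if k: "max N1 N2 \<le> k" for k
      proof -
        have "(\<integral>\<^sup>+x. ennreal (\<bar>u (r k) x - v x\<bar> powr \<rho>) \<partial>?M)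
          = (\<integral>\<^sup>+x. ennreal (\<bar>(u (r k) x - \<phi> (r k) x) + (\<phi> (r k) x - v x)\<bar> powr \<rho>) \<partial>?M)" by simp
        also have "\<dots> \<le> ennreal (2 powr \<rho>) * ((\<integral>\<^sup>+x. ennreal (\<bar>u (r k) x - \<phi> (r k) x\<bar> powr \<rho>) \<partial>?M)
            + (\<integral>\<^sup>+x. ennreal (\<bar>\<phi> (r k) x - v x\<bar> powr \<rho>) \<partial>?M))"
          by (rule nn_integral_powr_add_le[OF _ _ \<rho>0]) measurable
        also have "\<dots> \<le> ennreal (2 powr \<rho>) * (ennreal e + ennreal e)"
        proof (intro mult_left_mono add_mono)
          have "(\<integral>\<^sup>+x. ennreal (\<bar>u (r k) x - \<phi> (r k) x\<bar> powr \<rho>) \<partial>?M) \<le> ennreal ((C * ?t (r k)) powr \<rho>)"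
            using \<phi>(3)[of "r k"] by (simp only: abs_minus_commute)
          also have "\<dots> \<le> ennreal e" using N2 k by (intro ennreal_leI less_imp_le) simp
          finally show "(\<integral>\<^sup>+x. ennreal (\<bar>u (r k) x - \<phi> (r k) x\<bar> powr \<rho>) \<partial>?M) \<le> ennreal e" .
        qed (use N1 k in auto)
        also have "\<dots> = ennreal (2 powr \<rho> * (e + e))"
          using e(1) by (simp add: ennreal_plus[symmetric] ennreal_mult[symmetric] del: ennreal_plus)
        finally show ?thesis by (simp only: e(2))
      qed
      then show ?thesis by blast
    qed
    have "v \<in> Lp_space \<rho> ?M"
    proof -
      obtain k where k: "(\<integral>\<^sup>+x. ennreal (\<bar>u (r k) x - v x\<bar> powr \<rho>) \<partial>?M) \<le> ennreal (1 powr \<rho>)"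
        using small[of 1] by auto
      let ?a = "\<integral>x. \<bar>u (r k) x\<bar> powr \<rho> \<partial>?M"
      have "(\<integral>\<^sup>+x. ennreal (\<bar>v x\<bar> powr \<rho>) \<partial>?M) = (\<integral>\<^sup>+x. ennreal (\<bar>u (r k) x + (v x - u (r k) x)\<bar> powr \<rho>) \<partial>?M)" by simp
      also have "\<dots> \<le> ennreal (2 powr \<rho>) * ((\<integral>\<^sup>+x. ennreal (\<bar>u (r k) x\<bar> powr \<rho>) \<partial>?M) + (\<integral>\<^sup>+x. ennreal (\<bar>v x - u (r k) x\<bar> powr \<rho>) \<partial>?M))"
        by (rule nn_integral_powr_add_le[OF _ _ \<rho>0]) measurable
      also have "\<dots> \<le> ennreal (2 powr \<rho>) * (ennreal ?a + ennreal (1 powr \<rho>))"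
        using k by (intro mult_left_mono add_mono) (simp_all only: Lp_space_nn_integral[OF in_Y[OF u]] abs_minus_commute[of "v _"] order_refl zero_le)
      also have "\<dots> = ennreal (2 powr \<rho> * (?a + 1 powr \<rho>))"
      proof -
        have "0 \<le> ?a" by simp
        then show ?thesis by (simp only: ennreal_plus[symmetric] ennreal_mult[symmetric] powr_ge_zero add_nonneg_nonneg)
      qed
      finally show ?thesis by (intro nn_Lp_imp_Lp(1)[OF \<rho>0 vm]) simp_all
    qed
    moreover have "(\<lambda>k. Lp_norm \<rho> ?M (\<lambda>x. u (r k) x - v x)) \<longlonglongrightarrow> 0"
    proof (rule LIMSEQ_I)
      fix \<delta> :: real assume \<delta>: "0 < \<delta>"
      then obtain N where N: "\<forall>k\<ge>N. (\<integral>\<^sup>+x. ennreal (\<bar>u (r k) x - v x\<bar> powr \<rho>) \<partial>?M) \<le> ennreal ((\<delta> / 2) powr \<rho>)"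
        using small[of "\<delta> / 2"] by auto
      have "norm (Lp_norm \<rho> ?M (\<lambda>x. u (r k) x - v x) - 0) < \<delta>" if "N \<le> k" for k
      proof -
        have "Lp_norm \<rho> ?M (\<lambda>x. u (r k) x - v x) \<le> ((\<delta> / 2) powr \<rho>) powr (1 / \<rho>)"
          by (rule nn_Lp_imp_Lp(2)[OF \<rho>0 dm]) (use N that in auto)
        also have "\<dots> = \<delta> / 2" using \<rho>0 \<delta> by (simp add: powr_powr)
        finally show ?thesis using \<delta> by simp
      qed
      then show "\<exists>N. \<forall>k\<ge>N. norm (Lp_norm \<rho> ?M (\<lambda>x. u (r k) x - v x) - 0) < \<delta>" by blast
    qed
    ultimately show ?thesis using r0 by blast
  qed
  show ?thesis
    unfolding compact_embedding_def
  proof (intro conjI allI impI)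
    show "E_space p \<subseteq> Lp_space \<rho> ?M" using in_Y by blast
    show "\<exists>C. \<forall>u\<in>E_space p. Lp_norm \<rho> ?M u \<le> C * E_norm p u" using le_Y by blast
  next
    fix u :: "nat \<Rightarrow> 'a \<Rightarrow> real"
    assume "(\<forall>k. u k \<in> E_space p) \<and> (\<exists>B. \<forall>k. E_norm p (u k) \<le> B)"
    then obtain B where "\<And>k. u k \<in> E_space p" "\<And>k. E_norm p (u k) \<le> B" by auto
    then show "\<exists>r v. strict_mono (r :: nat \<Rightarrow> nat) \<and> v \<in> Lp_space \<rho> ?M \<and>
      (\<lambda>k. Lp_norm \<rho> ?M (\<lambda>x. u (r k) x - v x)) \<longlonglongrightarrow> 0" by (rule cpt)
  qed
qed

theorem theorem1p5:
  fixes p \<gamma> \<rho> :: real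
  assumes "CARD('n::finite) \<ge> 4"
    and "1 < p" and "p < real CARD('n) / 2"
    and "0 < \<gamma>" and "\<gamma> < real CARD('n)"
    and "p_star CARD('n) p \<le> \<rho>"
  shows "compact_embedding
           (E_space p :: (real ^ 'n \<Rightarrow> real) set) (E_norm p)
           (Lp_space \<rho> (power_weight \<gamma>)) (Lp_norm \<rho> (power_weight \<gamma>))"
  by (rule E_space_compact_embedding) (use assms in simp_all)

end
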